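(* Let $k\ge 3$, let $T$ be an ordinary tree and let $T^k$ be its $k$th power. Suppose that $T^k$ has $n$ vertices. Then $$\rho(\mathcal{A}(\mathcal{P}_{n,k}))\leq \rho(\mathcal{A}(T^k))\leq \rho(\mathcal{A}(\mathcal{S}_{n,k})),$$ $$\rho(\mathcal{Q}(\mathcal{P}_{n,k}))\leq \rho(\mathcal{Q}(T^k))\leq \rho(\mathcal{Q}(\mathcal{S}_{n,k})),$$ $$\rho(\mathcal{Q}^{*}(\mathcal{P}_{n,k}))\leq \rho(\mathcal{Q}^{*}(T^k))\leq \rho(\mathcal{Q}^{*}(\mathcal{S}_{n,k})).$$ Moreover, for each one of the three left inequalities, equality holds if and only if $T^k\cong \mathcal{P}_{n,k}$, and for each one of the three right inequalities, equality holds if and only if $T^k\cong \mathcal{S}_{n,k}$.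
   Context: Hypergraphs. A $k$-uniform hypergraph $G=(V,E)$ has finite vertex set $V=[n]=\{1,\dots,n\}$ and a set $E$ of $k$-element subsets of $V$ (the edges; no repeated edges). The degree $d_i$ of a vertex $i$ is the number of edges containing $i$. For an ordinary graph $G=(V,E)$ and $k\ge3$, the $k$th power $G^k$ is the $k$-uniform hypergraph obtained by adding to each edge $e\in E$ a set of $k-2$ new vertices $i_{e,1},\dots,i_{e,k-2}$ (all new vertices distinct for distinct edges): its edge set is $\{e\cup\{i_{e,1},\dots,i_{e,k-2}\}: e\in E\}$ and its vertex set is $V\cup\bigcup_{e\in E}\{i_{e,1},\dots,i_{e,k-2}\}$. Let $m=\frac{n-1}{k-1}$ (an integer here). The hyperstar $\mathcal{S}_{n,k}$ is the $k$-uniform hypergraph on $n$ vertices with $m$ edges whose vertex set has a partition $V=V_0\cup V_1\cup\cdots\cup V_m$ with $|V_0|=1$, $|V_1|=\cdots=|V_m|=k-1$ and $E=\{V_0\cup V_i : i\in[m]\}$. The loose path $\mathcal{P}_{n,k}$ is the $k$-uniform hypergraph on $n$ vertices with $m$ edges which is a path $(v_0,e_1,v_1,\dots,v_{m-1},e_m,v_m)$ (distinct vertices $v_j$, distinct edges $e_j$, $v_{j-1},v_j\in e_j$) such that $v_1,\dots,v_{m-1}$ have degree two and all other vertices have degree one (when $m=0$ both $\mathcal{S}_{n,k}$ and $\mathcal{P}_{n,k}$ are a single vertex). Tensors. For a real order-$k$ dimension-$n$ tensor $\mathcal{T}=(\mathcal{T}_{i_1\cdots i_k})$ and $x\in\mathbb{C}^n$,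 $\mathcal{T}x\in\mathbb{C}^n$ is defined by $(\mathcal{T}x)_i=\sum_{i_2,\dots,i_k=1}^n\mathcal{T}_{ii_2\cdots i_k}x_{i_2}\cdots x_{i_k}$. A number $\lambda\in\mathbb{C}$ is an eigenvalue of $\mathcal{T}$ with eigenvector $0\ne x\in\mathbb{C}^n$ if $(\mathcal{T}x)_i=\lambda x_i^{k-1}$ for all $i$. The spectral radius $\rho(\mathcal{T})$ is the maximum modulus of an eigenvalue of $\mathcal{T}$. For a $k$-uniform hypergraph $G$: the adjacency tensor $\mathcal{A}(G)$ has entries $a_{i_1\cdots i_k}=\frac1{(k-1)!}$ if $\{i_1,\dots,i_k\}\in E$ and $0$ otherwise; the signless Laplacian tensor is $\mathcal{Q}(G)=\mathcal{D}(G)+\mathcal{A}(G)$ where $\mathcal{D}(G)$ is the diagonal tensor with $\mathcal{D}_{i\cdots i}=d_i$; the incidence $Q$-tensor $\mathcal{Q}^*(G)$ has $(i_1,\dots,i_k)$-entry equal to the number of edges $e$ with $i_t\in e$ for all $t=1,\dots,k$ (indices may repeat). *)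

theory Defs
  imports "HOL-Analysis.Analysis"
begin

section \<open>Uniform hypergraphs\<close>

record 'a hypergraph =
  verts :: "'a set"
  edges :: "'a set set"

definition uniform_hypergraph :: "nat \<Rightarrow> 'a hypergraph \<Rightarrow> bool" where
  "uniform_hypergraph k G \<longleftrightarrow>
     finite (verts G) \<and> verts G \<noteq> {} \<and> (\<forall>e\<in>edges G. e \<subseteq> verts G \<and> card e = k)"

definition degree :: "'a hypergraph \<Rightarrow> 'a \<Rightarrow> nat" where
  "degree G i = card {e \<in> edges G. i \<in> e}"

definition isomorphic :: "'a hypergraph \<Rightarrow> 'b hypergraph \<Rightarrow> bool" where
  "isomorphic G H \<longleftrightarrow>
     (\<exists>f. bij_betw f (verts G) (verts H) \<and> (\<lambda>e. f ` e) ` edges G = edges H)"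

text \<open>An ordinary finite simple graph is a 2-uniform hypergraph.\<close>

definition connected_graph :: "'a hypergraph \<Rightarrow> bool" where
  "connected_graph G \<longleftrightarrow>
     (\<forall>u\<in>verts G. \<forall>v\<in>verts G. (u, v) \<in> {(a, b). {a, b} \<in> edges G}\<^sup>*)"

definition graph_cycle :: "'a hypergraph \<Rightarrow> 'a list \<Rightarrow> bool" where
  "graph_cycle G vs \<longleftrightarrow> length vs \<ge> 3 \<and> distinct vs \<and>
     (\<forall>i<length vs. {vs ! i, vs ! (Suc i mod length vs)} \<in> edges G)"

definition tree :: "'a hypergraph \<Rightarrow> bool" where
  "tree T \<longleftrightarrow> uniform_hypergraph 2 T \<and> connected_graph T \<and> (\<nexists>vs. graph_cycle T vs)"

text \<open>The old vertices are tagged by \<^const>\<open>Inl\<close>; the new vertex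
  \<^term>\<open>Inr (e, j)\<close> is the \<open>j\<close>-th one added to the edge \<open>e\<close>.\<close>

definition power_hypergraph :: "nat \<Rightarrow> 'a hypergraph \<Rightarrow> ('a + 'a set \<times> nat) hypergraph" where
  "power_hypergraph k G =
     \<lparr>verts = Inl ` verts G \<union> Inr ` (edges G \<times> {1..k-2}),
      edges = (\<lambda>e. Inl ` e \<union> (\<lambda>j. Inr (e, j)) ` {1..k-2}) ` edges G\<rparr>"

text \<open>The next two predicates determine the hypergraph up to isomorphism. The equation
  \<^term>\<open>n = m * (k - 1) + 1\<close> says that \<open>m\<close> is the integer \<open>(n - 1) / (k - 1)\<close>.\<close>

definition is_hyperstar :: "nat \<Rightarrow> nat \<Rightarrow> 'a hypergraph \<Rightarrow> bool" where
  "is_hyperstar n k G \<longleftrightarrow> uniform_hypergraph k G \<and> card (verts G) = n \<and>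
     (\<exists>m W. n = m * (k - 1) + 1 \<and> card (edges G) = m \<and>
        disjoint_family_on W {0..m} \<and> verts G = (\<Union>i\<in>{0..m}. W i) \<and>
        card (W 0) = 1 \<and> (\<forall>i\<in>{1..m}. card (W i) = k - 1) \<and>
        edges G = (\<lambda>i. W 0 \<union> W i) ` {1..m})"

text \<open>The list \<open>es\<close> is 0-based, so that \<^term>\<open>es ! j\<close> joins \<^term>\<open>vs ! j\<close>
  and \<^term>\<open>vs ! Suc j\<close>. For \<^term>\<open>m = (0::nat)\<close> the hypergraph is a single vertex, whose
  degree is zero; hence the guard on the degree-one condition.\<close>

definition is_loose_path :: "nat \<Rightarrow> nat \<Rightarrow> 'a hypergraph \<Rightarrow> bool" where
  "is_loose_path n k G \<longleftrightarrow> uniform_hypergraph k G \<and> card (verts G) = n \<and>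
     (\<exists>m vs es. n = m * (k - 1) + 1 \<and> card (edges G) = m \<and>
        length vs = Suc m \<and> distinct vs \<and> set vs \<subseteq> verts G \<and>
        length es = m \<and> distinct es \<and> set es = edges G \<and>
        (\<forall>j<m. vs ! j \<in> es ! j \<and> vs ! Suc j \<in> es ! j) \<and>
        (\<forall>j\<in>{1..<m}. degree G (vs ! j) = 2) \<and>
        (m \<ge> 1 \<longrightarrow> (\<forall>v \<in> verts G - (!) vs ` {1..<m}. degree G v = 1)))"


section \<open>Tensors and their eigenvalues\<close>

text \<open>An order-\<open>k\<close> tensor whose dimensions are indexed by a finite set \<open>V\<close> is a function on
  index tuples, i.e. lists of length \<open>k\<close> over \<open>V\<close>; its values elsewhere, and those of a
  vector outside \<open>V\<close>, are irrelevant.\<close>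

type_synonym 'a tensor = "'a list \<Rightarrow> real"

definition tensor_apply :: "'a set \<Rightarrow> nat \<Rightarrow> 'a tensor \<Rightarrow> ('a \<Rightarrow> complex) \<Rightarrow> 'a \<Rightarrow> complex" where
  "tensor_apply V k A x i =
     (\<Sum>js | set js \<subseteq> V \<and> length js = k - 1.
        complex_of_real (A (i # js)) * prod_list (map x js))"

definition tensor_eigenvector ::
    "'a set \<Rightarrow> nat \<Rightarrow> 'a tensor \<Rightarrow> ('a \<Rightarrow> complex) \<Rightarrow> complex \<Rightarrow> bool" where
  "tensor_eigenvector V k A x l \<longleftrightarrow>
     (\<exists>i\<in>V. x i \<noteq> 0) \<and> (\<forall>i\<in>V. tensor_apply V k A x i = l * x i ^ (k - 1))"

definition tensor_eigenvalue :: "'a set \<Rightarrow> nat \<Rightarrow> 'a tensor \<Rightarrow> complex \<Rightarrow> bool" where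
  "tensor_eigenvalue V k A l \<longleftrightarrow> (\<exists>x. tensor_eigenvector V k A x l)"

definition tensor_spectral_radius :: "'a set \<Rightarrow> nat \<Rightarrow> 'a tensor \<Rightarrow> real" where
  "tensor_spectral_radius V k A = (GREATEST r. \<exists>l. tensor_eigenvalue V k A l \<and> r = cmod l)"


section \<open>Tensors of a uniform hypergraph\<close>

text \<open>For a list \<open>is\<close> of length \<open>k\<close>, \<^term>\<open>set is\<close> can be an edge only if the indices
  are pairwise distinct.\<close>

definition adjacency_tensor :: "nat \<Rightarrow> 'a hypergraph \<Rightarrow> 'a tensor" where
  "adjacency_tensor k G is = (if set is \<in> edges G then 1 / fact (k - 1) else 0)"

definition degree_tensor :: "'a hypergraph \<Rightarrow> 'a tensor" where
  "degree_tensor G is = (if set is = {hd is} then real (degree G (hd is)) else 0)"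

definition signless_laplacian_tensor :: "nat \<Rightarrow> 'a hypergraph \<Rightarrow> 'a tensor" where
  "signless_laplacian_tensor k G is = degree_tensor G is + adjacency_tensor k G is"

definition incidence_Q_tensor :: "'a hypergraph \<Rightarrow> 'a tensor" where
  "incidence_Q_tensor G is = real (card {e \<in> edges G. set is \<subseteq> e})"

abbreviation rho_A :: "nat \<Rightarrow> 'a hypergraph \<Rightarrow> real" where
  "rho_A k G \<equiv> tensor_spectral_radius (verts G) k (adjacency_tensor k G)"

abbreviation rho_Q :: "nat \<Rightarrow> 'a hypergraph \<Rightarrow> real" where
  "rho_Q k G \<equiv> tensor_spectral_radius (verts G) k (signless_laplacian_tensor k G)"

abbreviation rho_Q_star :: "nat \<Rightarrow> 'a hypergraph \<Rightarrow> real" where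
  "rho_Q_star k G \<equiv> tensor_spectral_radius (verts G) k (incidence_Q_tensor G)"


section \<open>Existence of hyperstars and loose paths\<close>

lemma block_unique:
  fixes d i j x :: nat
  assumes "i * d < x" "x \<le> Suc i * d" "j * d < x" "x \<le> Suc j * d"
  shows "i = j"
proof -
  have "i * d < Suc j * d" "j * d < Suc i * d" using assms by linarith+
  then have "i < Suc j" "j < Suc i" by (metis mult_less_cancel2)+
  then show ?thesis by simp
qed

lemma block_exists:
  fixes d m x :: nat
  assumes "0 < x" "x \<le> m * d"
  shows "\<exists>i<m. i * d < x \<and> x \<le> Suc i * d"
  using assms
proof (induction m)
  case (Suc m)
  show ?case
  proof (cases "x \<le> m * d")
    case True then show ?thesis using Suc by (meson less_SucI)
  next
    case False then show ?thesis using Suc.prems by (intro exI[of _ m]) auto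
  qed
qed simp

lemma is_hyperstar_exists:
  assumes "k \<ge> 2" "n = m * (k - 1) + 1"
  shows "\<exists>G :: nat hypergraph. is_hyperstar n k G"
proof -
  define d where "d = k - 1"
  have d: "d \<ge> 1" "k = Suc d" using assms by (auto simp: d_def)
  define W where "W i = (if i = 0 then {0} else {(i - 1) * d<..i * d})" for i :: nat
  define G where "G = \<lparr>verts = {0..m * d}, edges = (\<lambda>i. W 0 \<union> W i) ` {1..m}\<rparr>"
  have cW: "card (W i) = d" if "i \<ge> 1" for i
    using that by (cases i) (auto simp: W_def)
  have fW: "finite (W i)" for i by (auto simp: W_def)
  have W0: "0 \<notin> W i" if "i \<ge> 1" for i using that by (auto simp: W_def)
  have disj: "disjoint_family_on W {0..m}"
  proof (unfold disjoint_family_on_def, intro ballI impI)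
    fix i j :: nat assume ij: "i \<noteq> j"
    show "W i \<inter> W j = {}"
    proof (cases "i = 0 \<or> j = 0")
      case True then show ?thesis using ij by (auto simp: W_def)
    next
      case False
      then obtain a b where "i = Suc a" "j = Suc b" by (metis not0_implies_Suc)
      then have W: "W i = {a * d<..Suc a * d}" "W j = {b * d<..Suc b * d}"
        unfolding W_def by simp_all
      have "a = b" if "x \<in> W i" "x \<in> W j" for x
        using that unfolding W greaterThanAtMost_iff by (blast intro: block_unique)
      then show ?thesis using ij \<open>i = Suc a\<close> \<open>j = Suc b\<close> by blast
    qed
  qed
  have un: "{0..m * d} = (\<Union>i\<in>{0..m}. W i)"
  proof (intro equalityI subsetI)
    fix x assume x: "x \<in> {0..m * d}"
    show "x \<in> (\<Union>i\<in>{0..m}. W i)"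
    proof (cases "x = 0")
      case True then show ?thesis by (auto simp: W_def)
    next
      case False
      then obtain i where "i < m" "i * d < x" "x \<le> Suc i * d"
        using x block_exists[of x m d] by auto
      then show ?thesis by (intro UN_I[of "Suc i"]) (auto simp: W_def)
    qed
  next
    fix x assume "x \<in> (\<Union>i\<in>{0..m}. W i)"
    then obtain i where i: "i \<le> m" "x \<in> W i" by auto
    then have "x \<le> i * d" by (auto simp: W_def split: if_splits)
    also have "\<dots> \<le> m * d" using i by simp
    finally show "x \<in> {0..m * d}" by simp
  qed
  have ck: "card (W 0 \<union> W i) = k" if "i \<ge> 1" for i
    using cW[OF that] fW[of i] W0[OF that] d by (simp add: W_def[of 0])
  have inj: "inj_on (\<lambda>i. W 0 \<union> W i) {1..m}"
  proof (rule inj_onI)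
    fix i j assume ij: "i \<in> {1..m}" "j \<in> {1..m}" "W 0 \<union> W i = W 0 \<union> W j"
    have "W 0 \<inter> W i = {}" "W 0 \<inter> W j = {}" using W0 ij(1,2) by (simp_all add: W_def[of 0])
    then have eq: "W i = W j" using ij(3) by blast
    have ne: "W i \<noteq> {}" using cW[of i] ij(1) d by auto
    show "i = j"
    proof (rule ccontr)
      assume "i \<noteq> j"
      then have "W i \<inter> W j = {}" using disj ij(1,2) by (auto simp: disjoint_family_on_def)
      then show False using eq ne by simp
    qed
  qed
  have "uniform_hypergraph k G"
    using un ck unfolding uniform_hypergraph_def G_def by fastforce
  moreover have "card (edges G) = m" using card_image[OF inj] by (simp add: G_def)
  moreover have "card (verts G) = n" using assms(2) by (simp add: G_def d_def)
  moreover have "verts G = (\<Union>i\<in>{0..m}. W i)" using un by (simp add: G_def)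
  moreover have "card (W 0) = 1" by (simp add: W_def)
  moreover have "\<forall>i\<in>{1..m}. card (W i) = k - 1" using cW by (simp add: d_def)
  moreover have "edges G = (\<lambda>i. W 0 \<union> W i) ` {1..m}" by (simp add: G_def)
  ultimately have "is_hyperstar n k G"
    unfolding is_hyperstar_def using assms(2) disj by blast
  then show ?thesis by blast
qed

lemma is_loose_path_exists:
  assumes "k \<ge> 2" "n = m * (k - 1) + 1"
  shows "\<exists>G :: nat hypergraph. is_loose_path n k G"
proof -
  define d where "d = k - 1"
  have d: "d \<ge> 1" "k = Suc d" using assms by (auto simp: d_def)
  define F where "F j = {j * d..Suc j * d}" for j :: nat
  define G where "G = \<lparr>verts = {0..m * d}, edges = F ` {..<m}\<rparr>"
  have injF: "inj F"
    by (rule injI) (use d in \<open>auto simp: F_def Icc_eq_Icc\<close>)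
  have deg: "degree G x = card {j. j < m \<and> x \<in> F j}" for x
  proof -
    have "{e \<in> edges G. x \<in> e} = F ` {j. j < m \<and> x \<in> F j}" by (auto simp: G_def)
    then show ?thesis
      unfolding degree_def using injF by (simp add: card_image inj_on_subset)
  qed
  have mem: "j * d \<in> F i \<longleftrightarrow> i = j \<or> Suc i = j" for i j
  proof -
    have "j * d \<in> F i \<longleftrightarrow> i \<le> j \<and> j \<le> Suc i"
      unfolding F_def atLeastAtMost_iff using d by (metis mult_le_cancel2 less_le_trans zero_less_one)
    then show ?thesis by auto
  qed
  have deg2: "degree G (j * d) = 2" if "j \<in> {1..<m}" for j
  proof -
    have "{i. i < m \<and> j * d \<in> F i} = {j - 1, j}" using that by (auto simp: mem)
    moreover have "j - 1 \<noteq> j" using that by auto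
    ultimately show ?thesis by (simp add: deg)
  qed
  have deg1: "degree G v = 1" if m: "m \<ge> 1" and v: "v \<le> m * d" "v \<notin> (\<lambda>j. j * d) ` {1..<m}" for v
  proof (cases "\<exists>j. v = j * d")
    case True
    then obtain j where j: "v = j * d" by auto
    then have "j \<le> m" using v d by simp
    with v j have "j = 0 \<or> j = m" by fastforce
    then have "{i. i < m \<and> v \<in> F i} = {if j = 0 then 0 else m - 1}"
      using m unfolding j by (auto simp: mem)
    then show ?thesis by (simp add: deg)
  next
    case False
    then have v0: "0 < v" by (metis mult_0 gr0I)
    obtain i where i: "i < m" "i * d < v" "v \<le> Suc i * d" using block_exists[OF v0 v(1)] by auto
    have "a = i" if a: "v \<in> F a" for a
    proof -
      have "a * d < v" "v \<le> Suc a * d" using a False unfolding F_def atLeastAtMost_iff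
        by (metis le_neq_implies_less)+
      then show ?thesis using block_unique i by blast
    qed
    moreover have "v \<in> F i" using i by (simp add: F_def)
    ultimately have "{a. a < m \<and> v \<in> F a} = {i}" using i(1) by blast
    then show ?thesis by (simp add: deg)
  qed
  have sub: "F j \<subseteq> {0..m * d}" if "j < m" for j
  proof -
    have "Suc j * d \<le> m * d" using that by (intro mult_right_mono) auto
    then show ?thesis by (auto simp: F_def)
  qed
  have un: "uniform_hypergraph k G"
    using sub d unfolding uniform_hypergraph_def G_def by (fastforce simp: F_def)
  have cE: "card (edges G) = m" using injF by (simp add: G_def card_image inj_on_subset)
  let ?vs = "map (\<lambda>j. j * d) [0..<Suc m]" and ?es = "map F [0..<m]"
  have nth: "?vs ! j = j * d" if "j \<le> m" for j using that by (simp del: upt_Suc)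
  have img: "(!) ?vs ` {1..<m} = (\<lambda>j. j * d) ` {1..<m}"
    using nth by (intro image_cong) auto
  have "distinct ?vs" using d by (simp add: distinct_map inj_on_def del: upt_Suc)
  moreover have "distinct ?es" using inj_on_subset[OF injF subset_UNIV] by (simp add: distinct_map)
  moreover have "set ?vs \<subseteq> verts G" by (auto simp: G_def)
  moreover have "set ?es = edges G" by (auto simp: G_def)
  moreover have "\<forall>j<m. ?vs ! j \<in> ?es ! j \<and> ?vs ! Suc j \<in> ?es ! j"
    using nth mem by (simp del: upt_Suc mult_Suc)
  moreover have "\<forall>j\<in>{1..<m}. degree G (?vs ! j) = 2" using nth deg2 by simp
  moreover have "\<forall>v\<in>verts G - (!) ?vs ` {1..<m}. degree G v = 1" if "m \<ge> 1"
    unfolding img using deg1[OF that] by (simp add: G_def)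
  moreover have "length ?vs = Suc m" "length ?es = m" by simp_all
  moreover have "card (verts G) = n" using assms(2) by (simp add: G_def d_def)
  ultimately have "is_loose_path n k G"
    unfolding is_loose_path_def using assms(2) un cE by blast
  then show ?thesis by blast
qed

end

theory Submission
  imports Defs "HOL-Combinatorics.Multiset_Permutations"
begin

text \<open>A nonnegative tensor with a positive eigenvector has the corresponding eigenvalue as its spectral
  radius (\<open>spectral_radius_eq_if_positive_eigenvector\<close>). For the power of a graph, the values
  of such an eigenvector at the new vertices can be eliminated. What remains, for each of the three
  tensors, is a system of ratio equations on the graph: at every vertex \<open>u\<close>, the numbers
  \<open>h t (x\<^sub>v / x\<^sub>u)\<close>, for \<open>v\<close> adjacent to \<open>u\<close>, sum to one. Here \<open>h t r\<close> is increasing in \<open>r\<close> and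
  decreasing in the parameter \<open>t\<close>, and the spectral radius is an increasing function of \<open>t\<close>. For
  \<open>\<A>\<close> and \<open>\<Q>\<close> one has \<open>h t r = (d + r / t\<^bsup>k - 2\<^esup>) / (d + t\<^sup>2)\<close> with \<open>d = 0\<close> and \<open>d = 1\<close>, for
  the incidence tensor \<open>h t r = ((1 + r) / t)\<^bsup>k - 1\<^esup>\<close>.

  On a connected graph a solution exists (\<open>ratio_solution_exists\<close>: minimise \<open>t\<close> subject to the
  inequalities). Positive vectors whose ratio sums are all at least one, or all at most one, bound
  the parameter from below or above, strictly if one of the inequalities is strict
  (\<open>parameter_less\<close>). So it suffices to find such test vectors on a tree with \<open>m\<close> edges, for
  the parameter of the path and for that of the star with \<open>m\<close> edges.

  For the path, take a solution and let \<open>g i\<close> be the contribution of an end piece with \<open>i\<close> vertices to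
  the ratio sum at the next vertex. On the tree, choose the ratio along each edge as if the branch
  behind it were a pendant path with the same number of vertices. The branches at a vertex have sizes
  adding up to \<open>m\<close>, so the ratio sums are at least \<open>g m = 1\<close> because \<open>g\<close> is subadditive
  (\<open>path_ratios.g_subadditive\<close>), which follows from the fact that \<open>h t r + h t (1 / r)\<close> grows
  with \<open>\<bar>ln r\<bar>\<close>. A vertex of degree at least three makes the inequality strict.

  For the star, the test vectors are explicit functions of the degree, different for the three
  tensors (\<open>star_bound_adjacency\<close>, \<open>star_bound_signless_laplacian\<close>, \<open>star_bound_incidence\<close>). They
  are based on the fact that the degrees of the neighbours of a vertex sum to at most \<open>m\<close>, and those
  of two adjacent vertices to at most \<open>m + 1\<close>.

  Finally, a tree without vertices of degree three or more has a loose path as its power, a tree with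
  a vertex of degree \<open>m\<close> a hyperstar, and loose paths and hyperstars are determined up to isomorphism
  by their parameters, since the numbers of vertices with given incidence patterns are.\<close>

section \<open>Positive eigenvectors of nonnegative tensors\<close>

lemma finite_index_lists: "finite V \<Longrightarrow> finite {js. set js \<subseteq> V \<and> length js = q}"
  by (simp add: finite_lists_length_eq)

lemma norm_prod_list_le:
  fixes y :: "'a \<Rightarrow> complex" and x :: "'a \<Rightarrow> real"
  assumes "\<And>j. j \<in> set js \<Longrightarrow> cmod (y j) \<le> c * x j" "\<And>j. j \<in> set js \<Longrightarrow> 0 \<le> x j" "0 \<le> c"
  shows "cmod (prod_list (map y js)) \<le> c ^ length js * prod_list (map x js)"
  using assms
proof (induction js)
  case (Cons a js)
  have "cmod (y a) * cmod (prod_list (map y js)) \<le> (c * x a) * (c ^ length js * prod_list (map x js))"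
    using Cons by (intro mult_mono) auto
  then show ?case by (simp add: norm_mult mult_ac)
qed simp

lemma prod_list_of_real:
  "prod_list (map (\<lambda>j. complex_of_real (x j)) js) = complex_of_real (prod_list (map x js))"
  by (induction js) auto

lemma prod_list_map_nonneg:
  fixes x :: "'a \<Rightarrow> real"
  shows "(\<And>j. j \<in> set js \<Longrightarrow> 0 \<le> x j) \<Longrightarrow> 0 \<le> prod_list (map x js)"
  by (induction js) auto

text \<open>If \<open>x\<close> is a positive eigenvector for \<open>r\<close> and \<open>y\<close> an eigenvector for \<open>l\<close>, then reading the
  equation for \<open>y\<close> at an index where \<open>\<bar>y\<^sub>i\<bar> / x\<^sub>i\<close> is largest gives \<open>\<bar>l\<bar> \<le> r\<close>.\<close>

lemma spectral_radius_eq_if_positive_eigenvector: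
  fixes x :: "'a \<Rightarrow> real"
  assumes fin: "finite V" and ne: "V \<noteq> {}"
    and A: "\<And>js. 0 \<le> A js"
    and x: "\<And>i. i \<in> V \<Longrightarrow> 0 < x i"
    and eig: "\<And>i. i \<in> V \<Longrightarrow>
      tensor_apply V k A (\<lambda>j. complex_of_real (x j)) i = complex_of_real (r * x i ^ (k - 1))"
  shows "tensor_spectral_radius V k A = r"
proof -
  let ?J = "{js. set js \<subseteq> V \<and> length js = k - 1}"
  have real_eig: "(\<Sum>js\<in>?J. A (i # js) * prod_list (map x js)) = r * x i ^ (k - 1)" if "i \<in> V" for i
  proof -
    have "complex_of_real (\<Sum>js\<in>?J. A (i # js) * prod_list (map x js)) = complex_of_real (r * x i ^ (k - 1))"
      using eig[OF that] unfolding tensor_apply_def prod_list_of_real by simp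
    then show ?thesis by (simp only: of_real_eq_iff)
  qed
  obtain i0 where i0: "i0 \<in> V" using ne by blast
  have "0 \<le> (\<Sum>js\<in>?J. A (i0 # js) * prod_list (map x js))"
    by (intro sum_nonneg mult_nonneg_nonneg A prod_list_map_nonneg) (use x in \<open>auto intro: less_imp_le\<close>)
  then have r0: "0 \<le> r"
    using real_eig[OF i0] zero_less_power[OF x[OF i0], of "k - 1"] by (simp add: zero_le_mult_iff)
  have ev: "tensor_eigenvalue V k A (complex_of_real r)"
    unfolding tensor_eigenvalue_def tensor_eigenvector_def
    using i0 x eig by (intro exI[of _ "\<lambda>j. complex_of_real (x j)"]) force
  have bound: "cmod l \<le> r" if l: "tensor_eigenvalue V k A l" for l
  proof -
    obtain y where y: "\<exists>i\<in>V. y i \<noteq> 0" "\<And>i. i \<in> V \<Longrightarrow> tensor_apply V k A y i = l * y i ^ (k - 1)"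
      using l unfolding tensor_eigenvalue_def tensor_eigenvector_def by blast
    define t where "t = Max ((\<lambda>i. cmod (y i) / x i) ` V)"
    have le_t: "cmod (y i) \<le> t * x i" if "i \<in> V" for i
    proof -
      have "cmod (y i) / x i \<le> t" unfolding t_def using fin that by (intro Max_ge) auto
      then show ?thesis using x[OF that] by (simp add: field_simps)
    qed
    have "t \<in> (\<lambda>i. cmod (y i) / x i) ` V" unfolding t_def using fin ne by (intro Max_in) auto
    then obtain i where i: "i \<in> V" "cmod (y i) / x i = t" by auto
    have yi: "cmod (y i) = t * x i" using i x[OF i(1)] by (auto simp: field_simps)
    have tpos: "0 < t"
    proof -
      obtain j where j: "j \<in> V" "y j \<noteq> 0" using y(1) by blast
      then have "0 < t * x j" using le_t[OF j(1)] by (smt (verit) zero_less_norm_iff)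
      then show ?thesis using x[OF j(1)] by (simp add: zero_less_mult_iff)
    qed
    have "cmod l * (t * x i) ^ (k - 1) = cmod (tensor_apply V k A y i)"
      using y(2)[OF i(1)] yi by (simp add: norm_mult norm_power)
    also have "\<dots> \<le> (\<Sum>js\<in>?J. A (i # js) * (t ^ (k - 1) * prod_list (map x js)))"
      unfolding tensor_apply_def
    proof (rule order_trans[OF norm_sum], rule sum_mono)
      fix js assume js: "js \<in> ?J"
      have "cmod (prod_list (map y js)) \<le> t ^ length js * prod_list (map x js)"
        using js le_t x tpos by (intro norm_prod_list_le) (auto intro: less_imp_le)
      then show "cmod (complex_of_real (A (i # js)) * prod_list (map y js))
          \<le> A (i # js) * (t ^ (k - 1) * prod_list (map x js))"
        using js A[of "i # js"] by (simp add: norm_mult mult_left_mono)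
    qed
    also have "\<dots> = t ^ (k - 1) * (r * x i ^ (k - 1))"
      unfolding real_eig[OF i(1), symmetric] sum_distrib_left by (simp add: mult_ac)
    also have "\<dots> = r * (t * x i) ^ (k - 1)" by (simp add: power_mult_distrib)
    finally show ?thesis using tpos x[OF i(1)] by (simp add: zero_less_power)
  qed
  show ?thesis
    unfolding tensor_spectral_radius_def
  proof (rule Greatest_equality)
    show "\<exists>l. tensor_eigenvalue V k A l \<and> r = cmod l" using ev r0 by (intro exI[of _ "complex_of_real r"]) simp
  qed (use bound in auto)
qed

text \<open>Relabelling the indices does not change the eigenvalues.\<close>

lemma tensor_eigenvalue_transport:
  assumes f: "bij_betw f V W"
    and AB: "\<And>js. set js \<subseteq> V \<Longrightarrow> length js = k \<Longrightarrow> B (map f js) = A js"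
    and k: "k \<ge> 1"
    and l: "tensor_eigenvalue W k B l"
  shows "tensor_eigenvalue V k A l"
proof -
  obtain x where x: "\<exists>i\<in>W. x i \<noteq> 0" "\<And>i. i \<in> W \<Longrightarrow> tensor_apply W k B x i = l * x i ^ (k - 1)"
    using l unfolding tensor_eigenvalue_def tensor_eigenvector_def by blast
  have inj: "inj_on f V" and im: "f ` V = W" using f by (auto simp: bij_betw_def)
  have bij: "bij_betw (map f) {js. set js \<subseteq> V \<and> length js = k - 1} {js. set js \<subseteq> W \<and> length js = k - 1}"
  proof (rule bij_betw_imageI)
    have "inj_on (map f) (lists V)" using inj by (rule inj_on_mapI[OF inj_on_subset]) auto
    then show "inj_on (map f) {js. set js \<subseteq> V \<and> length js = k - 1}" by (rule inj_on_subset) auto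
    show "map f ` {js. set js \<subseteq> V \<and> length js = k - 1} = {js. set js \<subseteq> W \<and> length js = k - 1}"
    proof (intro equalityI subsetI)
      fix ys assume ys: "ys \<in> {js. set js \<subseteq> W \<and> length js = k - 1}"
      then have "ys \<in> lists (f ` V)" using im by auto
      then obtain js where "js \<in> lists V" "ys = map f js" by (auto simp: lists_image)
      then show "ys \<in> map f ` {js. set js \<subseteq> V \<and> length js = k - 1}" using ys by auto
    next
      fix ys assume "ys \<in> map f ` {js. set js \<subseteq> V \<and> length js = k - 1}"
      then show "ys \<in> {js. set js \<subseteq> W \<and> length js = k - 1}" unfolding im[symmetric] by fastforce
    qed
  qed
  have "tensor_apply V k A (x \<circ> f) i = l * (x \<circ> f) i ^ (k - 1)" if i: "i \<in> V" for i
  proof -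
    have "tensor_apply V k A (x \<circ> f) i = tensor_apply W k B x (f i)"
      unfolding tensor_apply_def
    proof (rule sum.reindex_bij_betw[OF bij, THEN sym, THEN trans, symmetric], rule sum.cong[OF refl])
      fix js assume "js \<in> {js. set js \<subseteq> V \<and> length js = k - 1}"
      then have "B (map f (i # js)) = A (i # js)" using i k by (intro AB) auto
      then show "complex_of_real (B (f i # map f js)) * prod_list (map x (map f js)) =
          complex_of_real (A (i # js)) * prod_list (map (x \<circ> f) js)" by simp
    qed
    then show ?thesis using x(2)[of "f i"] i im by auto
  qed
  then show ?thesis
    unfolding tensor_eigenvalue_def tensor_eigenvector_def using x(1) im
    by (intro exI[of _ "x \<circ> f"]) auto
qed

lemma tensor_spectral_radius_transport:
  assumes f: "bij_betw f V W"
    and AB: "\<And>js. set js \<subseteq> V \<Longrightarrow> length js = k \<Longrightarrow> B (map f js) = A js"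
    and k: "k \<ge> 1"
  shows "tensor_spectral_radius V k A = tensor_spectral_radius W k B"
proof -
  have inv: "A (map (inv_into V f) js) = B js" if js: "set js \<subseteq> W" "length js = k" for js
  proof -
    have "map f (map (inv_into V f) js) = js"
      unfolding map_map
      by (rule map_idI) (use js f in \<open>auto simp: bij_betw_def f_inv_into_f subset_iff\<close>)
    moreover have "set (map (inv_into V f) js) \<subseteq> V"
      using js f by (auto simp: bij_betw_def intro!: inv_into_into)
    ultimately show ?thesis using AB[of "map (inv_into V f) js"] js by simp
  qed
  have "tensor_eigenvalue V k A l" if "tensor_eigenvalue W k B l" for l
    using tensor_eigenvalue_transport[where B = B, OF f AB k that] by blast
  moreover have "tensor_eigenvalue W k B l" if "tensor_eigenvalue V k A l" for l
    by (rule tensor_eigenvalue_transport[OF bij_betw_inv_into[OF f] inv k that])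
  ultimately have "tensor_eigenvalue V k A l \<longleftrightarrow> tensor_eigenvalue W k B l" for l by blast
  then show ?thesis unfolding tensor_spectral_radius_def by simp
qed

section \<open>The three tensors of a uniform hypergraph\<close>

lemma isomorphic_imp_spectral_radii_eq:
  assumes iso: "isomorphic G H" and G: "uniform_hypergraph k G" and k: "k \<ge> 1"
  shows "rho_A k G = rho_A k H" "rho_Q k G = rho_Q k H" "rho_Q_star k G = rho_Q_star k H"
proof -
  obtain f where f: "bij_betw f (verts G) (verts H)" and E: "(\<lambda>e. f ` e) ` edges G = edges H"
    using iso unfolding isomorphic_def by blast
  have inj: "inj_on f (verts G)" using f by (simp add: bij_betw_def)
  have sub: "e \<subseteq> verts G" if "e \<in> edges G" for e using G that by (simp add: uniform_hypergraph_def)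
  have injE: "inj_on ((`) f) (Pow (verts G))" using inj by (rule inj_on_image_Pow)
  have mem: "f ` X \<in> edges H \<longleftrightarrow> X \<in> edges G" if "X \<subseteq> verts G" for X
    using inj_on_image_mem_iff[OF injE, of X "edges G"] that sub E by auto
  have incl: "card {e \<in> edges H. f ` X \<subseteq> e} = card {e \<in> edges G. X \<subseteq> e}" if X: "X \<subseteq> verts G" for X
  proof -
    have "{e \<in> edges H. f ` X \<subseteq> e} = (`) f ` {e \<in> edges G. X \<subseteq> e}"
    proof -
      have "f ` X \<subseteq> f ` e \<longleftrightarrow> X \<subseteq> e" if "e \<in> edges G" for e
        using inj_on_image_subset_iff[OF inj X sub[OF that]] .
      then show ?thesis unfolding E[symmetric] by auto
    qed
    moreover have "inj_on ((`) f) {e \<in> edges G. X \<subseteq> e}"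
      using sub by (intro inj_on_subset[OF injE]) auto
    ultimately show ?thesis by (simp add: card_image)
  qed
  have deg: "degree H (f i) = degree G i" if "i \<in> verts G" for i
    using incl[of "{i}"] that by (simp add: degree_def)
  have A: "adjacency_tensor k H (map f js) = adjacency_tensor k G js" if "set js \<subseteq> verts G" for js
    using mem[OF that] by (simp add: adjacency_tensor_def)
  have D: "degree_tensor H (map f js) = degree_tensor G js" if js: "set js \<subseteq> verts G" "length js = k" for js
  proof -
    have "js \<noteq> []" using js k by auto
    then obtain i ls where i: "js = i # ls" by (cases js) auto
    have "f ` set js = f ` {i} \<longleftrightarrow> set js = {i}"
      by (rule inj_on_image_eq_iff[OF inj]) (use js i in auto)
    then show ?thesis using deg[of i] js i by (simp add: degree_tensor_def)
  qed
  show "rho_A k G = rho_A k H"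
    by (rule tensor_spectral_radius_transport[OF f _ k]) (rule A)
  show "rho_Q k G = rho_Q k H"
    by (rule tensor_spectral_radius_transport[OF f _ k]) (simp add: signless_laplacian_tensor_def A D)
  show "rho_Q_star k G = rho_Q_star k H"
    by (rule tensor_spectral_radius_transport[OF f _ k]) (simp add: incidence_Q_tensor_def incl)
qed

lemma sum_index_lists_prod:
  fixes x :: "'a \<Rightarrow> 'b :: comm_semiring_1"
  assumes "finite e"
  shows "(\<Sum>js | set js \<subseteq> e \<and> length js = q. prod_list (map x js)) = (\<Sum>j\<in>e. x j) ^ q"
proof (induction q)
  case 0
  have "{js. set js \<subseteq> e \<and> length js = 0} = {[]}" by auto
  then show ?case by simp
next
  case (Suc q)
  let ?L = "\<lambda>q. {js. set js \<subseteq> e \<and> length js = q}"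
  have "?L (Suc q) = (\<lambda>(a, js). a # js) ` (e \<times> ?L q)"
    by (auto simp: length_Suc_conv image_iff)
  then have "(\<Sum>js\<in>?L (Suc q). prod_list (map x js)) =
      (\<Sum>(a, js)\<in>e \<times> ?L q. x a * prod_list (map x js))"
    by (simp add: sum.reindex inj_on_def case_prod_unfold)
  also have "\<dots> = (\<Sum>a\<in>e. x a) * (\<Sum>js\<in>?L q. prod_list (map x js))"
    by (simp add: sum_product sum.cartesian_product)
  finally show ?case using Suc by simp
qed

text \<open>The index lists that contribute at \<open>i\<close> for an edge \<open>e\<close> are the \<open>(k - 1)!\<close> orderings of
  \<open>e - {i}\<close>, which cancels the normalising factor of the adjacency tensor.\<close>

lemma adjacency_tensor_apply:
  assumes G: "uniform_hypergraph k G" and i: "i \<in> verts G" and k: "k \<ge> 1"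
  shows "tensor_apply (verts G) k (adjacency_tensor k G) x i =
    (\<Sum>e | e \<in> edges G \<and> i \<in> e. \<Prod>j\<in>e - {i}. x j)"
proof -
  let ?J = "{js. set js \<subseteq> verts G \<and> length js = k - 1}"
  let ?E = "{e. e \<in> edges G \<and> i \<in> e}"
  have fin: "finite (verts G)" and sub: "\<And>e. e \<in> edges G \<Longrightarrow> e \<subseteq> verts G" and card: "\<And>e. e \<in> edges G \<Longrightarrow> card e = k"
    using G by (auto simp: uniform_hypergraph_def)
  have finE: "finite (edges G)" by (rule finite_subset[of _ "Pow (verts G)"]) (use fin sub in auto)
  have "tensor_apply (verts G) k (adjacency_tensor k G) x i =
      (\<Sum>js\<in>{js \<in> ?J. set (i # js) \<in> edges G}. 1 / fact (k - 1) * prod_list (map x js))"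
    unfolding tensor_apply_def adjacency_tensor_def using finite_index_lists[OF fin]
    by (subst sum.inter_filter) (auto intro!: sum.cong)
  also have "{js \<in> ?J. set (i # js) \<in> edges G} = (\<Union>e\<in>?E. permutations_of_set (e - {i}))"
  proof (intro equalityI subsetI)
    fix js assume js: "js \<in> {js \<in> ?J. set (i # js) \<in> edges G}"
    then have "card (set (i # js)) = length (i # js)" using card[of "set (i # js)"] k by auto
    then have "distinct (i # js)" by (rule card_distinct)
    then have "js \<in> permutations_of_set (set (i # js) - {i})" by (auto simp: permutations_of_set_def)
    then show "js \<in> (\<Union>e\<in>?E. permutations_of_set (e - {i}))" using js by auto
  next
    fix js assume "js \<in> (\<Union>e\<in>?E. permutations_of_set (e - {i}))"
    then obtain e where e: "e \<in> edges G" "i \<in> e" "set js = e - {i}" "distinct js"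
      by (auto simp: permutations_of_set_def)
    have "length js = k - 1" using e card[OF e(1)] distinct_card[OF e(4)] by simp
    moreover have "set (i # js) = e" using e by auto
    ultimately show "js \<in> {js \<in> ?J. set (i # js) \<in> edges G}" using e sub[OF e(1)] by auto
  qed
  also have "(\<Sum>js\<in>(\<Union>e\<in>?E. permutations_of_set (e - {i})). 1 / fact (k - 1) * prod_list (map x js)) =
      (\<Sum>e\<in>?E. \<Sum>js\<in>permutations_of_set (e - {i}). 1 / fact (k - 1) * prod_list (map x js))"
  proof (rule sum.UNION_disjoint)
    show "\<forall>e\<in>?E. \<forall>e'\<in>?E. e \<noteq> e' \<longrightarrow> permutations_of_set (e - {i}) \<inter> permutations_of_set (e' - {i}) = {}"
    proof (intro ballI impI)
      fix e e' assume "e \<in> ?E" "e' \<in> ?E" "e \<noteq> e'"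
      then have "e - {i} \<noteq> e' - {i}" by blast
      then show "permutations_of_set (e - {i}) \<inter> permutations_of_set (e' - {i}) = {}"
        by (auto simp: permutations_of_set_def)
    qed
  qed (use finE in auto)
  also have "\<dots> = (\<Sum>e\<in>?E. \<Prod>j\<in>e - {i}. x j)"
  proof (rule sum.cong[OF refl])
    fix e assume e: "e \<in> ?E"
    have fe: "finite e" using e sub fin finite_subset by blast
    have c: "card (e - {i}) = k - 1" using e card fe by simp
    have "(\<Sum>js\<in>permutations_of_set (e - {i}). 1 / fact (k - 1) * prod_list (map x js)) =
        (\<Sum>js\<in>permutations_of_set (e - {i}). 1 / fact (k - 1) * (\<Prod>j\<in>e - {i}. x j))"
    proof (rule sum.cong[OF refl])
      fix js assume "js \<in> permutations_of_set (e - {i})"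
      then have "distinct js" "set js = e - {i}" by (auto simp: permutations_of_set_def)
      then show "1 / fact (k - 1) * prod_list (map x js) = 1 / fact (k - 1) * (\<Prod>j\<in>e - {i}. x j)"
        using prod.distinct_set_conv_list[of js x] by simp
    qed
    also have "\<dots> = (\<Prod>j\<in>e - {i}. x j)" using fe c by simp
    finally show "(\<Sum>js\<in>permutations_of_set (e - {i}). 1 / fact (k - 1) * prod_list (map x js)) = (\<Prod>j\<in>e - {i}. x j)" .
  qed
  finally show ?thesis .
qed

lemma signless_laplacian_tensor_apply:
  assumes G: "uniform_hypergraph k G" and i: "i \<in> verts G" and k: "k \<ge> 1"
  shows "tensor_apply (verts G) k (signless_laplacian_tensor k G) x i =
    of_nat (degree G i) * x i ^ (k - 1) + (\<Sum>e | e \<in> edges G \<and> i \<in> e. \<Prod>j\<in>e - {i}. x j)"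
proof -
  let ?J = "{js. set js \<subseteq> verts G \<and> length js = k - 1}"
  have fin: "finite ?J" using G finite_index_lists by (auto simp: uniform_hypergraph_def)
  have rep: "set js \<subseteq> {i} \<longleftrightarrow> js = replicate (k - 1) i" if "js \<in> ?J" for js
  proof
    assume "set js \<subseteq> {i}"
    then show "js = replicate (k - 1) i" using that by (intro replicate_eqI) auto
  qed auto
  have "(\<Sum>js\<in>?J. complex_of_real (degree_tensor G (i # js)) * prod_list (map x js)) =
      (\<Sum>js\<in>{replicate (k - 1) i}. complex_of_real (degree_tensor G (i # js)) * prod_list (map x js))"
  proof (rule sum.mono_neutral_right[OF fin])
    show "{replicate (k - 1) i} \<subseteq> ?J" using i by auto
    show "\<forall>js\<in>?J - {replicate (k - 1) i}. complex_of_real (degree_tensor G (i # js)) * prod_list (map x js) = 0"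
      using rep by (auto simp: degree_tensor_def)
  qed
  also have "\<dots> = of_nat (degree G i) * x i ^ (k - 1)"
    using rep[of "replicate (k - 1) i"] by (cases "k = 1") (auto simp: degree_tensor_def prod_list_replicate)
  finally show ?thesis
    unfolding adjacency_tensor_apply[OF assms, symmetric]
    by (simp add: tensor_apply_def signless_laplacian_tensor_def ring_distribs sum.distrib)
qed

text \<open>Summing over edges first, the index lists within one edge \<open>e\<close> add up to the \<open>(k - 1)\<close>-st power
  of the sum of \<open>x\<close> over \<open>e\<close>.\<close>

lemma incidence_Q_tensor_apply:
  assumes G: "uniform_hypergraph k G" and i: "i \<in> verts G"
  shows "tensor_apply (verts G) k (incidence_Q_tensor G) x i =
    (\<Sum>e | e \<in> edges G \<and> i \<in> e. (\<Sum>j\<in>e. x j) ^ (k - 1))"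
proof -
  let ?J = "{js. set js \<subseteq> verts G \<and> length js = k - 1}"
  let ?E = "{e. e \<in> edges G \<and> i \<in> e}"
  have fin: "finite (verts G)" and sub: "\<And>e. e \<in> edges G \<Longrightarrow> e \<subseteq> verts G"
    using G by (auto simp: uniform_hypergraph_def)
  have finE: "finite ?E" by (rule finite_subset[of _ "Pow (verts G)"]) (use fin sub in auto)
  note finJ = finite_index_lists[OF fin, of "k - 1"]
  have "tensor_apply (verts G) k (incidence_Q_tensor G) x i =
      (\<Sum>js\<in>?J. \<Sum>e\<in>?E. if set js \<subseteq> e then prod_list (map x js) else 0)"
    unfolding tensor_apply_def
  proof (rule sum.cong[OF refl])
    fix js
    have "{e \<in> edges G. set (i # js) \<subseteq> e} = {e \<in> ?E. set js \<subseteq> e}" by auto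
    then show "complex_of_real (incidence_Q_tensor G (i # js)) * prod_list (map x js) =
        (\<Sum>e\<in>?E. if set js \<subseteq> e then prod_list (map x js) else 0)"
      using finE by (simp add: incidence_Q_tensor_def sum.inter_filter[symmetric])
  qed
  also have "\<dots> = (\<Sum>e\<in>?E. \<Sum>js\<in>?J. if set js \<subseteq> e then prod_list (map x js) else 0)"
    by (rule sum.swap)
  also have "\<dots> = (\<Sum>e\<in>?E. (\<Sum>j\<in>e. x j) ^ (k - 1))"
  proof (rule sum.cong[OF refl])
    fix e assume e: "e \<in> ?E"
    have "(\<Sum>js\<in>?J. if set js \<subseteq> e then prod_list (map x js) else 0) =
        (\<Sum>js\<in>{js \<in> ?J. set js \<subseteq> e}. prod_list (map x js))"
      using finJ by (simp add: sum.inter_filter[symmetric])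
    also have "{js \<in> ?J. set js \<subseteq> e} = {js. set js \<subseteq> e \<and> length js = k - 1}"
      using sub e by auto
    also have "(\<Sum>js\<in>\<dots>. prod_list (map x js)) = (\<Sum>j\<in>e. x j) ^ (k - 1)"
      using e sub fin by (intro sum_index_lists_prod) (auto intro: finite_subset)
    finally show "(\<Sum>js\<in>?J. if set js \<subseteq> e then prod_list (map x js) else 0) = (\<Sum>j\<in>e. x j) ^ (k - 1)" .
  qed
  finally show ?thesis .
qed

section \<open>Neighbours and ratio sums in a graph\<close>

text \<open>The neighbours of a vertex of an ordinary graph.\<close>

definition nbrs :: "'a hypergraph \<Rightarrow> 'a \<Rightarrow> 'a set" where
  "nbrs G u = {v. {u, v} \<in> edges G}"

text \<open>The eigenvalue problems for the three tensors of a power hypergraph all reduce to equations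
  for the ratios \<open>x\<^sub>v / x\<^sub>u\<close> along the edges of the graph: at every vertex \<open>u\<close>, the values of a
  function of these ratios sum to one.\<close>

definition ratio_sum :: "(real \<Rightarrow> real) \<Rightarrow> 'a hypergraph \<Rightarrow> ('a \<Rightarrow> real) \<Rightarrow> 'a \<Rightarrow> real" where
  "ratio_sum g G x u = (\<Sum>v\<in>nbrs G u. g (x v / x u))"

definition ratio_solution :: "(real \<Rightarrow> real) \<Rightarrow> 'a hypergraph \<Rightarrow> ('a \<Rightarrow> real) \<Rightarrow> bool" where
  "ratio_solution g G x \<longleftrightarrow> (\<forall>u\<in>verts G. 0 < x u \<and> ratio_sum g G x u = 1)"

lemma nbrs_sym: "v \<in> nbrs G u \<longleftrightarrow> u \<in> nbrs G v"
  by (simp add: nbrs_def insert_commute)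

lemma finite_edges: "uniform_hypergraph k G \<Longrightarrow> finite (edges G)"
  by (rule finite_subset[of _ "Pow (verts G)"]) (auto simp: uniform_hypergraph_def)

context
  fixes G :: "'a hypergraph"
  assumes G: "uniform_hypergraph 2 G"
begin

lemma finite_verts: "finite (verts G)"
  using G by (simp add: uniform_hypergraph_def)

lemma nbrs_irrefl: "u \<notin> nbrs G u"
  using G by (force simp: nbrs_def uniform_hypergraph_def)

lemma nbrs_subset: "nbrs G u \<subseteq> verts G"
  using G by (force simp: nbrs_def uniform_hypergraph_def)

lemma nbrs_in_verts: "v \<in> nbrs G u \<Longrightarrow> u \<in> verts G"
  using nbrs_subset nbrs_sym by fast

lemma finite_nbrs: "finite (nbrs G u)"
  using finite_subset[OF nbrs_subset finite_verts] .

lemma edgeE: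
  assumes "e \<in> edges G"
  obtains u v where "e = {u, v}" "u \<noteq> v" "v \<in> nbrs G u"
  using G assms unfolding uniform_hypergraph_def nbrs_def by (metis card_2_iff mem_Collect_eq)

lemma incident_edges: "{e. e \<in> edges G \<and> u \<in> e} = (\<lambda>v. {u, v}) ` nbrs G u"
proof (intro equalityI subsetI)
  fix e assume e: "e \<in> {e. e \<in> edges G \<and> u \<in> e}"
  then obtain a b where "e = {a, b}" "a \<noteq> b" by (auto elim: edgeE)
  with e have "e = {u, a} \<or> e = {u, b}" by auto
  with e show "e \<in> (\<lambda>v. {u, v}) ` nbrs G u" by (auto simp: nbrs_def)
qed (auto simp: nbrs_def)

lemma inj_on_edge: "inj_on (\<lambda>v. {u, v}) A"
  by (auto simp: inj_on_def doubleton_eq_iff)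

lemma degree_eq_card_nbrs: "degree G u = card (nbrs G u)"
  unfolding degree_def incident_edges by (simp add: card_image inj_on_edge)

lemma connected_closed_eq_verts:
  assumes "connected_graph G" and "u0 \<in> S" and "S \<subseteq> verts G"
    and closed: "\<And>u v. u \<in> S \<Longrightarrow> v \<in> nbrs G u \<Longrightarrow> v \<in> S"
  shows "S = verts G"
proof
  show "verts G \<subseteq> S"
  proof
    fix v assume "v \<in> verts G"
    then have "(u0, v) \<in> {(a, b). {a, b} \<in> edges G}\<^sup>*"
      using assms(1-3) unfolding connected_graph_def by blast
    then show "v \<in> S" by (induction) (use assms(2) closed in \<open>auto simp: nbrs_def\<close>)
  qed
qed (rule assms(3))

lemma nbrs_nonempty:
  assumes "connected_graph G" "edges G \<noteq> {}" "u \<in> verts G"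
  shows "nbrs G u \<noteq> {}"
proof
  assume "nbrs G u = {}"
  then have "{u} = verts G" using assms by (intro connected_closed_eq_verts[of u]) auto
  moreover obtain a b where "a \<noteq> b" "b \<in> nbrs G a" using assms(2) edgeE by (metis ex_in_conv)
  ultimately show False using nbrs_subset[of a] nbrs_in_verts[of b a] by (metis singletonD subsetD)
qed

end

section \<open>Existence and comparison of solutions of ratio equations\<close>

text \<open>A family \<open>h t\<close> of increasing functions of a positive ratio, decreasing in the parameter \<open>t\<close>.
  The least parameter \<open>t1\<close> is the one that solves the equations on a single edge. The last
  condition says that \<open>h t r + h t (1 / r)\<close> increases with \<open>\<bar>ln r\<bar>\<close>; it is what makes
  the path extremal.\<close>

locale ratio_function =
  fixes h :: "real \<Rightarrow> real \<Rightarrow> real" and t1 :: real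
  assumes h_pos: "t1 \<le> t \<Longrightarrow> 0 < r \<Longrightarrow> 0 < h t r"
    and h_mono: "t1 \<le> t \<Longrightarrow> 0 < r \<Longrightarrow> r < r' \<Longrightarrow> h t r < h t r'"
    and h_anti: "t1 \<le> t \<Longrightarrow> t < t' \<Longrightarrow> 0 < r \<Longrightarrow> h t' r < h t r"
    and h_cont: "continuous_on ({t1..} \<times> {0<..}) (\<lambda>(t, r). h t r)"
    and h_one: "h t1 1 = 1"
    and h_small: "0 < e \<Longrightarrow> \<exists>t\<ge>t1. h t 1 \<le> e"
    and h_large: "t1 \<le> t \<Longrightarrow> \<exists>r>0. 1 < h t r"
    and h_recip: "t1 \<le> t \<Longrightarrow> 0 < r \<Longrightarrow> r < r' \<Longrightarrow> 1 < r * r' \<Longrightarrow>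
      h t r + h t (1 / r) < h t r' + h t (1 / r')"
begin

lemma h_mono_le: "t1 \<le> t \<Longrightarrow> 0 < r \<Longrightarrow> r \<le> r' \<Longrightarrow> h t r \<le> h t r'"
  using h_mono[of t r r'] by (cases "r = r'") auto

lemma h_anti_le: "t1 \<le> t \<Longrightarrow> t \<le> t' \<Longrightarrow> 0 < r \<Longrightarrow> h t' r \<le> h t r"
  using h_anti[of t t' r] by (cases "t = t'") auto

text \<open>At a vertex where \<open>x\<^sub>u / y\<^sub>u\<close> is largest every ratio \<open>x\<^sub>v / x\<^sub>u\<close> is at most \<open>y\<^sub>v / y\<^sub>u\<close>. If
  \<open>b \<le> a\<close>, the two inequalities at such a vertex are equalities, and the largest value spreads to
  all neighbours.\<close>

lemma parameter_less:
  assumes G: "uniform_hypergraph 2 G" and conn: "connected_graph G"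
    and a: "t1 \<le> a" and b: "t1 \<le> b"
    and x: "\<And>u. u \<in> verts G \<Longrightarrow> 0 < x u" "\<And>u. u \<in> verts G \<Longrightarrow> 1 \<le> ratio_sum (h a) G x u"
    and y: "\<And>u. u \<in> verts G \<Longrightarrow> 0 < y u" "\<And>u. u \<in> verts G \<Longrightarrow> ratio_sum (h b) G y u \<le> 1"
    and strict: "\<exists>u\<in>verts G. 1 < ratio_sum (h a) G x u \<or> ratio_sum (h b) G y u < 1"
  shows "a < b"
proof (rule ccontr)
  assume "\<not> a < b"
  then have ba: "b \<le> a" by simp
  define t where "t = Max ((\<lambda>u. x u / y u) ` verts G)"
  define S where "S = {u \<in> verts G. x u = t * y u}"
  note fin = finite_verts[OF G]
  have ne: "verts G \<noteq> {}" using G by (simp add: uniform_hypergraph_def)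
  have le_t: "x u \<le> t * y u" if "u \<in> verts G" for u
  proof -
    have "x u / y u \<le> t" unfolding t_def using fin that by (intro Max_ge) auto
    then show ?thesis using y(1)[OF that] by (simp add: field_simps)
  qed
  have "t \<in> (\<lambda>u. x u / y u) ` verts G" unfolding t_def using fin ne by (intro Max_in) auto
  then obtain u0 where u0: "u0 \<in> verts G" "t = x u0 / y u0" by auto
  have u0S: "u0 \<in> S" using u0 y(1)[OF u0(1)] by (simp add: S_def)
  have tpos: "0 < t" using u0 x(1) y(1) by simp
  have *: "ratio_sum (h a) G x u = 1 \<and> ratio_sum (h b) G y u = 1 \<and> nbrs G u \<subseteq> S" if u: "u \<in> S" for u
  proof -
    have uV: "u \<in> verts G" and xu: "x u = t * y u" using u by (auto simp: S_def)
    have pos: "0 < x v" "0 < y v" "v \<in> verts G" if "v \<in> nbrs G u" for v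
      using that nbrs_subset[OF G, of u] x(1) y(1) by auto
    have rat: "x v / x u \<le> y v / y u" if "v \<in> nbrs G u" for v
      using le_t[OF pos(3)[OF that]] x(1)[OF uV] y(1)[OF uV] tpos unfolding xu by (simp add: field_simps)
    have term_le: "h a (x v / x u) \<le> h b (y v / y u)" if "v \<in> nbrs G u" for v
    proof -
      have "h a (x v / x u) \<le> h a (y v / y u)"
        using rat[OF that] pos[OF that] x(1)[OF uV] a by (intro h_mono_le) auto
      also have "\<dots> \<le> h b (y v / y u)" using ba b pos[OF that] y(1)[OF uV] by (intro h_anti_le) auto
      finally show ?thesis .
    qed
    have "ratio_sum (h a) G x u \<le> ratio_sum (h b) G y u"
      unfolding ratio_sum_def by (intro sum_mono term_le)
    then have eq: "ratio_sum (h a) G x u = 1" "ratio_sum (h b) G y u = 1"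
      using x(2)[OF uV] y(2)[OF uV] by auto
    have "v \<in> S" if v: "v \<in> nbrs G u" for v
    proof (rule ccontr)
      assume "v \<notin> S"
      then have "x v < t * y v" using le_t[OF pos(3)[OF v]] pos(3)[OF v] by (auto simp: S_def)
      then have "x v / x u < y v / y u"
        using x(1)[OF uV] y(1)[OF uV] tpos unfolding xu by (simp add: field_simps)
      then have "h a (x v / x u) < h a (y v / y u)"
        using pos[OF v] x(1)[OF uV] a by (intro h_mono) auto
      also have "\<dots> \<le> h b (y v / y u)" using ba b pos[OF v] y(1)[OF uV] by (intro h_anti_le) auto
      finally have "ratio_sum (h a) G x u < ratio_sum (h b) G y u"
        unfolding ratio_sum_def using v finite_nbrs[OF G] term_le
        by (intro sum_strict_mono_ex1) auto
      then show False using eq by simp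
    qed
    then show ?thesis using eq by blast
  qed
  have "S = verts G" by (rule connected_closed_eq_verts[OF G conn u0S]) (use * in \<open>auto simp: S_def\<close>)
  then show False using strict * by force
qed

text \<open>Pairs for which all ratio sums are at most one.\<close>

definition feasible :: "'a hypergraph \<Rightarrow> real \<Rightarrow> ('a \<Rightarrow> real) \<Rightarrow> bool" where
  "feasible G t x \<longleftrightarrow> t1 \<le> t \<and> (\<forall>u\<in>verts G. 0 < x u \<and> ratio_sum (h t) G x u \<le> 1)"

lemma continuous_on_h:
  assumes "continuous_on S f" "continuous_on S g" "\<And>s. s \<in> S \<Longrightarrow> t1 \<le> f s" "\<And>s. s \<in> S \<Longrightarrow> 0 < g s"
  shows "continuous_on S (\<lambda>s. h (f s) (g s))"
proof -
  have "continuous_on S ((\<lambda>(t, r). h t r) \<circ> (\<lambda>s. (f s, g s)))"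
    by (rule continuous_on_compose[OF continuous_on_Pair[OF assms(1,2)]])
      (rule continuous_on_subset[OF h_cont], use assms(3,4) in auto)
  then show ?thesis by (simp add: o_def)
qed

text \<open>By connectedness, the ratios of the entries of \<open>x\<close> in a feasible pair with bounded parameter are
  bounded; normalised at one vertex, such pairs form a compact set.\<close>

lemma minimal_feasible_exists:
  assumes G: "uniform_hypergraph 2 G" and conn: "connected_graph G"
  shows "\<exists>t x. feasible G t x \<and> (\<forall>t' x'. feasible G t' x' \<longrightarrow> t \<le> t')"
proof -
  let ?V = "verts G"
  note fin = finite_verts[OF G]
  obtain r where r: "r \<in> ?V" using G by (auto simp: uniform_hypergraph_def)
  have cpos: "0 < real (card ?V)" using r fin by (auto simp: card_gt_0_iff)
  obtain L where L: "t1 \<le> L" "h L 1 \<le> 1 / card ?V" using h_small[of "1 / card ?V"] cpos by auto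
  have fL: "feasible G L (\<lambda>_. 1)"
  proof -
    have "ratio_sum (h L) G (\<lambda>_. 1) u \<le> 1" for u
    proof -
      have "ratio_sum (h L) G (\<lambda>_. 1) u = card (nbrs G u) * h L 1" by (simp add: ratio_sum_def)
      also have "\<dots> \<le> card ?V * (1 / card ?V)"
        using L card_mono[OF fin nbrs_subset[OF G, of u]] h_pos[OF L(1), of 1] by (intro mult_mono) auto
      finally show ?thesis using cpos by simp
    qed
    then show ?thesis using L by (simp add: feasible_def)
  qed
  obtain R where R: "0 < R" "1 < h L R" using h_large[OF L(1)] by blast
  have ratio: "x v \<le> R * x u" if f: "feasible G t x" and t: "t \<le> L" and v: "v \<in> nbrs G u" for t x u v
  proof (rule ccontr)
    assume "\<not> x v \<le> R * x u"
    have uv: "u \<in> ?V" "v \<in> ?V" using v nbrs_in_verts[OF G] nbrs_subset[OF G] by blast+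
    have t1: "t1 \<le> t" and pos: "\<And>w. w \<in> ?V \<Longrightarrow> 0 < x w" using f by (auto simp: feasible_def)
    have "R < x v / x u" using \<open>\<not> _\<close> pos[OF uv(1)] by (simp add: field_simps)
    then have "h L R < h L (x v / x u)" using R L by (intro h_mono) auto
    also have "\<dots> \<le> h t (x v / x u)" using t1 t pos uv by (intro h_anti_le) auto
    also have "\<dots> \<le> ratio_sum (h t) G x u"
      unfolding ratio_sum_def
    proof (rule member_le_sum[OF v])
      fix w assume "w \<in> nbrs G u - {v}"
      then have "w \<in> ?V" using nbrs_subset[OF G] by blast
      then show "0 \<le> h t (x w / x u)" using h_pos[OF t1, of "x w / x u"] pos uv(1) by (simp add: less_imp_le)
    qed (rule finite_nbrs[OF G])
    also have "\<dots> \<le> 1" using f uv(1) by (simp add: feasible_def)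
    finally show False using R by simp
  qed
  \<comment> \<open>\<open>B M w\<close>: the factor \<open>M\<close> bounds the ratio between the entries at \<open>w\<close> and at \<open>r\<close>\<close>
  define B where "B M w \<longleftrightarrow> 0 < M \<and> (\<forall>t x. feasible G t x \<longrightarrow> t \<le> L \<longrightarrow> x w \<le> M * x r \<and> x r \<le> M * x w)"
    for M :: real and w
  have "{w \<in> ?V. \<exists>M. B M w} = ?V"
  proof (rule connected_closed_eq_verts[OF G conn])
    have "B 1 r" by (simp add: B_def)
    then show "r \<in> {w \<in> ?V. \<exists>M. B M w}" using r by blast
  next
    fix u v assume u: "u \<in> {w \<in> ?V. \<exists>M. B M w}" and v: "v \<in> nbrs G u"
    then obtain M where M: "B M u" by blast
    have "B (R * M) v"
      unfolding B_def
    proof (intro conjI allI impI)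
      show "0 < R * M" using R M by (simp add: B_def)
      fix t x assume f: "feasible G t x" "t \<le> L"
      have "x v \<le> R * x u" using ratio[OF f v] .
      also have "\<dots> \<le> R * (M * x r)" using M f R by (intro mult_left_mono) (auto simp: B_def)
      finally show "x v \<le> R * M * x r" by simp
      have "x r \<le> M * x u" using M f by (auto simp: B_def)
      also have "\<dots> \<le> M * (R * x v)"
        using M ratio[OF f, of u v] v by (intro mult_left_mono) (auto simp: B_def nbrs_sym)
      finally show "x r \<le> R * M * x v" by (simp add: mult_ac)
    qed
    then show "v \<in> {w \<in> ?V. \<exists>M. B M w}" using v nbrs_subset[OF G] by blast
  qed auto
  then have "\<forall>w\<in>?V. \<exists>M. B M w" by blast
  then obtain M where M: "\<And>w. w \<in> ?V \<Longrightarrow> B (M w) w" by metis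
  define K where "K = PiE UNIV (\<lambda>w. if w \<in> ?V then {1 / M w .. M w} else {1})"
  have "compactin (product_topology (\<lambda>_. euclidean) UNIV) K"
    unfolding K_def compactin_PiE by auto
  then have K: "compact K" by (simp add: euclidean_product_topology)
  have Kpos: "0 < x w" if "x \<in> K" "w \<in> ?V" for x w
  proof -
    have "1 / M w \<le> x w" using that by (auto simp: K_def PiE_iff split: if_splits)
    moreover have "0 < 1 / M w" using M[OF that(2)] by (simp add: B_def)
    ultimately show ?thesis by linarith
  qed
  let ?D = "{t1..L} \<times> K"
  define C where "C = (\<Inter>u\<in>?V. ?D \<inter> (\<lambda>(t, x). ratio_sum (h t) G x u) -` {..1})"
  have coord: "continuous_on ?D (\<lambda>p. snd p w)" for w :: 'a
    by (rule continuous_on_compose2[OF continuous_on_product_coordinates[of w], of _ snd])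
      (auto intro: continuous_intros)
  have "continuous_on ?D (\<lambda>(t, x). ratio_sum (h t) G x u)" if u: "u \<in> ?V" for u
    unfolding ratio_sum_def case_prod_unfold
  proof (intro continuous_on_sum continuous_on_h)
    fix v assume v: "v \<in> nbrs G u"
    have vV: "v \<in> ?V" using v nbrs_subset[OF G] by blast
    show "continuous_on ?D (\<lambda>p. snd p v / snd p u)"
      by (intro continuous_on_divide coord) (use Kpos[OF _ u] in force)
    show "0 < snd p v / snd p u" if "p \<in> ?D" for p
      using that Kpos[OF _ u] Kpos[OF _ vV] by auto
  qed (auto intro: continuous_intros)
  then have "closedin (top_of_set ?D) (?D \<inter> (\<lambda>(t, x). ratio_sum (h t) G x u) -` {..1})" if "u \<in> ?V" for u
    using that by (intro continuous_closedin_preimage) auto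
  then have "closedin (top_of_set ?D) C"
    unfolding C_def using r by (intro closedin_INT) blast+
  then have C: "compact C" by (rule closedin_compact[OF compact_Times[OF compact_Icc K]])
  have CD: "p \<in> ?D \<and> (\<forall>u\<in>?V. ratio_sum (h (fst p)) G (snd p) u \<le> 1)" if "p \<in> C" for p
    using that r unfolding C_def INT_iff vimage_def case_prod_unfold by blast
  have CI: "(t, \<lambda>w. if w \<in> ?V then x w / x r else 1) \<in> C" (is "(t, ?x) \<in> C")
    if f: "feasible G t x" and t: "t \<le> L" for t x
  proof -
    have pos: "\<And>w. w \<in> ?V \<Longrightarrow> 0 < x w" using f by (auto simp: feasible_def)
    have "?x \<in> K"
    proof -
      have "1 / M w \<le> x w / x r \<and> x w / x r \<le> M w" if w: "w \<in> ?V" for w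
      proof -
        have "0 < M w" "x w \<le> M w * x r" "x r \<le> M w * x w" using M[OF w] f t unfolding B_def by blast+
        then show ?thesis using pos[OF r] by (simp add: field_simps)
      qed
      then show ?thesis by (auto simp: K_def PiE_iff)
    qed
    moreover have "ratio_sum (h t) G ?x u = ratio_sum (h t) G x u" if "u \<in> ?V" for u
      unfolding ratio_sum_def using nbrs_subset[OF G, of u] that pos[OF r]
      by (intro sum.cong) (auto simp: subset_iff)
    ultimately show ?thesis
      using f t unfolding C_def INT_iff feasible_def by (simp add: vimage_def)
  qed
  have "C \<noteq> {}" using CI[OF fL] by auto
  then obtain p where p: "p \<in> C" "\<And>q. q \<in> C \<Longrightarrow> fst p \<le> fst q"
    using continuous_attains_inf[OF C, of fst] continuous_on_fst[OF continuous_on_id] by (metis id_apply)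
  obtain t x where tx: "p = (t, x)" by (cases p)
  have "feasible G t x" using CD[OF p(1)] Kpos unfolding tx feasible_def by auto
  moreover have "t \<le> t'" if "feasible G t' x'" for t' x'
  proof (cases "t' \<le> L")
    case True
    then show ?thesis using p(2)[OF CI[OF that True]] tx by simp
  next
    case False
    then show ?thesis using CD[OF p(1)] tx by auto
  qed
  ultimately show ?thesis by blast
qed

text \<open>A minimal parameter admits equality everywhere: lowering \<open>x\<close> at a vertex with a strict
  inequality keeps that inequality and makes those at all its neighbours strict. So if one
  inequality is strict then all can be made strict, and the parameter can be lowered.\<close>

theorem ratio_solution_exists:
  assumes G: "uniform_hypergraph 2 G" and conn: "connected_graph G" and E: "edges G \<noteq> {}"
  shows "\<exists>t x. t1 \<le> t \<and> ratio_solution (h t) G x"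
proof -
  let ?V = "verts G"
  note fin = finite_verts[OF G]
  obtain t x0 where tx0: "feasible G t x0" and min: "\<And>t' x'. feasible G t' x' \<Longrightarrow> t \<le> t'"
    using minimal_feasible_exists[OF G conn] by blast
  \<comment> \<open>the vertices with a strict inequality; \<open>x\<close> is chosen to have as many of them as possible\<close>
  define St where "St x = {u \<in> ?V. ratio_sum (h t) G x u < 1}" for x
  have "\<exists>x. feasible G t x \<and> (\<forall>y. feasible G t y \<longrightarrow> card (St y) \<le> card (St x))"
  proof (rule ex_has_greatest_nat[of "feasible G t" x0 _ "Suc (card ?V)", OF tx0], intro allI impI)
    fix y
    have "card (St y) \<le> card ?V" using fin by (intro card_mono) (auto simp: St_def)
    then show "card (St y) < Suc (card ?V)" by simp
  qed
  then obtain x where x: "feasible G t x" and max: "\<And>y. feasible G t y \<Longrightarrow> card (St y) \<le> card (St x)"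
    by blast
  have t: "t1 \<le> t" and pos: "\<And>w. w \<in> ?V \<Longrightarrow> 0 < x w"
    and le1: "\<And>w. w \<in> ?V \<Longrightarrow> ratio_sum (h t) G x w \<le> 1" using x by (auto simp: feasible_def)
  have "St x = {}"
  proof (rule ccontr)
    assume "St x \<noteq> {}"
    then obtain u0 where u0: "u0 \<in> St x" by blast
    have closed: "v \<in> St x" if u: "u \<in> St x" and v: "v \<in> nbrs G u" for u v
    proof (rule ccontr)
      assume vn: "v \<notin> St x"
      have uV: "u \<in> ?V" and u1: "ratio_sum (h t) G x u < 1" using u by (auto simp: St_def)
      have vV: "v \<in> ?V" using v nbrs_subset[OF G] by blast
      define f where "f s = (\<Sum>w\<in>nbrs G u. h t (x w / (s * x u)))" for s
      have "continuous_on {0<..} f"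
        unfolding f_def
      proof (intro continuous_on_sum continuous_on_h)
        fix w assume w: "w \<in> nbrs G u"
        then have "w \<in> ?V" using nbrs_subset[OF G] by blast
        then show "0 < x w / (s * x u)" if "s \<in> {0<..}" for s using that pos uV by auto
        show "continuous_on {0<..} (\<lambda>s. x w / (s * x u))"
          using pos[OF uV] by (intro continuous_intros) auto
      qed (use t in auto)
      then have "isCont f 1" by (simp add: continuous_on_eq_continuous_at)
      then have "(f \<longlongrightarrow> f 1) (at_left 1)" by (simp add: isCont_def filterlim_at_split)
      moreover have "f 1 < 1" using u1 by (simp add: f_def ratio_sum_def)
      ultimately have "\<forall>\<^sub>F s in at_left 1. f s < 1" by (rule order_tendstoD)
      moreover have "\<forall>\<^sub>F s in at_left (1::real). 0 < s \<and> s < 1"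
        using eventually_at_left_real[of 0 1] by (auto elim: eventually_mono)
      ultimately have "\<forall>\<^sub>F s in at_left 1. f s < 1 \<and> 0 < s \<and> s < 1" by (rule eventually_conj)
      then obtain s where s: "f s < 1" "0 < s" "s < 1"
        using eventually_happens'[OF trivial_limit_at_left_real] by blast
      define y where "y = x(u := s * x u)"
      have yu: "ratio_sum (h t) G y u = f s"
        unfolding ratio_sum_def f_def y_def using nbrs_irrefl[OF G, of u] by (intro sum.cong) auto
      have ypos: "0 < y w" if "w \<in> ?V" for w using pos that s by (auto simp: y_def)
      have yterm: "h t (y z / y w) \<le> h t (x z / x w)"
        if w: "w \<noteq> u" "w \<in> ?V" and z: "z \<in> nbrs G w" for w z
      proof (rule h_mono_le[OF t])
        have zV: "z \<in> ?V" using z nbrs_subset[OF G] by blast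
        have "y z \<le> x z" using pos[OF zV] s by (auto simp: y_def mult_le_cancel_right1)
        then show "y z / y w \<le> x z / x w"
          using w pos[OF w(2)] by (auto simp: y_def intro!: divide_right_mono)
        show "0 < y z / y w" using ypos[OF zV] ypos[OF w(2)] by simp
      qed
      have yw: "ratio_sum (h t) G y w \<le> ratio_sum (h t) G x w" if "w \<noteq> u" "w \<in> ?V" for w
        unfolding ratio_sum_def by (intro sum_mono yterm that)
      have yv: "ratio_sum (h t) G y w < 1" if w: "w \<in> nbrs G u" for w
      proof -
        have wV: "w \<in> ?V" and wu: "w \<noteq> u" using w nbrs_subset[OF G] nbrs_irrefl[OF G] by blast+
        have "ratio_sum (h t) G y w < ratio_sum (h t) G x w"
          unfolding ratio_sum_def
        proof (rule sum_strict_mono_ex1)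
          show "\<forall>z\<in>nbrs G w. h t (y z / y w) \<le> h t (x z / x w)" using yterm wu wV by blast
          show "\<exists>z\<in>nbrs G w. h t (y z / y w) < h t (x z / x w)"
          proof
            show "u \<in> nbrs G w" using w nbrs_sym by fast
            show "h t (y u / y w) < h t (x u / x w)"
              using wu wV uV pos ypos t s by (intro h_mono) (auto simp: y_def divide_strict_right_mono)
          qed
        qed (rule finite_nbrs[OF G])
        then show ?thesis using le1[OF wV] by simp
      qed
      have fy: "feasible G t y"
        unfolding feasible_def
      proof (intro conjI ballI t)
        fix w assume w: "w \<in> ?V"
        show "0 < y w" using ypos[OF w] .
        show "ratio_sum (h t) G y w \<le> 1"
          using yw[OF _ w] le1[OF w] yu s by (cases "w = u") fastforce+
      qed
      have "insert v (St x) \<subseteq> St y"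
      proof
        fix w assume "w \<in> insert v (St x)"
        then show "w \<in> St y"
          using yv[OF v] vV yu s yw[of w] by (cases "w = u") (auto simp: St_def)
      qed
      then have "card (insert v (St x)) \<le> card (St y)"
        using fin by (intro card_mono) (auto simp: St_def)
      moreover have "card (insert v (St x)) = Suc (card (St x))"
        using vn fin by (intro card_insert_disjoint) (auto simp: St_def)
      ultimately show False using max[OF fy] by simp
    qed
    have StV: "St x = ?V"
    proof (rule connected_closed_eq_verts[OF G conn u0])
      show "St x \<subseteq> ?V" by (auto simp: St_def)
    qed (rule closed)
    have lt1: "ratio_sum (h t) G x u < 1" if "u \<in> ?V" for u
      using that unfolding StV[symmetric] by (simp add: St_def)
    have "t1 < t"
    proof (rule ccontr)
      assume "\<not> t1 < t"
      then have tt: "t = t1" using t by simp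
      obtain a b where ab: "b \<in> nbrs G a" using E by (metis edgeE[OF G] ex_in_conv)
      have ba: "a \<in> nbrs G b" using ab nbrs_sym by fast
      have V: "a \<in> ?V" "b \<in> ?V" using ab ba nbrs_subset[OF G] by blast+
      have *: "h t (x d / x c) < 1" if "d \<in> nbrs G c" "c \<in> ?V" for c d
      proof -
        have "h t (x d / x c) \<le> ratio_sum (h t) G x c"
          unfolding ratio_sum_def
        proof (rule member_le_sum[OF that(1)])
          fix w assume "w \<in> nbrs G c - {d}"
          then have "w \<in> ?V" using nbrs_subset[OF G] by blast
          then show "0 \<le> h t (x w / x c)" using h_pos[OF t, of "x w / x c"] pos that(2) by (simp add: less_imp_le)
        qed (rule finite_nbrs[OF G])
        then show ?thesis using lt1[OF that(2)] by simp
      qed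
      have "1 \<le> x b / x a \<or> 1 \<le> x a / x b" using pos[OF V(1)] pos[OF V(2)] by (simp add: field_simps) linarith
      then have "h t 1 \<le> h t (x b / x a) \<or> h t 1 \<le> h t (x a / x b)" using h_mono_le[OF t, of 1] by auto
      then show False using *[OF ab V(1)] *[OF ba V(2)] h_one unfolding tt by auto
    qed
    have "\<forall>\<^sub>F s in at_left t. \<forall>u\<in>?V. ratio_sum (h s) G x u < 1"
    proof (rule eventually_ball_finite[OF fin], rule ballI)
      fix u assume u: "u \<in> ?V"
      have "continuous_on {t1<..} (\<lambda>s. ratio_sum (h s) G x u)"
        unfolding ratio_sum_def
      proof (intro continuous_on_sum continuous_on_h)
        fix w assume "w \<in> nbrs G u"
        then have "w \<in> ?V" using nbrs_subset[OF G] by blast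
        then show "0 < x w / x u" using pos u by simp
      qed auto
      then have "isCont (\<lambda>s. ratio_sum (h s) G x u) t" using \<open>t1 < t\<close> by (simp add: continuous_on_eq_continuous_at)
      then have "((\<lambda>s. ratio_sum (h s) G x u) \<longlongrightarrow> ratio_sum (h t) G x u) (at_left t)"
        by (simp add: isCont_def filterlim_at_split)
      then show "\<forall>\<^sub>F s in at_left t. ratio_sum (h s) G x u < 1"
        using lt1[OF u] by (rule order_tendstoD(2))
    qed
    moreover have "\<forall>\<^sub>F s in at_left t. t1 < s \<and> s < t"
      using eventually_at_left_real[OF \<open>t1 < t\<close>] by (auto elim: eventually_mono)
    ultimately have "\<forall>\<^sub>F s in at_left t. (\<forall>u\<in>?V. ratio_sum (h s) G x u < 1) \<and> t1 < s \<and> s < t"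
      by (rule eventually_conj)
    then obtain s where s: "\<forall>u\<in>?V. ratio_sum (h s) G x u < 1" "t1 < s" "s < t"
      using eventually_happens'[OF trivial_limit_at_left_real] by blast
    then have "feasible G s x" using pos by (auto simp: feasible_def intro: less_imp_le)
    then show False using min[of s x] s by simp
  qed
  then have "ratio_solution (h t) G x"
    using pos le1 unfolding ratio_solution_def St_def by force
  then show ?thesis using t by blast
qed

end

section \<open>Spectral radii of power hypergraphs\<close>

lemma rho_A_eqI:
  fixes X :: "'a \<Rightarrow> real"
  assumes H: "uniform_hypergraph k H" and k: "k \<ge> 1"
    and X: "\<And>i. i \<in> verts H \<Longrightarrow> 0 < X i"
    and eq: "\<And>i. i \<in> verts H \<Longrightarrow> (\<Sum>e | e \<in> edges H \<and> i \<in> e. \<Prod>j\<in>e - {i}. X j) = r * X i ^ (k - 1)"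
  shows "rho_A k H = r"
proof (rule spectral_radius_eq_if_positive_eigenvector[OF _ _ _ X])
  fix i assume i: "i \<in> verts H"
  show "tensor_apply (verts H) k (adjacency_tensor k H) (\<lambda>j. complex_of_real (X j)) i = complex_of_real (r * X i ^ (k - 1))"
    unfolding adjacency_tensor_apply[OF H i k] eq[OF i, symmetric] by simp
qed (use H in \<open>auto simp: uniform_hypergraph_def adjacency_tensor_def\<close>)

lemma rho_Q_eqI:
  fixes X :: "'a \<Rightarrow> real"
  assumes H: "uniform_hypergraph k H" and k: "k \<ge> 1"
    and X: "\<And>i. i \<in> verts H \<Longrightarrow> 0 < X i"
    and eq: "\<And>i. i \<in> verts H \<Longrightarrow>
      degree H i * X i ^ (k - 1) + (\<Sum>e | e \<in> edges H \<and> i \<in> e. \<Prod>j\<in>e - {i}. X j) = r * X i ^ (k - 1)"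
  shows "rho_Q k H = r"
proof (rule spectral_radius_eq_if_positive_eigenvector[OF _ _ _ X])
  fix i assume i: "i \<in> verts H"
  show "tensor_apply (verts H) k (signless_laplacian_tensor k H) (\<lambda>j. complex_of_real (X j)) i = complex_of_real (r * X i ^ (k - 1))"
    unfolding signless_laplacian_tensor_apply[OF H i k] eq[OF i, symmetric] by simp
qed (use H in \<open>auto simp: uniform_hypergraph_def signless_laplacian_tensor_def adjacency_tensor_def degree_tensor_def\<close>)

lemma rho_Q_star_eqI:
  fixes X :: "'a \<Rightarrow> real"
  assumes H: "uniform_hypergraph k H"
    and X: "\<And>i. i \<in> verts H \<Longrightarrow> 0 < X i"
    and eq: "\<And>i. i \<in> verts H \<Longrightarrow> (\<Sum>e | e \<in> edges H \<and> i \<in> e. (\<Sum>j\<in>e. X j) ^ (k - 1)) = r * X i ^ (k - 1)"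
  shows "rho_Q_star k H = r"
proof (rule spectral_radius_eq_if_positive_eigenvector[OF _ _ _ X])
  fix i assume i: "i \<in> verts H"
  show "tensor_apply (verts H) k (incidence_Q_tensor H) (\<lambda>j. complex_of_real (X j)) i = complex_of_real (r * X i ^ (k - 1))"
    unfolding incidence_Q_tensor_apply[OF H i] eq[OF i, symmetric] by simp
qed (use H in \<open>auto simp: uniform_hypergraph_def incidence_Q_tensor_def\<close>)

text \<open>The edge of the power hypergraph that arises from the edge \<open>e\<close> of the graph.\<close>

definition power_edge :: "nat \<Rightarrow> 'a set \<Rightarrow> ('a + 'a set \<times> nat) set" where
  "power_edge k e = Inl ` e \<union> (\<lambda>j. Inr (e, j)) ` {1..k - 2}"

lemma power_edge_mem [simp]:
  "Inl u \<in> power_edge k e \<longleftrightarrow> u \<in> e"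
  "Inr (e', j) \<in> power_edge k e \<longleftrightarrow> e' = e \<and> j \<in> {1..k - 2}"
  by (auto simp: power_edge_def)

lemma inj_power_edge: "inj (power_edge k)"
proof (rule injI)
  fix e e' :: "'a set" assume "power_edge k e = power_edge k e'"
  then have "Inl u \<in> power_edge k e \<longleftrightarrow> Inl u \<in> power_edge k e'" for u by simp
  then show "e = e'" by auto
qed

lemma edges_power_hypergraph: "edges (power_hypergraph k G) = power_edge k ` edges G"
  by (simp add: power_hypergraph_def power_edge_def)

lemma card_edges_power_hypergraph: "card (edges (power_hypergraph k G)) = card (edges G)"
  unfolding edges_power_hypergraph by (rule card_image[OF inj_on_subset[OF inj_power_edge]]) simp

lemma Inl_in_verts_power [simp]: "Inl u \<in> verts (power_hypergraph k G) \<longleftrightarrow> u \<in> verts G"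
  by (auto simp: power_hypergraph_def)

lemma Inr_in_verts_power [simp]:
  "Inr (e, j) \<in> verts (power_hypergraph k G) \<longleftrightarrow> e \<in> edges G \<and> j \<in> {1..k - 2}"
  by (auto simp: power_hypergraph_def)

lemma card_power_edge:
  assumes "finite e" shows "card (power_edge k e) = card e + (k - 2)"
proof -
  have "card (power_edge k e) = card (Inl ` e :: ('a + 'a set \<times> nat) set) +
      card ((\<lambda>j. Inr (e, j) :: 'a + 'a set \<times> nat) ` {1..k - 2})"
    unfolding power_edge_def using assms by (intro card_Un_disjoint) auto
  then show ?thesis by (simp add: card_image inj_on_def)
qed

text \<open>Eliminating the new vertices from the eigenvalue equations of \<open>d\<D> + \<A>\<close>: with eigenvalue
  \<open>d + t\<^sup>2\<close>, the value at a new vertex of \<open>{u, v}\<close> is the geometric mean of the values at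
  \<open>u\<close> and \<open>v\<close>, divided by \<open>t\<close>; the \<open>k/2\<close>-th powers of the values at the old vertices then
  solve a ratio equation on the graph.\<close>

definition degree_adjacency_ratio :: "nat \<Rightarrow> real \<Rightarrow> real \<Rightarrow> real \<Rightarrow> real" where
  "degree_adjacency_ratio k d t r = (d + r / t ^ (k - 2)) / (d + t\<^sup>2)"

text \<open>For the incidence tensor, let \<open>x(e)\<close> be the sum of the entries of the eigenvector over an edge \<open>e\<close>.
  With eigenvalue \<open>(t + k - 2)\<^bsup>k - 1\<^esup>\<close>, each new vertex has the value \<open>x(e) / (t + k - 2)\<close>, which
  for \<open>e\<close> arising from \<open>{u, v}\<close> is the sum of the values at \<open>u\<close> and \<open>v\<close>, divided by \<open>t\<close>. The
  values at the old vertices themselves solve a ratio equation.\<close>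

definition incidence_ratio :: "nat \<Rightarrow> real \<Rightarrow> real \<Rightarrow> real" where
  "incidence_ratio k t r = ((1 + r) / t) ^ (k - 1)"

context
  fixes G :: "'a hypergraph" and k :: nat
  assumes G: "uniform_hypergraph 2 G" and k: "k \<ge> 3"
begin

lemma uniform_power_hypergraph: "uniform_hypergraph k (power_hypergraph k G)"
proof -
  have "finite (verts (power_hypergraph k G))"
    using finite_verts[OF G] finite_edges[OF G] by (simp add: power_hypergraph_def)
  moreover have "verts (power_hypergraph k G) \<noteq> {}"
    using G by (auto simp: power_hypergraph_def uniform_hypergraph_def)
  moreover have "power_edge k e \<subseteq> verts (power_hypergraph k G) \<and> card (power_edge k e) = k"
    if e: "e \<in> edges G" for e
  proof -
    have "card e = 2" "e \<subseteq> verts G" using G e by (auto simp: uniform_hypergraph_def)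
    then show ?thesis
      using e k card_power_edge[of e k] card.infinite[of e]
      by (fastforce simp: power_edge_def power_hypergraph_def)
  qed
  ultimately show ?thesis by (auto simp: uniform_hypergraph_def edges_power_hypergraph)
qed

lemma card_verts_power_hypergraph:
  "card (verts (power_hypergraph k G)) = card (verts G) + card (edges G) * (k - 2)"
proof -
  have "card (verts (power_hypergraph k G)) =
      card (Inl ` verts G :: ('a + 'a set \<times> nat) set) + card (Inr ` (edges G \<times> {1..k - 2}) :: ('a + 'a set \<times> nat) set)"
    unfolding power_hypergraph_def using finite_verts[OF G] finite_edges[OF G]
    by (simp del: atLeastAtMost_iff, intro card_Un_disjoint) auto
  then show ?thesis by (simp add: card_image card_cartesian_product)
qed

lemma incident_power_Inl:
  "{E. E \<in> edges (power_hypergraph k G) \<and> Inl u \<in> E} = (\<lambda>v. power_edge k {u, v}) ` nbrs G u"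
proof -
  have "{E. E \<in> edges (power_hypergraph k G) \<and> Inl u \<in> E} = power_edge k ` {e. e \<in> edges G \<and> u \<in> e}"
    by (auto simp: edges_power_hypergraph)
  then show ?thesis unfolding incident_edges[OF G] by (simp add: image_image)
qed

lemma inj_power_edge_nbr: "inj_on (\<lambda>v. power_edge k {u, v}) A"
  using comp_inj_on[OF inj_on_edge[OF G] inj_on_subset[OF inj_power_edge subset_UNIV]]
  by (simp add: o_def)

lemma sum_incident_power_Inl:
  "(\<Sum>E | E \<in> edges (power_hypergraph k G) \<and> Inl u \<in> E. f E) = (\<Sum>v\<in>nbrs G u. f (power_edge k {u, v}))"
  unfolding incident_power_Inl by (simp add: sum.reindex inj_power_edge_nbr)

lemma incident_power_Inr:
  assumes "e \<in> edges G" "j \<in> {1..k - 2}"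
  shows "{E. E \<in> edges (power_hypergraph k G) \<and> Inr (e, j) \<in> E} = {power_edge k e}"
  using assms by (auto simp: edges_power_hypergraph)

lemma degree_power_Inl: "degree (power_hypergraph k G) (Inl u) = card (nbrs G u)"
  unfolding degree_def incident_power_Inl by (simp add: card_image inj_power_edge_nbr)

lemma degree_power_Inr:
  "e \<in> edges G \<Longrightarrow> j \<in> {1..k - 2} \<Longrightarrow> degree (power_hypergraph k G) (Inr (e, j)) = 1"
  unfolding degree_def incident_power_Inr by simp

lemma prod_power_edge_Inl:
  fixes X :: "'a + 'a set \<times> nat \<Rightarrow> real"
  assumes v: "v \<in> nbrs G u" and X: "\<And>j. X (Inr ({u, v}, j)) = w"
  shows "(\<Prod>j\<in>power_edge k {u, v} - {Inl u}. X j) = X (Inl v) * w ^ (k - 2)"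
proof -
  have uv: "u \<noteq> v" using v nbrs_irrefl[OF G] by blast
  have "power_edge k {u, v} - {Inl u} = insert (Inl v) ((\<lambda>j. Inr ({u, v}, j)) ` {1..k - 2})"
    using uv by (auto simp: power_edge_def)
  then have "(\<Prod>j\<in>power_edge k {u, v} - {Inl u}. X j) = X (Inl v) * (\<Prod>j\<in>(\<lambda>j. Inr ({u, v}, j)) ` {1..k - 2}. X j)"
    by (simp only:, subst prod.insert) auto
  also have "(\<Prod>j\<in>(\<lambda>j. Inr ({u, v}, j)) ` {1..k - 2}. X j) = w ^ (k - 2)"
    by (subst prod.reindex) (auto simp: inj_on_def X)
  finally show ?thesis .
qed

lemma prod_power_edge_Inr:
  fixes X :: "'a + 'a set \<times> nat \<Rightarrow> real"
  assumes v: "v \<in> nbrs G u" and i: "i \<in> {1..k - 2}" and X: "\<And>j. X (Inr ({u, v}, j)) = w"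
  shows "(\<Prod>j\<in>power_edge k {u, v} - {Inr ({u, v}, i)}. X j) = X (Inl u) * X (Inl v) * w ^ (k - 3)"
proof -
  have uv: "u \<noteq> v" using v nbrs_irrefl[OF G] by blast
  have "power_edge k {u, v} - {Inr ({u, v}, i)} =
      insert (Inl u) (insert (Inl v) ((\<lambda>j. Inr ({u, v}, j)) ` ({1..k - 2} - {i})))"
    by (auto simp: power_edge_def)
  then have "(\<Prod>j\<in>power_edge k {u, v} - {Inr ({u, v}, i)}. X j) =
      X (Inl u) * (X (Inl v) * (\<Prod>j\<in>(\<lambda>j. Inr ({u, v}, j)) ` ({1..k - 2} - {i}). X j))"
    using uv by (simp only:, subst prod.insert, simp, force, subst prod.insert) auto
  also have "(\<Prod>j\<in>(\<lambda>j. Inr ({u, v}, j)) ` ({1..k - 2} - {i}). X j) = w ^ (k - 3)"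
    using i by (subst prod.reindex) (auto simp: inj_on_def X)
  finally show ?thesis by (simp add: mult_ac)
qed

lemma sum_power_edge:
  fixes X :: "'a + 'a set \<times> nat \<Rightarrow> real"
  assumes v: "v \<in> nbrs G u" and X: "\<And>j. X (Inr ({u, v}, j)) = w"
  shows "(\<Sum>j\<in>power_edge k {u, v}. X j) = X (Inl u) + X (Inl v) + real (k - 2) * w"
proof -
  have uv: "u \<noteq> v" using v nbrs_irrefl[OF G] by blast
  have "(\<Sum>j\<in>power_edge k {u, v}. X j) = (\<Sum>j\<in>Inl ` {u, v}. X j) + (\<Sum>j\<in>(\<lambda>j. Inr ({u, v}, j)) ` {1..k - 2}. X j)"
    unfolding power_edge_def by (rule sum.union_disjoint) auto
  also have "(\<Sum>j\<in>Inl ` {u, v}. X j) = X (Inl u) + X (Inl v)" using uv by simp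
  also have "(\<Sum>j\<in>(\<lambda>j. Inr ({u, v}, j)) ` {1..k - 2}. X j) = real (k - 2) * w"
    by (subst sum.reindex) (auto simp: inj_on_def X)
  finally show ?thesis .
qed

lemma degree_adjacency_lift:
  assumes y: "ratio_solution (degree_adjacency_ratio k d t) G y" and t: "0 < t" and d: "0 \<le> d"
  obtains X where "\<And>i. i \<in> verts (power_hypergraph k G) \<Longrightarrow> 0 < X i"
    "\<And>i. i \<in> verts (power_hypergraph k G) \<Longrightarrow>
      d * real (degree (power_hypergraph k G) i) * X i ^ (k - 1) +
      (\<Sum>e | e \<in> edges (power_hypergraph k G) \<and> i \<in> e. \<Prod>j\<in>e - {i}. X j) = (d + t\<^sup>2) * X i ^ (k - 1)"
proof -
  define z where "z u = root k (y u)" for u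
  have y0: "0 < y u" if "u \<in> verts G" for u using y that by (simp add: ratio_solution_def)
  have z0: "0 < z u" if "u \<in> verts G" for u using y0[OF that] k by (simp add: z_def)
  have zk: "z u ^ k = y u" if "u \<in> verts G" for u
    using y0[OF that] k by (simp add: z_def)
  define X :: "'a + 'a set \<times> nat \<Rightarrow> real" where
    "X i = (case i of Inl u \<Rightarrow> (z u)\<^sup>2 | Inr (e, j) \<Rightarrow> (\<Prod>u\<in>e. z u) / t)" for i
  have XInl: "X (Inl u) = (z u)\<^sup>2" for u by (simp add: X_def)
  have XInr: "X (Inr ({u, v}, j)) = z u * z v / t" if "v \<in> nbrs G u" for u v j
    using that nbrs_irrefl[OF G, of u] by (cases "u = v") (auto simp: X_def)
  obtain c where "k = c + 3" using k by (metis le_Suc_ex add.commute)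
  then have kk: "k - 1 = Suc (Suc c)" "k - 2 = Suc c" "k - 3 = c" "k = Suc (Suc (Suc c))" by auto
  have dt: "0 < d + t\<^sup>2" using d t by (simp add: add_nonneg_pos)
  show ?thesis
  proof
    fix i assume i: "i \<in> verts (power_hypergraph k G)"
    show "0 < X i"
    proof (cases i)
      case (Inl u)
      then show ?thesis using i z0[of u] by (simp add: XInl)
    next
      case (Inr p)
      then obtain e j where p: "i = Inr (e, j)" "e \<in> edges G" using i by (cases p) auto
      then obtain u v where e: "e = {u, v}" and v: "v \<in> nbrs G u" by (auto elim: edgeE[OF G])
      have "u \<in> verts G" "v \<in> verts G" using v nbrs_subset[OF G] nbrs_in_verts[OF G] by blast+
      then have "0 < z u * z v / t" using z0 t by simp
      then show ?thesis unfolding p(1) e XInr[OF v] .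
    qed
  next
    fix i assume i: "i \<in> verts (power_hypergraph k G)"
    show "d * real (degree (power_hypergraph k G) i) * X i ^ (k - 1) +
      (\<Sum>e | e \<in> edges (power_hypergraph k G) \<and> i \<in> e. \<Prod>j\<in>e - {i}. X j) = (d + t\<^sup>2) * X i ^ (k - 1)"
    proof (cases i)
      case (Inl u)
      have u: "u \<in> verts G" using i Inl by simp
      have "(\<Sum>v\<in>nbrs G u. (d + (y v / y u) / t ^ (k - 2)) / (d + t\<^sup>2)) = 1"
        using y u by (simp add: ratio_solution_def ratio_sum_def degree_adjacency_ratio_def)
      then have "(\<Sum>v\<in>nbrs G u. d + (y v / y u) / t ^ (k - 2)) = d + t\<^sup>2"
        using dt by (simp add: sum_divide_distrib[symmetric])
      then have s: "d * card (nbrs G u) + (\<Sum>v\<in>nbrs G u. (y v / y u) / t ^ (k - 2)) = d + t\<^sup>2"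
        by (simp add: sum.distrib mult.commute)
      have "(\<Prod>j\<in>power_edge k {u, v} - {Inl u}. X j) = X (Inl u) ^ (k - 1) * ((y v / y u) / t ^ (k - 2))"
        if v: "v \<in> nbrs G u" for v
      proof -
        have vV: "v \<in> verts G" using v nbrs_subset[OF G] by blast
        have "(\<Prod>j\<in>power_edge k {u, v} - {Inl u}. X j) = (z v)\<^sup>2 * (z u * z v / t) ^ (k - 2)"
          using prod_power_edge_Inl[OF v, of X] XInr[OF v] by (simp add: XInl)
        also have "\<dots> = ((z u)\<^sup>2) ^ (k - 1) * ((z v ^ k / z u ^ k) / t ^ (k - 2))"
          using z0[OF u] z0[OF vV] t
          by (simp add: kk field_simps power2_eq_square power_mult_distrib)
        finally show ?thesis by (simp add: zk u vV XInl)
      qed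
      then have "(\<Sum>e | e \<in> edges (power_hypergraph k G) \<and> i \<in> e. \<Prod>j\<in>e - {i}. X j) =
          X i ^ (k - 1) * (\<Sum>v\<in>nbrs G u. (y v / y u) / t ^ (k - 2))"
        unfolding Inl sum_incident_power_Inl by (simp add: sum_distrib_left)
      then show ?thesis unfolding s[symmetric] by (simp add: Inl degree_power_Inl algebra_simps)
    next
      case (Inr p)
      then obtain e j where p: "i = Inr (e, j)" "e \<in> edges G" "j \<in> {1..k - 2}" using i by (cases p) auto
      then obtain u v where e: "e = {u, v}" and v: "v \<in> nbrs G u" by (auto elim: edgeE[OF G])
      have "(\<Sum>e | e \<in> edges (power_hypergraph k G) \<and> i \<in> e. \<Prod>j\<in>e - {i}. X j) =
          (z u)\<^sup>2 * (z v)\<^sup>2 * (z u * z v / t) ^ (k - 3)"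
        unfolding p(1) incident_power_Inr[OF p(2,3)]
        using prod_power_edge_Inr[OF v p(3), of X] XInr[OF v] by (simp add: XInl e)
      also have "\<dots> = t\<^sup>2 * X i ^ (k - 1)"
        unfolding p(1) e XInr[OF v] using t by (simp add: kk field_simps power2_eq_square)
      finally show ?thesis using degree_power_Inr[OF p(2,3)] by (simp add: p(1) algebra_simps)
    qed
  qed
qed

lemma rho_A_power_hypergraph:
  assumes "ratio_solution (degree_adjacency_ratio k 0 t) G y" "0 < t"
  shows "rho_A k (power_hypergraph k G) = t\<^sup>2"
proof -
  obtain X where "\<And>i. i \<in> verts (power_hypergraph k G) \<Longrightarrow> 0 < X i"
    "\<And>i. i \<in> verts (power_hypergraph k G) \<Longrightarrow>
      0 * real (degree (power_hypergraph k G) i) * X i ^ (k - 1) +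
      (\<Sum>e | e \<in> edges (power_hypergraph k G) \<and> i \<in> e. \<Prod>j\<in>e - {i}. X j) = (0 + t\<^sup>2) * X i ^ (k - 1)"
    using degree_adjacency_lift[OF assms order_refl] by blast
  then show ?thesis using k by (intro rho_A_eqI[OF uniform_power_hypergraph, of X]) auto
qed

lemma rho_Q_power_hypergraph:
  assumes "ratio_solution (degree_adjacency_ratio k 1 t) G y" "0 < t"
  shows "rho_Q k (power_hypergraph k G) = 1 + t\<^sup>2"
proof -
  obtain X where "\<And>i. i \<in> verts (power_hypergraph k G) \<Longrightarrow> 0 < X i"
    "\<And>i. i \<in> verts (power_hypergraph k G) \<Longrightarrow>
      1 * real (degree (power_hypergraph k G) i) * X i ^ (k - 1) +
      (\<Sum>e | e \<in> edges (power_hypergraph k G) \<and> i \<in> e. \<Prod>j\<in>e - {i}. X j) = (1 + t\<^sup>2) * X i ^ (k - 1)"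
    using degree_adjacency_lift[OF assms zero_le_one] by blast
  then show ?thesis using k by (intro rho_Q_eqI[OF uniform_power_hypergraph, of X]) auto
qed

lemma rho_Q_star_power_hypergraph:
  assumes y: "ratio_solution (incidence_ratio k t) G y" and t: "0 < t"
  shows "rho_Q_star k (power_hypergraph k G) = (t + real (k - 2)) ^ (k - 1)"
proof -
  have y0: "0 < y u" if "u \<in> verts G" for u using y that by (simp add: ratio_solution_def)
  define X :: "'a + 'a set \<times> nat \<Rightarrow> real" where
    "X i = (case i of Inl u \<Rightarrow> y u | Inr (e, j) \<Rightarrow> (\<Sum>u\<in>e. y u) / t)" for i
  have XInl: "X (Inl u) = y u" for u by (simp add: X_def)
  have XInr: "X (Inr ({u, v}, j)) = (y u + y v) / t" if "v \<in> nbrs G u" for u v j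
    using that nbrs_irrefl[OF G, of u] by (cases "u = v") (auto simp: X_def)
  have edge: "(\<Sum>j\<in>power_edge k {u, v}. X j) = (y u + y v) / t * (t + real (k - 2))"
    if "v \<in> nbrs G u" for u v
  proof -
    have "(\<Sum>j\<in>power_edge k {u, v}. X j) = y u + y v + real (k - 2) * ((y u + y v) / t)"
      using sum_power_edge[OF that, of X] XInr[OF that] by (simp add: XInl)
    then show ?thesis using t by (simp add: field_simps)
  qed
  show ?thesis
  proof (rule rho_Q_star_eqI[OF uniform_power_hypergraph, of X])
    fix i assume i: "i \<in> verts (power_hypergraph k G)"
    show "0 < X i"
    proof (cases i)
      case (Inl u)
      then show ?thesis using i y0[of u] by (simp add: XInl)
    next
      case (Inr p)
      then obtain e j where p: "i = Inr (e, j)" "e \<in> edges G" using i by (cases p) auto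
      then obtain u v where uv: "e = {u, v}" "v \<in> nbrs G u" by (auto elim: edgeE[OF G])
      then have "u \<in> verts G" "v \<in> verts G" using nbrs_subset[OF G] nbrs_in_verts[OF G] by blast+
      then show ?thesis using p uv y0[of u] y0[of v] t XInr[of v u j] by auto
    qed
  next
    fix i assume i: "i \<in> verts (power_hypergraph k G)"
    show "(\<Sum>e | e \<in> edges (power_hypergraph k G) \<and> i \<in> e. (\<Sum>j\<in>e. X j) ^ (k - 1)) =
        (t + real (k - 2)) ^ (k - 1) * X i ^ (k - 1)"
    proof (cases i)
      case (Inl u)
      have u: "u \<in> verts G" using i Inl by simp
      have s: "(\<Sum>v\<in>nbrs G u. ((1 + y v / y u) / t) ^ (k - 1)) = 1"
        using y u by (simp add: ratio_solution_def ratio_sum_def incidence_ratio_def)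
      have "(y u + y v) / t * (t + real (k - 2)) = (t + real (k - 2)) * y u * ((1 + y v / y u) / t)" for v
        using y0[OF u] t by (simp add: field_simps)
      then have "(\<Sum>j\<in>power_edge k {u, v}. X j) ^ (k - 1) =
          (t + real (k - 2)) ^ (k - 1) * y u ^ (k - 1) * ((1 + y v / y u) / t) ^ (k - 1)"
        if "v \<in> nbrs G u" for v
        by (simp only: edge[OF that] power_mult_distrib)
      then show ?thesis
        using s unfolding Inl sum_incident_power_Inl XInl by (simp add: sum_distrib_left[symmetric])
    next
      case (Inr p)
      then obtain e j where p: "i = Inr (e, j)" "e \<in> edges G" "j \<in> {1..k - 2}" using i by (cases p) auto
      then obtain u v where e: "e = {u, v}" and v: "v \<in> nbrs G u" by (auto elim: edgeE[OF G])
      show ?thesis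
        unfolding p(1) incident_power_Inr[OF p(2,3)]
        by (simp add: e edge[OF v] XInr[OF v] power_mult_distrib power_divide mult.commute)
    qed
  qed
qed

end

section \<open>Branches of a tree\<close>

lemma rtrancl_distinct_path:
  assumes "(x, y) \<in> r\<^sup>*"
  shows "\<exists>xs. xs \<noteq> [] \<and> hd xs = x \<and> last xs = y \<and> distinct xs \<and>
    (\<forall>i. Suc i < length xs \<longrightarrow> (xs ! i, xs ! Suc i) \<in> r)"
  using assms
proof induction
  case base
  then show ?case by (intro exI[of _ "[x]"]) auto
next
  case (step y z)
  then obtain xs where xs: "xs \<noteq> []" "hd xs = x" "last xs = y" "distinct xs"
    "\<And>i. Suc i < length xs \<Longrightarrow> (xs ! i, xs ! Suc i) \<in> r" by blast
  show ?case
  proof (cases "z \<in> set xs")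
    case True
    then obtain j where j: "j < length xs" "xs ! j = z" by (auto simp: in_set_conv_nth)
    have "last (take (Suc j) xs) = z" using j by (simp add: take_Suc_conv_app_nth)
    then show ?thesis using xs j by (intro exI[of _ "take (Suc j) xs"]) (auto simp: hd_take)
  next
    case False
    have "((xs @ [z]) ! i, (xs @ [z]) ! Suc i) \<in> r" if i: "Suc i < length (xs @ [z])" for i
    proof (cases "Suc i < length xs")
      case True
      then show ?thesis using xs(5)[of i] by (simp add: nth_append)
    next
      case F: False
      then have "i = length xs - 1" "Suc i = length xs" using i by auto
      then show ?thesis using xs(1,3) step.hyps(2) by (simp add: nth_append last_conv_nth)
    qed
    then show ?thesis using xs False by (intro exI[of _ "xs @ [z]"]) auto
  qed
qed

text \<open>The adjacency relation after deletion of the edge \<open>e\<close>.\<close>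

definition steps_avoiding :: "'a hypergraph \<Rightarrow> 'a set \<Rightarrow> ('a \<times> 'a) set" where
  "steps_avoiding T e = {(a, b). {a, b} \<in> edges T \<and> {a, b} \<noteq> e}"

text \<open>The component of \<open>b\<close> after deletion of the edge \<open>{a, b}\<close>.\<close>

definition branch :: "'a hypergraph \<Rightarrow> 'a \<Rightarrow> 'a \<Rightarrow> 'a set" where
  "branch T a b = {w. (b, w) \<in> (steps_avoiding T {a, b})\<^sup>*}"

lemma branch_self: "b \<in> branch T a b"
  by (simp add: branch_def)

lemma branch_step: "w \<in> branch T a b \<Longrightarrow> z \<in> nbrs T w \<Longrightarrow> {w, z} \<noteq> {a, b} \<Longrightarrow> z \<in> branch T a b"
  by (auto simp: branch_def steps_avoiding_def nbrs_def intro: rtrancl_into_rtrancl)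

lemma branch_induct [consumes 1, case_names self step]:
  assumes "w \<in> branch T a b" "P b"
    "\<And>w z. w \<in> branch T a b \<Longrightarrow> P w \<Longrightarrow> z \<in> nbrs T w \<Longrightarrow> {w, z} \<noteq> {a, b} \<Longrightarrow> P z"
  shows "P w"
proof -
  have "(b, w) \<in> (steps_avoiding T {a, b})\<^sup>*" using assms(1) by (simp add: branch_def)
  then have "w \<in> branch T a b \<and> P w"
  proof induction
    case base
    then show ?case using assms(2) branch_self by fast
  next
    case (step w z)
    then have "z \<in> nbrs T w" "{w, z} \<noteq> {a, b}" by (auto simp: steps_avoiding_def nbrs_def)
    then show ?case using assms(3)[of w z] branch_step[of w T a b z] step by blast
  qed
  then show ?thesis by blast
qed

lemma sym_steps_avoiding: "sym (steps_avoiding T e)"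
  by (auto simp: sym_def steps_avoiding_def insert_commute)

context
  fixes T :: "'a hypergraph"
  assumes T: "tree T"
begin

lemma tree_uniform: "uniform_hypergraph 2 T" and tree_connected: "connected_graph T"
  using T by (auto simp: tree_def)

text \<open>A path from \<open>b\<close> to \<open>a\<close> that avoids the edge \<open>{a, b}\<close> would close to a cycle.\<close>

lemma tree_edge_is_bridge:
  assumes ab: "b \<in> nbrs T a"
  shows "a \<notin> branch T a b"
proof
  assume "a \<in> branch T a b"
  then have "(b, a) \<in> (steps_avoiding T {a, b})\<^sup>*" by (simp add: branch_def)
  then obtain xs where xs: "xs \<noteq> []" "hd xs = b" "last xs = a" "distinct xs"
    "\<And>i. Suc i < length xs \<Longrightarrow> (xs ! i, xs ! Suc i) \<in> steps_avoiding T {a, b}"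
    using rtrancl_distinct_path by metis
  have ne: "a \<noteq> b" using ab nbrs_irrefl[OF tree_uniform] by blast
  have ends: "xs ! 0 = b" "xs ! (length xs - 1) = a" using xs by (auto simp: hd_conv_nth last_conv_nth)
  have "length xs \<noteq> 1" using ends ne by auto
  moreover have "length xs \<noteq> 2"
    using ends xs(5)[of 0] by (auto simp: steps_avoiding_def insert_commute numeral_2_eq_2)
  moreover have "length xs \<noteq> 0" using xs by simp
  ultimately have len: "length xs \<ge> 3" by linarith
  have "{xs ! i, xs ! (Suc i mod length xs)} \<in> edges T" if "i < length xs" for i
  proof (cases "Suc i < length xs")
    case True
    then show ?thesis using xs(5)[of i] by (simp add: steps_avoiding_def)
  next
    case False
    then have "i = length xs - 1" "Suc i = length xs" using that by auto
    then show ?thesis using ends ab by (simp add: nbrs_def)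
  qed
  then have "graph_cycle T xs" using len xs(4) by (simp add: graph_cycle_def)
  then show False using T by (auto simp: tree_def)
qed

lemma branch_subset: "b \<in> nbrs T a \<Longrightarrow> branch T a b \<subseteq> verts T"
proof
  fix w assume "b \<in> nbrs T a" "w \<in> branch T a b"
  from this(2) show "w \<in> verts T"
    by (induction rule: branch_induct) (use \<open>b \<in> nbrs T a\<close> nbrs_subset[OF tree_uniform] in blast)+
qed

lemma branch_Un: "b \<in> nbrs T a \<Longrightarrow> branch T a b \<union> branch T b a = verts T"
proof (rule connected_closed_eq_verts[OF tree_uniform tree_connected, of b])
  assume ab: "b \<in> nbrs T a"
  then have "a \<in> nbrs T b" by (simp add: nbrs_sym)
  then show "branch T a b \<union> branch T b a \<subseteq> verts T" using ab branch_subset by blast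
  fix u v assume u: "u \<in> branch T a b \<union> branch T b a" and v: "v \<in> nbrs T u"
  show "v \<in> branch T a b \<union> branch T b a"
  proof (cases "{u, v} = {a, b}")
    case True
    then have "v = a \<or> v = b" by (auto simp: doubleton_eq_iff)
    then show ?thesis using branch_self by fast
  next
    case False
    moreover from this have "{u, v} \<noteq> {b, a}" by (simp add: insert_commute)
    ultimately show ?thesis using branch_step[of u T a b v] branch_step[of u T b a v] u v by blast
  qed
qed (use branch_self in fast)

lemma branch_disjoint:
  assumes ab: "b \<in> nbrs T a" shows "branch T a b \<inter> branch T b a = {}"
proof (rule ccontr)
  assume "branch T a b \<inter> branch T b a \<noteq> {}"
  then obtain w where "(b, w) \<in> (steps_avoiding T {a, b})\<^sup>*" "(a, w) \<in> (steps_avoiding T {a, b})\<^sup>*"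
    by (auto simp: branch_def insert_commute)
  then have "(b, a) \<in> (steps_avoiding T {a, b})\<^sup>*"
    using sym_rtrancl[OF sym_steps_avoiding] by (meson rtrancl_trans symD)
  then show False using tree_edge_is_bridge[OF ab] by (simp add: branch_def)
qed

lemma branch_other_edge:
  assumes "v \<in> nbrs T u" "{u, v} \<noteq> {a, b}"
  shows "u \<in> branch T a b \<longleftrightarrow> v \<in> branch T a b"
proof -
  have "u \<in> nbrs T v" "{v, u} \<noteq> {a, b}" using assms by (simp_all add: nbrs_sym insert_commute)
  then show ?thesis using assms branch_step[of u T a b v] branch_step[of v T a b u] by blast
qed

lemma branch_subset_opposite:
  assumes v: "v \<in> nbrs T u" and v': "v' \<in> nbrs T u" and ne: "v \<noteq> v'"
  shows "branch T u v' \<subseteq> branch T v u"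
proof
  fix w assume "w \<in> branch T u v'"
  then show "w \<in> branch T v u"
  proof (induction rule: branch_induct)
    case self
    then show ?case using branch_other_edge[OF v', of v u] ne branch_self[of u T v] by (auto simp: doubleton_eq_iff)
  next
    case (step w z)
    have "w \<noteq> u" using step.hyps(1) tree_edge_is_bridge[OF v'] by blast
    moreover have "w \<noteq> v" using step.IH branch_disjoint[OF v] branch_self[of v T u] by blast
    ultimately have "{w, z} \<noteq> {v, u}" by (auto simp: doubleton_eq_iff)
    then show ?case using branch_step[OF step.IH step.hyps(2)] by blast
  qed
qed

lemma branches_disjoint:
  assumes "v \<in> nbrs T u" "v' \<in> nbrs T u" "v \<noteq> v'"
  shows "branch T u v \<inter> branch T u v' = {}"
  using branch_subset_opposite[OF assms] branch_disjoint[OF assms(1)] by blast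

lemma branches_Un:
  assumes u: "u \<in> verts T" shows "insert u (\<Union>v\<in>nbrs T u. branch T u v) = verts T"
proof (rule connected_closed_eq_verts[OF tree_uniform tree_connected, of u])
  show "insert u (\<Union>v\<in>nbrs T u. branch T u v) \<subseteq> verts T" using u branch_subset by blast
  fix w z assume w: "w \<in> insert u (\<Union>v\<in>nbrs T u. branch T u v)" and z: "z \<in> nbrs T w"
  show "z \<in> insert u (\<Union>v\<in>nbrs T u. branch T u v)"
  proof (cases "w = u")
    case True
    then show ?thesis using z branch_self[of z T u] by auto
  next
    case False
    then obtain v where v: "v \<in> nbrs T u" "w \<in> branch T u v" using w by blast
    show ?thesis
    proof (cases "{w, z} = {u, v}")
      case True
      then show ?thesis using False v by (auto simp: doubleton_eq_iff)
    next
      case False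
      then show ?thesis using branch_step[OF v(2) z] v by blast
    qed
  qed
qed simp

lemma finite_branch: "b \<in> nbrs T a \<Longrightarrow> finite (branch T a b)"
  using finite_subset[OF branch_subset finite_verts[OF tree_uniform]] .

lemma card_branch_pos: "b \<in> nbrs T a \<Longrightarrow> 1 \<le> card (branch T a b)"
  using finite_branch[of b a] branch_self[of b T a] card_gt_0_iff[of "branch T a b"] by fastforce

lemma card_branch_add:
  assumes "b \<in> nbrs T a" shows "card (branch T a b) + card (branch T b a) = card (verts T)"
  using assms card_Un_disjoint[OF finite_branch finite_branch branch_disjoint, of b a] branch_Un[of b a]
  by (simp add: nbrs_sym)

lemma sum_card_branches:
  assumes u: "u \<in> verts T" shows "Suc (\<Sum>v\<in>nbrs T u. card (branch T u v)) = card (verts T)"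
proof -
  have "card (\<Union>v\<in>nbrs T u. branch T u v) = (\<Sum>v\<in>nbrs T u. card (branch T u v))"
    using finite_nbrs[OF tree_uniform] finite_branch branches_disjoint by (intro card_UN_disjoint) auto
  moreover have "u \<notin> (\<Union>v\<in>nbrs T u. branch T u v)" using tree_edge_is_bridge by blast
  moreover have "finite (\<Union>v\<in>nbrs T u. branch T u v)"
    using finite_nbrs[OF tree_uniform] finite_branch by auto
  ultimately show ?thesis using branches_Un[OF u] by (metis card_insert_disjoint)
qed

text \<open>Each vertex other than a root \<open>r\<close> is matched with the edge towards \<open>r\<close>.\<close>

lemma tree_card_verts: "card (verts T) = Suc (card (edges T))"
proof -
  obtain r where r: "r \<in> verts T" using tree_uniform by (auto simp: uniform_hypergraph_def)
  have ex1: "\<exists>!v. v \<in> nbrs T w \<and> r \<in> branch T w v" if w: "w \<in> verts T - {r}" for w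
  proof -
    have "r \<in> insert w (\<Union>v\<in>nbrs T w. branch T w v)" using branches_Un[of w] w r by simp
    then obtain v where v: "v \<in> nbrs T w" "r \<in> branch T w v" using w by blast
    moreover have "v' = v" if "v' \<in> nbrs T w" "r \<in> branch T w v'" for v'
      using branches_disjoint[OF that(1) v(1)] that(2) v(2) by blast
    ultimately show ?thesis by blast
  qed
  define par where "par w = (THE v. v \<in> nbrs T w \<and> r \<in> branch T w v)" for w
  have par: "par w \<in> nbrs T w" "r \<in> branch T w (par w)" if "w \<in> verts T - {r}" for w
    using theI'[OF ex1[OF that]] unfolding par_def by auto
  have par_eq: "par w = v" if "w \<in> verts T - {r}" "v \<in> nbrs T w" "r \<in> branch T w v" for w v
    using ex1[OF that(1)] par[OF that(1)] that(2,3) by blast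
  have "bij_betw (\<lambda>w. {w, par w}) (verts T - {r}) (edges T)"
  proof (rule bij_betw_imageI)
    show "inj_on (\<lambda>w. {w, par w}) (verts T - {r})"
    proof (rule inj_onI, rule ccontr)
      fix w w' assume w: "w \<in> verts T - {r}" "w' \<in> verts T - {r}" "{w, par w} = {w', par w'}" "w \<noteq> w'"
      then have "par w = w'" "par w' = w" by (auto simp: doubleton_eq_iff)
      then show False using par[OF w(1)] par[OF w(2)] branch_disjoint[of w' w] by auto
    qed
    show "(\<lambda>w. {w, par w}) ` (verts T - {r}) = edges T"
    proof (intro equalityI subsetI)
      fix e assume "e \<in> (\<lambda>w. {w, par w}) ` (verts T - {r})"
      then show "e \<in> edges T" using par(1) by (auto simp: nbrs_def)
    next
      have *: "{a, b} \<in> (\<lambda>w. {w, par w}) ` (verts T - {r})" if b: "b \<in> nbrs T a" and r: "r \<in> branch T a b" for a b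
      proof -
        have a: "a \<in> verts T - {r}"
          using b r nbrs_in_verts[OF tree_uniform] tree_edge_is_bridge[OF b] by auto
        then show ?thesis using par_eq[OF a b r] by blast
      qed
      fix e assume "e \<in> edges T"
      then obtain a b where e: "e = {a, b}" and b: "b \<in> nbrs T a" by (auto elim: edgeE[OF tree_uniform])
      have "r \<in> branch T a b \<or> r \<in> branch T b a" using branch_Un[OF b] r by blast
      then show "e \<in> (\<lambda>w. {w, par w}) ` (verts T - {r})"
        using *[OF b] *[of a b] b unfolding e by (auto simp: nbrs_sym[of a] insert_commute)
    qed
  qed
  then have "card (verts T - {r}) = card (edges T)" by (rule bij_betw_same_card)
  then show ?thesis using r finite_verts[OF tree_uniform] by (metis card_Suc_Diff1)
qed

text \<open>A vector with prescribed ratios along the edges, as a product over all directed edges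
  \<open>(a, b)\<close> that point towards \<open>u\<close>, with factors \<open>sqrt (q a b)\<close>: only the edge \<open>{u, v}\<close> changes its direction when \<open>u\<close> is
  replaced by a neighbour \<open>v\<close>.\<close>

lemma tree_vector_with_ratios:
  fixes q :: "'a \<Rightarrow> 'a \<Rightarrow> real"
  assumes q: "\<And>a b. b \<in> nbrs T a \<Longrightarrow> 0 < q a b" "\<And>a b. b \<in> nbrs T a \<Longrightarrow> q a b * q b a = 1"
  shows "\<exists>x. (\<forall>u. 0 < x u) \<and> (\<forall>u v. v \<in> nbrs T u \<longrightarrow> x v / x u = q u v)"
proof -
  define D where "D = {(a, b). b \<in> nbrs T a}"
  have "D \<subseteq> verts T \<times> verts T"
    using nbrs_subset[OF tree_uniform] nbrs_in_verts[OF tree_uniform] by (fastforce simp: D_def)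
  then have finD: "finite D" using finite_verts[OF tree_uniform] finite_subset by blast
  define f where "f u = (\<lambda>(a, b). if u \<in> branch T a b then sqrt (q a b) else 1)" for u
  define x where "x u = (\<Prod>p\<in>D. f u p)" for u
  have fpos: "0 < f u p" if "p \<in> D" for u p using q(1) that by (auto simp: f_def D_def)
  have "x v / x u = q u v" if v: "v \<in> nbrs T u" for u v
  proof -
    have u: "u \<in> nbrs T v" using v by (simp add: nbrs_sym)
    have ne: "u \<noteq> v" using v nbrs_irrefl[OF tree_uniform] by blast
    let ?D = "D - {(u, v), (v, u)}"
    have D: "D = insert (u, v) (insert (v, u) ?D)" using u v by (auto simp: D_def)
    have split: "x w = f w (u, v) * (f w (v, u) * (\<Prod>p\<in>?D. f w p))" for w
      unfolding x_def using finD ne by (subst D, subst prod.insert) auto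
    have same: "(\<Prod>p\<in>?D. f v p) = (\<Prod>p\<in>?D. f u p)"
    proof (rule prod.cong[OF refl])
      fix p assume p: "p \<in> ?D"
      obtain a b where ab: "p = (a, b)" by (cases p)
      have "{u, v} \<noteq> {a, b}" using p ab by (auto simp: doubleton_eq_iff)
      then show "f v p = f u p" using branch_other_edge[OF v] by (simp add: f_def ab)
    qed
    have "f v (u, v) = sqrt (q u v)" "f u (u, v) = 1" "f v (v, u) = 1" "f u (v, u) = sqrt (q v u)"
      using branch_self[of v T u] branch_self[of u T v] tree_edge_is_bridge[OF u] tree_edge_is_bridge[OF v]
      by (simp_all add: f_def)
    moreover have "0 < (\<Prod>p\<in>?D. f u p)" using fpos by (intro prod_pos) auto
    ultimately have "x v / x u = sqrt (q u v) / sqrt (q v u)" unfolding split same by simp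
    also have "q v u = 1 / q u v" using q(1)[OF v] q(2)[OF v] by (simp add: field_simps)
    also have "sqrt (q u v) / sqrt (1 / q u v) = q u v" using q(1)[OF v] by (simp add: real_sqrt_divide)
    finally show ?thesis .
  qed
  moreover have "0 < x u" for u unfolding x_def using fpos by (intro prod_pos) auto
  ultimately show ?thesis by blast
qed

end

section \<open>The path has the smallest parameter\<close>

text \<open>The path with \<open>m\<close> edges, on the vertices \<open>0, \<dots>, m\<close>.\<close>

definition path_graph :: "nat \<Rightarrow> nat hypergraph" where
  "path_graph m = \<lparr>verts = {0..m}, edges = (\<lambda>i. {i, Suc i}) ` {..<m}\<rparr>"

lemma nbrs_path_graph: "nbrs (path_graph m) i = {j. j \<le> m \<and> i \<le> m \<and> (j = Suc i \<or> i = Suc j)}"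
  by (auto simp: nbrs_def path_graph_def doubleton_eq_iff image_iff)

lemma path_graph_uniform: "uniform_hypergraph 2 (path_graph m)"
  by (auto simp: path_graph_def uniform_hypergraph_def)

lemma path_graph_connected: "connected_graph (path_graph m)"
proof -
  let ?R = "{(a, b). {a, b} \<in> edges (path_graph m)}"
  have R: "(i, j) \<in> ?R" if "i \<in> nbrs (path_graph m) j" for i j using that by (simp add: nbrs_def insert_commute)
  have 0: "(0, i) \<in> ?R\<^sup>* \<and> (i, 0) \<in> ?R\<^sup>*" if "i \<le> m" for i
    using that
  proof (induction i)
    case (Suc i)
    have "(i, Suc i) \<in> ?R" by (rule R) (use Suc.prems in \<open>simp add: nbrs_path_graph\<close>)
    moreover have "(Suc i, i) \<in> ?R" by (rule R) (use Suc.prems in \<open>simp add: nbrs_path_graph\<close>)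
    ultimately show ?case using Suc by (meson Suc_leD converse_rtrancl_into_rtrancl rtrancl.rtrancl_into_rtrancl)
  qed simp
  show ?thesis
    unfolding connected_graph_def
  proof (intro ballI)
    fix u v assume "u \<in> verts (path_graph m)" "v \<in> verts (path_graph m)"
    then have "(u, 0) \<in> ?R\<^sup>*" "(0, v) \<in> ?R\<^sup>*" using 0 by (auto simp: path_graph_def)
    then show "(u, v) \<in> ?R\<^sup>*" by (rule rtrancl_trans)
  qed
qed

text \<open>A solution \<open>x\<close> of the ratio equations on the path, in terms of its ratios
  \<open>p i = x (i - 1) / x i\<close> for \<open>1 \<le> i \<le> m\<close>. The number \<open>g i\<close> is what a pendant path with \<open>i\<close>
  vertices contributes to the ratio sum at the vertex it is attached to.\<close>

locale path_ratios = ratio_function +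
  fixes t :: real and m :: nat and p :: "nat \<Rightarrow> real"
  assumes t: "t1 \<le> t"
    and p_pos: "\<And>i. 1 \<le> i \<Longrightarrow> i \<le> m \<Longrightarrow> 0 < p i"
    and first: "1 \<le> m \<Longrightarrow> h t (1 / p 1) = 1"
    and mid: "\<And>i. 1 \<le> i \<Longrightarrow> i < m \<Longrightarrow> h t (p i) + h t (1 / p (Suc i)) = 1"
    and last: "1 \<le> m \<Longrightarrow> h t (p m) = 1"
begin

definition g :: "nat \<Rightarrow> real" where
  "g i = (if i = 0 then 0 else h t (p i))"

lemma h_less_imp_less: "h t r < h t r' \<Longrightarrow> 0 < r \<Longrightarrow> 0 < r' \<Longrightarrow> r < r'"
  using h_mono_le[OF t, of r' r] by linarith

lemma h_inj: "h t r = h t r' \<Longrightarrow> 0 < r \<Longrightarrow> 0 < r' \<Longrightarrow> r = r'"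
  using h_mono[OF t, of r r'] h_mono[OF t, of r' r] by (cases r r' rule: linorder_cases) auto

lemma g_recip: "i < m \<Longrightarrow> g i + h t (1 / p (Suc i)) = 1"
  using first mid[of i] by (cases i) (auto simp: g_def)

lemma g_last: "1 \<le> m \<Longrightarrow> g m = 1"
  using last by (simp add: g_def)

lemma p_less_Suc: "1 \<le> i \<Longrightarrow> i < m \<Longrightarrow> p i < p (Suc i)"
proof (induction i rule: dec_induct)
  case base
  have "h t (1 / p (Suc 1)) < h t (1 / p 1)"
    using first mid[of 1] h_pos[OF t p_pos, of 1] base by simp
  then have "1 / p (Suc 1) < 1 / p 1" by (rule h_less_imp_less) (use p_pos[of 1] p_pos[of "Suc 1"] base in auto)
  then show ?case using p_pos[of 1] p_pos[of "Suc 1"] base by (simp add: field_simps)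
next
  case (step i)
  have pos: "0 < p i" "0 < p (Suc i)" "0 < p (Suc (Suc i))" using step p_pos by auto
  have "h t (p i) < h t (p (Suc i))" using step pos by (intro h_mono[OF t]) auto
  then have "h t (1 / p (Suc (Suc i))) < h t (1 / p (Suc i))"
    using mid[of i] mid[of "Suc i"] step by simp
  then have "1 / p (Suc (Suc i)) < 1 / p (Suc i)" by (rule h_less_imp_less) (use pos in auto)
  then show ?case using pos by (simp add: field_simps)
qed

lemma p_less: "1 \<le> i \<Longrightarrow> i < j \<Longrightarrow> j \<le> m \<Longrightarrow> p i < p j"
proof (induction j)
  case (Suc j)
  then show ?case using p_less_Suc[of j] by (cases "i = j") (auto simp: less_Suc_eq)
qed simp

text \<open>The recursion run from the other end of the path is the same.\<close>

lemma p_symmetric: "1 \<le> i \<Longrightarrow> i \<le> m \<Longrightarrow> p i * p (Suc m - i) = 1"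
proof (induction i rule: dec_induct)
  case base
  have "1 / p 1 = p m" by (rule h_inj) (use first last p_pos[of 1] p_pos[of m] base in auto)
  then show ?case using p_pos[of 1] base by (simp add: field_simps)
next
  case (step i)
  have pos: "0 < p i" "0 < p (Suc i)" "0 < p (m - i)" "0 < p (Suc m - i)" using step p_pos by auto
  have "p i * p (Suc m - i) = 1" using step by simp
  then have eq: "p i = 1 / p (Suc (m - i))" using pos step by (simp add: field_simps Suc_diff_le)
  have "h t (1 / p (Suc i)) = h t (p (m - i))"
  proof -
    have "h t (p i) + h t (1 / p (Suc i)) = 1" using step by (intro mid) auto
    moreover have "h t (p (m - i)) + h t (1 / p (Suc (m - i))) = 1" using step by (intro mid) auto
    ultimately show ?thesis unfolding eq by linarith
  qed
  then have "1 / p (Suc i) = p (m - i)" by (rule h_inj) (use pos in auto)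
  then show ?case using pos by (simp add: field_simps)
qed

text \<open>Making the sizes \<open>a\<close> and \<open>b\<close> of two pendant paths less equal does not increase their contribution.
  By the recursion for \<open>p\<close>, this compares \<open>h t r + h t (1 / r)\<close> at \<open>r = p (b + 1)\<close> and at
  \<open>r = 1 / p a\<close>; monotonicity and symmetry give \<open>p a < p (b + 1) \<le> 1 / p a\<close>.\<close>

lemma g_balance:
  assumes a: "1 \<le> a" "a \<le> b" "a + b \<le> m"
  shows "g (a - 1) + g (Suc b) \<le> g a + g b" "a + b < m \<Longrightarrow> g (a - 1) + g (Suc b) < g a + g b"
proof -
  have pos: "0 < p a" "0 < p (Suc b)" using p_pos a by auto
  have ga: "h t (1 / p a) = 1 - g (a - 1)" using g_recip[of "a - 1"] a by (simp add: algebra_simps)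
  have gb: "h t (1 / p (Suc b)) = 1 - g b" using g_recip[of b] a by simp
  have inc: "p a < p (Suc b)" by (rule p_less) (use a in auto)
  have sym: "p a * p (Suc m - a) = 1" using a by (intro p_symmetric) auto
  have strict: "g (a - 1) + g (Suc b) < g a + g b" if "p a * p (Suc b) < 1"
  proof -
    have "h t (p (Suc b)) + h t (1 / p (Suc b)) < h t (1 / p a) + h t (1 / (1 / p a))"
      using pos inc that by (intro h_recip[OF t]) (auto simp: field_simps)
    then show ?thesis using a unfolding ga gb by (simp add: g_def)
  qed
  show less: "g (a - 1) + g (Suc b) < g a + g b" if "a + b < m"
  proof (rule strict)
    have "p (Suc b) < p (Suc m - a)" by (rule p_less) (use a that in auto)
    then show "p a * p (Suc b) < 1" using pos sym by (metis mult_strict_left_mono)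
  qed
  show "g (a - 1) + g (Suc b) \<le> g a + g b"
  proof (cases "a + b < m")
    case True
    then show ?thesis using less by simp
  next
    case False
    then have "Suc m - a = Suc b" using a by simp
    then have "p (Suc b) = 1 / p a" using sym pos by (simp add: field_simps)
    then show ?thesis using ga gb a by (simp add: g_def)
  qed
qed

lemma g_subadditive_aux:
  assumes "a \<le> b" "a + b \<le> m"
  shows "g (a + b) \<le> g a + g b \<and> (1 \<le> a \<longrightarrow> a + b < m \<longrightarrow> g (a + b) < g a + g b)"
  using assms
proof (induction a arbitrary: b)
  case 0
  then show ?case by (simp add: g_def)
next
  case (Suc a)
  have "g (a + Suc b) \<le> g a + g (Suc b)" using Suc by (intro conjunct1[OF Suc.IH]) auto
  then show ?case using g_balance[of "Suc a" b] Suc.prems by auto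
qed

lemma g_subadditive: "a + b \<le> m \<Longrightarrow> g (a + b) \<le> g a + g b"
  using g_subadditive_aux[of a b] g_subadditive_aux[of b a] by (cases "a \<le> b") (auto simp: add.commute)

lemma g_strictly_subadditive: "1 \<le> a \<Longrightarrow> 1 \<le> b \<Longrightarrow> a + b < m \<Longrightarrow> g (a + b) < g a + g b"
  using g_subadditive_aux[of a b] g_subadditive_aux[of b a] by (cases "a \<le> b") (auto simp: add.commute)

text \<open>So branches with given sizes contribute at least as much as a single pendant path with the
  same number of vertices, and strictly more if there are three of them.\<close>

lemma g_sum_le:
  assumes "finite A" "sum f A \<le> m"
  shows "g (sum f A) \<le> (\<Sum>a\<in>A. g (f a))"
  using assms
proof (induction A)
  case (insert a A)
  have "g (f a + sum f A) \<le> g (f a) + g (sum f A)" using insert by (intro g_subadditive) auto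
  also have "\<dots> \<le> g (f a) + (\<Sum>a\<in>A. g (f a))" using insert by simp
  finally show ?case using insert by simp
qed (simp add: g_def)

lemma g_sum_less:
  fixes A :: "'b set"
  assumes fin: "finite A" and sum: "sum f A \<le> m" and card: "3 \<le> card A" and f: "\<And>a. a \<in> A \<Longrightarrow> 1 \<le> f a"
  shows "g (sum f A) < (\<Sum>a\<in>A. g (f a))"
proof -
  obtain B where B: "B \<subseteq> A" "card B = 3" using card by (meson obtain_subset_with_card_n)
  then obtain a b c where abc: "B = {a, b, c}" "a \<noteq> b" "a \<noteq> c" "b \<noteq> c" by (auto simp: card_3_iff)
  let ?C = "A - {a, b}"
  have C: "?C = A - {a} - {b}" by auto
  have split: "sum F A = F a + (F b + sum F ?C)" for F :: "'b \<Rightarrow> 'd :: comm_monoid_add"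
    unfolding C using fin B abc
    by (metis Diff_iff finite_Diff insertCI singletonD subsetD sum.remove)
  have "c \<in> ?C" using B abc by auto
  then have "f c \<le> sum f ?C" using fin by (intro member_le_sum) auto
  moreover have "1 \<le> f c" using f B abc by auto
  ultimately have "f a + f b < m" using sum split[of f] by linarith
  then have less: "g (f a + f b) < g (f a) + g (f b)"
    using f B abc by (intro g_strictly_subadditive) auto
  have "g (sum f A) = g ((f a + f b) + sum f ?C)" by (simp add: split[of f] add.assoc)
  also have "\<dots> \<le> g (f a + f b) + g (sum f ?C)"
    using sum split[of f] by (intro g_subadditive) linarith
  also have "g (sum f ?C) \<le> (\<Sum>a\<in>?C. g (f a))"
    using fin sum split[of f] by (intro g_sum_le) auto
  finally show ?thesis using less split[of "\<lambda>a. g (f a)"] by simp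
qed

end

context ratio_function
begin

lemma path_ratios_of_solution:
  assumes t: "t1 \<le> t" and x: "ratio_solution (h t) (path_graph m) x"
  shows "path_ratios h t1 t m (\<lambda>i. x (i - 1) / x i)"
proof -
  have x0: "0 < x i" if "i \<le> m" for i using x that by (simp add: ratio_solution_def path_graph_def)
  have eq: "(\<Sum>j\<in>nbrs (path_graph m) i. h t (x j / x i)) = 1" if "i \<le> m" for i
    using x that by (simp add: ratio_solution_def path_graph_def ratio_sum_def)
  show ?thesis
  proof
    show "t1 \<le> t" by (rule t)
    show "0 < x (i - 1) / x i" if "1 \<le> i" "i \<le> m" for i using x0[of i] x0[of "i - 1"] that by simp
    show "h t (1 / (x (1 - 1) / x 1)) = 1" if "1 \<le> m"
    proof -
      have "nbrs (path_graph m) 0 = {1}" using that by (auto simp: nbrs_path_graph)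
      then show ?thesis using eq[of 0] by simp
    qed
    show "h t (x (m - 1) / x m) = 1" if "1 \<le> m"
    proof -
      have "nbrs (path_graph m) m = {m - 1}" using that by (auto simp: nbrs_path_graph)
      then show ?thesis using eq[of m] by simp
    qed
    show "h t (x (i - 1) / x i) + h t (1 / (x (Suc i - 1) / x (Suc i))) = 1" if "1 \<le> i" "i < m" for i
    proof -
      have "nbrs (path_graph m) i = {i - 1, Suc i}" using that by (auto simp: nbrs_path_graph)
      then show ?thesis using eq[of i] that by simp
    qed
  qed
qed

text \<open>The test vector on the tree has \<open>x\<^sub>v / x\<^sub>u = p i\<close> along each edge, where \<open>i\<close> is the number of
  vertices of the branch at \<open>u\<close> that contains \<open>v\<close>; by the symmetry of \<open>p\<close> the two directions of an
  edge agree. Its ratio sum at \<open>u\<close> is the total contribution of the branches at \<open>u\<close>, whose sizes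
  add up to \<open>m\<close>, hence at least \<open>g m = 1\<close>.\<close>

theorem path_parameter_less:
  assumes T: "tree T" and m: "card (edges T) = m" "1 \<le> m"
    and t: "t1 \<le> t" and x: "ratio_solution (h t) (path_graph m) x"
    and s: "t1 \<le> s" and y: "ratio_solution (h s) T y"
    and u0: "u0 \<in> verts T" "3 \<le> card (nbrs T u0)"
  shows "t < s"
proof -
  define p where "p i = x (i - 1) / x i" for i
  interpret path_ratios h t1 t m p
    using path_ratios_of_solution[OF t x] by (simp add: p_def[abs_def])
  define q where "q a b = p (card (branch T a b))" for a b
  have V: "card (verts T) = Suc m" using tree_card_verts[OF T] m by simp
  have add: "card (branch T a b) + card (branch T b a) = Suc m" if "b \<in> nbrs T a" for a b
    using card_branch_add[OF T that] V by simp
  have range: "1 \<le> card (branch T a b) \<and> card (branch T a b) \<le> m" if "b \<in> nbrs T a" for a b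
    using add[OF that] card_branch_pos[OF T, of b a] card_branch_pos[OF T, of a b] that
    by (simp add: nbrs_sym[of a])
  have "\<exists>z. (\<forall>u. 0 < z u) \<and> (\<forall>u v. v \<in> nbrs T u \<longrightarrow> z v / z u = q u v)"
  proof (rule tree_vector_with_ratios[OF T])
    fix a b assume b: "b \<in> nbrs T a"
    show "0 < q a b" using p_pos range[OF b] by (simp add: q_def)
    have "card (branch T b a) = Suc m - card (branch T a b)" using add[OF b] by simp
    then show "q a b * q b a = 1" using p_symmetric range[OF b] by (simp add: q_def)
  qed
  then obtain z where z: "\<And>u. 0 < z u" "\<And>u v. v \<in> nbrs T u \<Longrightarrow> z v / z u = q u v" by blast
  have sum: "ratio_sum (h t) T z u = (\<Sum>v\<in>nbrs T u. g (card (branch T u v)))" for u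
    unfolding ratio_sum_def
  proof (rule sum.cong[OF refl])
    fix v assume v: "v \<in> nbrs T u"
    then show "h t (z v / z u) = g (card (branch T u v))"
      using z(2)[OF v] range[OF v] by (simp add: q_def g_def)
  qed
  have total: "(\<Sum>v\<in>nbrs T u. card (branch T u v)) = m" if "u \<in> verts T" for u
    using sum_card_branches[OF T that] V by simp
  note fin = finite_nbrs[OF tree_uniform[OF T]]
  show ?thesis
  proof (rule parameter_less[OF tree_uniform[OF T] tree_connected[OF T] t s])
    show "0 < z u" for u by (rule z)
    show "1 \<le> ratio_sum (h t) T z u" if "u \<in> verts T" for u
      using g_sum_le[OF fin, of "\<lambda>v. card (branch T u v)" u] total[OF that] g_last[OF m(2)] by (simp add: sum)
    show "0 < y u" "ratio_sum (h s) T y u \<le> 1" if "u \<in> verts T" for u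
      using y that by (simp_all add: ratio_solution_def)
    have "1 < ratio_sum (h t) T z u0"
      using g_sum_less[OF fin _ u0(2), of "\<lambda>v. card (branch T u0 v)"] total[OF u0(1)] g_last[OF m(2)] range
      by (simp add: sum)
    then show "\<exists>u\<in>verts T. 1 < ratio_sum (h t) T z u \<or> ratio_sum (h s) T y u < 1" using u0(1) by blast
  qed
qed

end

section \<open>The ratio functions of the three tensors\<close>

lemma add_inverse_less:
  fixes r r' :: real
  assumes "0 < r" "r < r'" "1 < r * r'"
  shows "r + 1 / r < r' + 1 / r'"
proof -
  have "(r' - r) * 1 < (r' - r) * (r * r')" using assms by (intro mult_strict_left_mono) auto
  then show ?thesis using assms by (simp add: field_simps)
qed

lemma power_add_inverse_less:
  fixes r r' :: real
  assumes r: "0 < r" "r < r'" "1 < r * r'" and n: "1 \<le> n"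
  shows "(1 + r) ^ n + (1 + 1 / r) ^ n < (1 + r') ^ n + (1 + 1 / r') ^ n"
proof -
  have expand: "(1 + s) ^ n + (1 + 1 / s) ^ n = (\<Sum>j\<le>n. real (n choose j) * (s ^ j + 1 / s ^ j))" for s :: real
    using binomial_ring[of s 1 n] binomial_ring[of "1 / s" 1 n]
    by (simp add: add.commute sum.distrib[symmetric] algebra_simps power_divide)
  have strict: "r ^ j + 1 / r ^ j < r' ^ j + 1 / r' ^ j" if "1 \<le> j" for j
  proof (rule add_inverse_less)
    show "r ^ j < r' ^ j" using r that by (intro power_strict_mono) auto
    have "1 < (r * r') ^ j" using r that by (intro one_less_power) auto
    then show "1 < r ^ j * r' ^ j" by (simp add: power_mult_distrib)
  qed (use r in simp)
  show ?thesis
    unfolding expand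
  proof (rule sum_strict_mono_ex1)
    show "\<forall>j\<in>{..n}. real (n choose j) * (r ^ j + 1 / r ^ j) \<le> real (n choose j) * (r' ^ j + 1 / r' ^ j)"
    proof
      fix j assume "j \<in> {..n}"
      show "real (n choose j) * (r ^ j + 1 / r ^ j) \<le> real (n choose j) * (r' ^ j + 1 / r' ^ j)"
        using strict[of j] by (cases "j = 0") (auto intro!: mult_left_mono)
    qed
    show "\<exists>j\<in>{..n}. real (n choose j) * (r ^ j + 1 / r ^ j) < real (n choose j) * (r' ^ j + 1 / r' ^ j)"
      using strict[of 1] n by (intro bexI[of _ 1]) auto
  qed simp
qed

lemma ratio_function_degree_adjacency:
  assumes k: "k \<ge> 3" and d: "0 \<le> d"
  shows "ratio_function (degree_adjacency_ratio k d) 1"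
proof
  fix t r r' :: real assume t: "1 \<le> t"
  have den: "0 < d + t\<^sup>2" using d t by (intro add_nonneg_pos) auto
  show "0 < r \<Longrightarrow> 0 < degree_adjacency_ratio k d t r"
    using d t den unfolding degree_adjacency_ratio_def by (intro divide_pos_pos add_nonneg_pos) auto
  show "r < r' \<Longrightarrow> degree_adjacency_ratio k d t r < degree_adjacency_ratio k d t r'"
    using t den unfolding degree_adjacency_ratio_def
    by (intro divide_strict_right_mono add_strict_left_mono) auto
  show "\<exists>r>0. 1 < degree_adjacency_ratio k d t r"
    using t den d by (intro exI[of _ "t ^ (k - 2) * (d + t\<^sup>2 + 1)"])
      (auto simp: degree_adjacency_ratio_def intro!: mult_pos_pos add_nonneg_pos)
  assume r: "0 < r" "r < r'" "1 < r * r'"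
  have eq: "degree_adjacency_ratio k d t s + degree_adjacency_ratio k d t (1 / s) =
      (2 * d + (s + 1 / s) / t ^ (k - 2)) / (d + t\<^sup>2)" for s
    unfolding degree_adjacency_ratio_def add_divide_distrib[symmetric] by (simp add: add_divide_distrib)
  show "degree_adjacency_ratio k d t r + degree_adjacency_ratio k d t (1 / r) <
      degree_adjacency_ratio k d t r' + degree_adjacency_ratio k d t (1 / r')"
    unfolding eq using add_inverse_less[OF r] t den
    by (intro divide_strict_right_mono add_strict_left_mono) auto
next
  fix t t' r :: real assume t: "1 \<le> t" "t < t'" and r: "0 < r"
  have "0 < t ^ (k - 2)" "t ^ (k - 2) \<le> t' ^ (k - 2)" using t by (auto intro!: power_mono)
  then have "r / t' ^ (k - 2) \<le> r / t ^ (k - 2)" using r by (intro divide_left_mono) auto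
  moreover have "0 < d + r / t' ^ (k - 2)" using d t r by (intro add_nonneg_pos) auto
  moreover have "0 < d + t\<^sup>2" using d t by (intro add_nonneg_pos) auto
  moreover have "t\<^sup>2 < t'\<^sup>2" using t by (intro power_strict_mono) auto
  ultimately show "degree_adjacency_ratio k d t' r < degree_adjacency_ratio k d t r"
    unfolding degree_adjacency_ratio_def by (intro frac_less2) auto
next
  have "d + t\<^sup>2 \<noteq> 0" if "1 \<le> t" for t :: real
  proof -
    have "0 < d + t\<^sup>2" using d that by (intro add_nonneg_pos) auto
    then show ?thesis by simp
  qed
  then show "continuous_on ({1..} \<times> {0<..}) (\<lambda>(t, r). degree_adjacency_ratio k d t r)"
    unfolding degree_adjacency_ratio_def case_prod_unfold by (intro continuous_intros) auto
  show "degree_adjacency_ratio k d 1 1 = 1" using d by (simp add: degree_adjacency_ratio_def)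
next
  fix e :: real assume e: "0 < e"
  define t where "t = max 1 ((d + 1) / e)"
  have t: "1 \<le> t" "(d + 1) / e \<le> t" by (auto simp: t_def)
  have "degree_adjacency_ratio k d t 1 \<le> (d + 1) / t"
    unfolding degree_adjacency_ratio_def
  proof (rule frac_le)
    show "d + 1 / t ^ (k - 2) \<le> d + 1" using t by simp
    have "t \<le> t\<^sup>2" using t by (simp add: power2_eq_square)
    then show "t \<le> d + t\<^sup>2" using d by simp
  qed (use d t in auto)
  also have "\<dots> \<le> e" using t e by (simp add: field_simps)
  finally show "\<exists>t\<ge>1. degree_adjacency_ratio k d t 1 \<le> e" using t by blast
qed

lemma ratio_function_incidence:
  assumes k: "k \<ge> 3"
  shows "ratio_function (incidence_ratio k) 2"
proof
  fix t r r' :: real assume t: "2 \<le> t"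
  show "0 < r \<Longrightarrow> 0 < incidence_ratio k t r"
    using t by (simp add: incidence_ratio_def)
  show "0 < r \<Longrightarrow> r < r' \<Longrightarrow> incidence_ratio k t r < incidence_ratio k t r'"
    using t k unfolding incidence_ratio_def by (intro power_strict_mono divide_strict_right_mono) auto
  show "\<exists>r>0. 1 < incidence_ratio k t r"
    using t k by (intro exI[of _ t]) (auto simp: incidence_ratio_def intro!: one_less_power)
  assume r: "0 < r" "r < r'" "1 < r * r'"
  show "incidence_ratio k t r + incidence_ratio k t (1 / r) < incidence_ratio k t r' + incidence_ratio k t (1 / r')"
    unfolding incidence_ratio_def power_divide add_divide_distrib[symmetric]
    using power_add_inverse_less[OF r, of "k - 1"] k t by (intro divide_strict_right_mono) (auto simp: power_divide)
next
  fix t t' r :: real assume "2 \<le> t" "t < t'" "0 < r"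
  then show "incidence_ratio k t' r < incidence_ratio k t r"
    using k unfolding incidence_ratio_def by (intro power_strict_mono divide_strict_left_mono) auto
next
  show "continuous_on ({2..} \<times> {0<..}) (\<lambda>(t, r). incidence_ratio k t r)"
    unfolding incidence_ratio_def case_prod_unfold by (intro continuous_intros) auto
  show "incidence_ratio k 2 1 = 1" by (simp add: incidence_ratio_def)
next
  fix e :: real assume e: "0 < e"
  define t where "t = max 2 (2 / e)"
  have t: "2 \<le> t" "2 / e \<le> t" by (auto simp: t_def)
  have "(2 / t) ^ (k - 1) \<le> (2 / t) ^ 1" using t k by (intro power_decreasing) auto
  also have "\<dots> \<le> e" using t e by (simp add: field_simps)
  finally show "\<exists>t\<ge>2. incidence_ratio k t 1 \<le> e" using t by (auto simp: incidence_ratio_def)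
qed

section \<open>The star has the largest parameter\<close>

text \<open>The star with centre \<open>0\<close> and leaves \<open>1, \<dots>, m\<close>.\<close>

definition star_graph :: "nat \<Rightarrow> nat hypergraph" where
  "star_graph m = \<lparr>verts = {0..m}, edges = (\<lambda>i. {0, i}) ` {1..m}\<rparr>"

lemma nbrs_star_graph:
  "nbrs (star_graph m) 0 = {1..m}" "1 \<le> i \<Longrightarrow> i \<le> m \<Longrightarrow> nbrs (star_graph m) i = {0}"
  by (auto simp: nbrs_def star_graph_def doubleton_eq_iff image_iff)

lemma star_graph_uniform: "uniform_hypergraph 2 (star_graph m)"
  by (auto simp: star_graph_def uniform_hypergraph_def)

lemma star_graph_solution:
  assumes "0 < s" "real m * h s = 1" "h (1 / s) = 1"
  shows "ratio_solution h (star_graph m) (\<lambda>i. if i = 0 then 1 else s)"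
  unfolding ratio_solution_def
proof (intro ballI conjI)
  fix u assume "u \<in> verts (star_graph m)"
  then have u: "u \<le> m" by (simp add: star_graph_def)
  show "ratio_sum h (star_graph m) (\<lambda>i. if i = 0 then 1 else s) u = 1"
  proof (cases "u = 0")
    case True
    then show ?thesis using assms by (simp add: ratio_sum_def nbrs_star_graph)
  next
    case False
    then show ?thesis using assms u nbrs_star_graph(2)[of u m] by (simp add: ratio_sum_def)
  qed
qed (use assms in simp)

lemma convex_power_nonneg: "convex_on {0::real..} (\<lambda>x. x ^ n)"
  using convex_power_even[of n] convex_power_odd[of n] convex_on_subset by (cases "even n") blast+

lemma convex_power_combination:
  fixes a b s :: real
  assumes "0 \<le> a" "0 \<le> b" "0 < s" "s < 1"
  shows "(a + b) ^ q \<le> s * (a / s) ^ q + (1 - s) * (b / (1 - s)) ^ q"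
proof -
  have "(s *\<^sub>R (a / s) + (1 - s) *\<^sub>R (b / (1 - s))) ^ q \<le> s * (a / s) ^ q + (1 - s) * (b / (1 - s)) ^ q"
    using assms convex_onD[OF convex_power_nonneg, of "1 - s" "a / s" "b / (1 - s)" q] by simp
  then show ?thesis using assms by simp
qed

text \<open>A positive vector all of whose ratio sums are at most one, not all equal to one. If \<open>h\<close> belongs
  to a parameter \<open>t\<close>, such a vector shows that the parameter of the solution on \<open>T\<close> is less than \<open>t\<close>.\<close>

definition strict_subsolution :: "'a hypergraph \<Rightarrow> (real \<Rightarrow> real) \<Rightarrow> ('a \<Rightarrow> real) \<Rightarrow> bool" where
  "strict_subsolution T h y \<longleftrightarrow> (\<forall>u\<in>verts T. 0 < y u \<and> ratio_sum h T y u \<le> 1) \<and> (\<exists>u\<in>verts T. ratio_sum h T y u < 1)"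

context
  fixes T :: "'a hypergraph"
  assumes T: "tree T"
begin

lemma card_nbrs_pos:
  assumes "edges T \<noteq> {}" "u \<in> verts T" shows "1 \<le> card (nbrs T u)"
  using nbrs_nonempty[OF tree_uniform[OF T] tree_connected[OF T] assms] finite_nbrs[OF tree_uniform[OF T], of u]
  by (simp add: Suc_le_eq card_gt_0_iff)

lemma incident_card: "card {e. e \<in> edges T \<and> u \<in> e} = card (nbrs T u)"
  using degree_eq_card_nbrs[OF tree_uniform[OF T], of u] by (simp add: degree_def)

lemma card_nbrs_le: "card (nbrs T u) \<le> card (edges T)"
  unfolding incident_card[symmetric] using finite_edges[OF tree_uniform[OF T]] by (intro card_mono) auto

text \<open>There are no triangles, so each edge meets the neighbourhood of a vertex at most once.\<close>

lemma sum_card_nbrs_le: "(\<Sum>v\<in>nbrs T u. card (nbrs T v)) \<le> card (edges T)"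
proof -
  note U = tree_uniform[OF T]
  have disj: "{e. e \<in> edges T \<and> v \<in> e} \<inter> {e. e \<in> edges T \<and> v' \<in> e} = {}"
    if v: "v \<in> nbrs T u" "v' \<in> nbrs T u" "v \<noteq> v'" for v v'
  proof (rule ccontr)
    assume "{e. e \<in> edges T \<and> v \<in> e} \<inter> {e. e \<in> edges T \<and> v' \<in> e} \<noteq> {}"
    then obtain e where e: "e \<in> edges T" "v \<in> e" "v' \<in> e" by blast
    then obtain a b where "e = {a, b}" by (auto elim: edgeE[OF U])
    with e v(3) have "e = {v, v'}" by auto
    with e have vv: "v' \<in> nbrs T v" by (simp add: nbrs_def)
    have "u \<noteq> v" using v(1) nbrs_irrefl[OF U] by blast
    then have "{v, v'} \<noteq> {u, v'}" using v(3) by (auto simp: doubleton_eq_iff)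
    then have "v \<in> branch T u v'" using branch_other_edge[OF T vv] branch_self by metis
    then show False using branches_disjoint[OF T v] branch_self[of v T u] by blast
  qed
  have "(\<Sum>v\<in>nbrs T u. card (nbrs T v)) = card (\<Union>v\<in>nbrs T u. {e. e \<in> edges T \<and> v \<in> e})"
    unfolding incident_card[symmetric] using finite_nbrs[OF U] finite_edges[OF U] disj
    by (intro card_UN_disjoint[symmetric]) auto
  also have "\<dots> \<le> card (edges T)" using finite_edges[OF U] by (intro card_mono) auto
  finally show ?thesis .
qed

lemma card_nbrs_add_le:
  assumes v: "v \<in> nbrs T u" shows "card (nbrs T u) + card (nbrs T v) \<le> Suc (card (edges T))"
proof -
  note U = tree_uniform[OF T]
  let ?I = "\<lambda>u. {e. e \<in> edges T \<and> u \<in> e}"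
  have fin: "finite (?I w)" for w using finite_edges[OF U] by simp
  have "u \<noteq> v" using v nbrs_irrefl[OF U] by blast
  then have "e = {u, v}" if "e \<in> ?I u \<inter> ?I v" for e
    using that by (auto elim!: edgeE[OF U])
  then have "card (?I u \<inter> ?I v) \<le> card {{u, v}}" by (intro card_mono) auto
  moreover have "card (?I u \<union> ?I v) \<le> card (edges T)" using finite_edges[OF U] by (intro card_mono) auto
  ultimately show ?thesis
    using card_Un_Int[OF fin fin, of u v] unfolding incident_card by simp
qed

text \<open>A smallest branch consists of a leaf.\<close>

lemma leaf_exists:
  assumes E: "edges T \<noteq> {}"
  shows "\<exists>u v. u \<in> verts T \<and> nbrs T u = {v}"
proof -
  note U = tree_uniform[OF T]
  let ?P = "\<lambda>p. snd p \<in> nbrs T (fst p)"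
  obtain a0 b0 where "b0 \<in> nbrs T a0" using E by (metis edgeE[OF U] ex_in_conv)
  then have "?P (a0, b0)" by simp
  then obtain p where p: "?P p" "\<And>p'. ?P p' \<Longrightarrow> card (branch T (fst p) (snd p)) \<le> card (branch T (fst p') (snd p'))"
    using ex_has_least_nat[of ?P "(a0, b0)" "\<lambda>p. card (branch T (fst p) (snd p))"] by blast
  obtain a b where ab: "p = (a, b)" by (cases p)
  have b: "b \<in> nbrs T a" using p(1) ab by simp
  have a: "a \<in> nbrs T b" using b nbrs_sym by fast
  have "v = a" if v: "v \<in> nbrs T b" for v
  proof (rule ccontr)
    assume "v \<noteq> a"
    then have sub: "branch T b v \<subseteq> branch T a b" using branch_subset_opposite[OF T a v] by simp
    have "b \<in> branch T a b" "b \<notin> branch T b v" using branch_self tree_edge_is_bridge[OF T v] by fast+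
    then have "card (branch T b v) < card (branch T a b)"
      using sub finite_branch[OF T b] by (intro psubset_card_mono) auto
    then show False using p(2)[of "(b, v)"] v ab by simp
  qed
  then have "nbrs T b = {a}" using a by blast
  then show ?thesis using nbrs_subset[OF U, of a] b by blast
qed

text \<open>The test vectors in the next three lemmas are functions of the degree that are exact for the star.
  Here it is the square root of the degree, and the Cauchy-Schwarz inequality bounds the ratio sum
  at \<open>u\<close> by \<open>sqrt (D u / m)\<close>, where \<open>D u \<le> m\<close> is the sum of the degrees of the neighbours of \<open>u\<close>.\<close>

lemma star_bound_adjacency:
  assumes k: "k \<ge> 3" and m: "card (edges T) = m" "1 \<le> m"
  shows "\<exists>t\<ge>1. (\<exists>x. ratio_solution (degree_adjacency_ratio k 0 t) (star_graph m) x) \<and>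
    ((\<forall>u\<in>verts T. card (nbrs T u) < m) \<longrightarrow> (\<exists>y. strict_subsolution T (degree_adjacency_ratio k 0 t) y))"
proof -
  note U = tree_uniform[OF T]
  define t where "t = root k (sqrt m)"
  have sm: "1 \<le> sqrt m" using m by simp
  have t: "1 \<le> t" unfolding t_def using sm k by simp
  have "t ^ k = sqrt m" unfolding t_def using k by simp
  moreover have "k - 2 + 2 = k" using k by simp
  then have "t ^ k = t ^ (k - 2) * t\<^sup>2" by (metis power_add)
  ultimately have h: "degree_adjacency_ratio k 0 t r = r / sqrt m" for r
    by (simp add: degree_adjacency_ratio_def)
  have "ratio_solution (degree_adjacency_ratio k 0 t) (star_graph m) (\<lambda>i. if i = 0 then 1 else 1 / sqrt m)"
    using m by (intro star_graph_solution) (auto simp: h)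
  moreover have "\<exists>y. strict_subsolution T (degree_adjacency_ratio k 0 t) y" if nonstar: "\<forall>u\<in>verts T. card (nbrs T u) < m"
  proof -
    define D where "D u = (\<Sum>v\<in>nbrs T u. card (nbrs T v))" for u
    define y where "y u = sqrt (card (nbrs T u))" for u
    have E: "edges T \<noteq> {}" using m by auto
    have ypos: "0 < y u" if "u \<in> verts T" for u using card_nbrs_pos[OF E that] by (simp add: y_def)
    have le: "ratio_sum (degree_adjacency_ratio k 0 t) T y u \<le> sqrt (D u) / sqrt m" if u: "u \<in> verts T" for u
    proof -
      have "(\<Sum>v\<in>nbrs T u. 1 * y v)\<^sup>2 \<le> (\<Sum>v\<in>nbrs T u. 1\<^sup>2) * (\<Sum>v\<in>nbrs T u. (y v)\<^sup>2)"
        by (rule Cauchy_Schwarz_ineq_sum)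
      also have "\<dots> = (y u)\<^sup>2 * D u" by (simp add: y_def D_def)
      finally have "(\<Sum>v\<in>nbrs T u. y v) \<le> sqrt ((y u)\<^sup>2 * D u)" by (simp add: real_le_rsqrt)
      also have "\<dots> = y u * sqrt (D u)" using ypos[OF u] by (simp add: real_sqrt_mult)
      finally have "(\<Sum>v\<in>nbrs T u. y v) / y u \<le> sqrt (D u)" using ypos[OF u] by (simp add: field_simps)
      then have "(\<Sum>v\<in>nbrs T u. y v) / y u / sqrt m \<le> sqrt (D u) / sqrt m" by (intro divide_right_mono) auto
      then show ?thesis by (simp add: ratio_sum_def h sum_divide_distrib)
    qed
    have D: "D u \<le> m" for u using sum_card_nbrs_le m by (simp add: D_def)
    obtain u v where uv: "u \<in> verts T" "nbrs T u = {v}" using leaf_exists[OF E] by blast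
    have "v \<in> verts T" using uv nbrs_subset[OF U, of u] by blast
    then have "D u < m" using nonstar by (simp add: D_def uv)
    then have "sqrt (D u) / sqrt m < 1" using m by simp
    then have "ratio_sum (degree_adjacency_ratio k 0 t) T y u < 1" using le[OF uv(1)] by simp
    moreover have "ratio_sum (degree_adjacency_ratio k 0 t) T y w \<le> 1" if "w \<in> verts T" for w
    proof -
      have "sqrt (D w) / sqrt m \<le> 1" using D[of w] m by simp
      then show ?thesis using le[OF that] by simp
    qed
    ultimately have "strict_subsolution T (degree_adjacency_ratio k 0 t) y"
      using ypos uv(1) unfolding strict_subsolution_def by blast
    then show ?thesis by blast
  qed
  ultimately show ?thesis using t by blast
qed

text \<open>The eigenvalue \<open>l = 1 + t\<^sup>2\<close> of the star satisfies \<open>(l - m) (l - 1)\<^bsup>k - 1\<^esup> = m\<close> and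
  \<open>m < l \<le> m + 1\<close>. With the test vector \<open>sqrt (d / (l - d))\<close>, where \<open>d\<close> is the degree, each
  neighbour of \<open>u\<close> contributes less than \<open>1 / d\<^sub>u\<close> as soon as
  \<open>d\<^sub>u d\<^sub>v < (l - d\<^sub>u) (l - d\<^sub>v) (l - 1)\<^bsup>k - 2\<^esup>\<close> for every edge \<open>{u, v}\<close>; when
  all degrees are less than \<open>m\<close>, this follows from \<open>d\<^sub>u + d\<^sub>v \<le> m + 1\<close>.\<close>

lemma star_bound_signless_laplacian:
  assumes k: "k \<ge> 3" and m: "card (edges T) = m" "1 \<le> m"
  shows "\<exists>t\<ge>1. (\<exists>x. ratio_solution (degree_adjacency_ratio k 1 t) (star_graph m) x) \<and>
    ((\<forall>u\<in>verts T. card (nbrs T u) < m) \<longrightarrow> (\<exists>y. strict_subsolution T (degree_adjacency_ratio k 1 t) y))"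
proof -
  note U = tree_uniform[OF T]
  define c where "c = k - 2"
  have c: "1 \<le> c" using k by (simp add: c_def)
  define f where "f t = (1 + t\<^sup>2 - m) * (t\<^sup>2 * (t ^ c)\<^sup>2)" for t :: real
  have rm: "1 \<le> real m" using m by simp
  have "f 1 \<le> m" using m by (simp add: f_def)
  moreover have "m \<le> f (sqrt m)"
  proof -
    have "1 * real m \<le> (sqrt m ^ c)\<^sup>2 * real m"
      using rm by (intro mult_right_mono one_le_power) auto
    then show ?thesis using rm by (simp add: f_def mult.commute)
  qed
  moreover have "continuous_on {1..sqrt m} f" unfolding f_def by (intro continuous_intros)
  ultimately obtain t where t: "1 \<le> t" "t \<le> sqrt m" "f t = m"
    using IVT'[of f 1 m "sqrt m"] rm by auto
  define l where "l = 1 + t\<^sup>2"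
  have tm: "t\<^sup>2 \<le> m" using power_mono[OF t(2), of 2] t(1) by simp
  have t0: "0 < t" using t by simp
  have eq: "(l - m) * ((l - 1) * (t ^ c)\<^sup>2) = m" using t(3) by (simp add: f_def l_def)
  have pos: "0 < (l - 1) * (t ^ c)\<^sup>2" using t0 by (simp add: l_def)
  have lm: "real m < l"
  proof -
    have "0 < (l - m) * ((l - 1) * (t ^ c)\<^sup>2)" using eq rm by simp
    then show ?thesis using pos by (simp add: zero_less_mult_iff)
  qed
  have h: "degree_adjacency_ratio k 1 t r = (1 + r / t ^ c) / l" for r
    by (simp add: degree_adjacency_ratio_def c_def l_def)
  have l0: "0 < l" using lm rm by linarith
  have "ratio_solution (degree_adjacency_ratio k 1 t) (star_graph m) (\<lambda>i. if i = 0 then 1 else 1 / (t\<^sup>2 * t ^ c))"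
  proof (rule star_graph_solution)
    show "0 < 1 / (t\<^sup>2 * t ^ c)" using t0 by simp
    show "degree_adjacency_ratio k 1 t (1 / (1 / (t\<^sup>2 * t ^ c))) = 1"
    proof -
      have "1 / (1 / (t\<^sup>2 * t ^ c)) / t ^ c = l - 1" using t0 by (simp add: l_def)
      then show ?thesis using l0 by (simp add: h)
    qed
    have "m * (1 + 1 / (t\<^sup>2 * t ^ c) / t ^ c) = m + m / ((l - 1) * (t ^ c)\<^sup>2)"
      by (simp add: l_def power2_eq_square field_simps)
    also have "m / ((l - 1) * (t ^ c)\<^sup>2) = l - m"
      using eq pos by (metis nonzero_eq_divide_eq less_irrefl)
    finally show "m * degree_adjacency_ratio k 1 t (1 / (t\<^sup>2 * t ^ c)) = 1" using l0 by (simp add: h)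
  qed
  moreover have "\<exists>y. strict_subsolution T (degree_adjacency_ratio k 1 t) y" if nonstar: "\<forall>u\<in>verts T. card (nbrs T u) < m"
  proof -
    have E: "edges T \<noteq> {}" using m by auto
    define d where "d u = real (card (nbrs T u))" for u
    define y where "y u = sqrt (d u / (l - d u))" for u
    have d1: "1 \<le> d u" "d u < m" if "u \<in> verts T" for u
      using card_nbrs_pos[OF E that] nonstar that by (auto simp: d_def)
    obtain u1 where u1: "u1 \<in> verts T" using U by (auto simp: uniform_hypergraph_def)
    then have m2: "2 \<le> m" using card_nbrs_pos[OF E u1] nonstar by fastforce
    have lm1: "l < m + 1"
    proof -
      have "t\<^sup>2 \<noteq> m"
      proof
        assume tt: "t\<^sup>2 = m"
        have "(t ^ c)\<^sup>2 = real m ^ c" by (simp add: tt[symmetric] power_mult[symmetric] mult.commute)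
        then have "real m ^ c = 1" using eq m by (simp add: l_def tt)
        moreover have "1 < real m ^ c" using m2 c by (intro one_less_power) auto
        ultimately show False by simp
      qed
      then show ?thesis using tm by (simp add: l_def)
    qed
    have ypos: "0 < y u" if "u \<in> verts T" for u using d1[OF that] lm by (simp add: y_def)
    have y2: "(y u)\<^sup>2 = d u / (l - d u)" if "u \<in> verts T" for u using d1[OF that] lm by (simp add: y_def)
    have yy: "y u * y v < t ^ c" if u: "u \<in> verts T" and v: "v \<in> nbrs T u" for u v
    proof -
      have vV: "v \<in> verts T" using v nbrs_subset[OF U] by blast
      let ?a = "d u" and ?b = "d v"
      have a: "1 \<le> ?a" "?a < m" and b: "1 \<le> ?b" "?b < m" using d1 u vV by auto
      have sum: "?a + ?b \<le> m + 1" using card_nbrs_add_le[OF v] m by (simp add: d_def)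
      \<comment> \<open>\<open>l\<close> times this is the difference of the two sides of the inequality between products below\<close>
      have key: "0 < m * (l - (?a + ?b)) + ?a * ?b * (m + 1 - l)"
      proof (cases "?a + ?b = m + 1")
        case True
        have "1 < ?a" "1 < ?b" using True a b by linarith+
        then have "0 < (?a - 1) * (?b - 1)" by simp
        then have "0 < ?a * ?b - m" using True by (simp add: algebra_simps)
        then have "0 < (?a * ?b - m) * (m + 1 - l)" using lm1 by simp
        then show ?thesis using True by (simp add: algebra_simps)
      next
        case False
        then have "card (nbrs T u) + card (nbrs T v) \<noteq> m + 1" by (auto simp: d_def)
        then have "?a + ?b \<le> m" using card_nbrs_add_le[OF v] m by (simp add: d_def)
        then have "0 < m * (l - (?a + ?b))" using lm rm by simp
        moreover have "0 < ?a * ?b * (m + 1 - l)" using a b lm1 by simp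
        ultimately show ?thesis by linarith
      qed
      have "0 < l * (m * (l - (?a + ?b)) + ?a * ?b * (m + 1 - l))" using key l0 by simp
      then have "?a * ?b * ((l - m) * (l - 1)) < m * ((l - ?a) * (l - ?b))" by (simp add: algebra_simps)
      then have "?a * ?b * ((l - m) * (l - 1)) * (t ^ c)\<^sup>2 < m * ((l - ?a) * (l - ?b)) * (t ^ c)\<^sup>2"
        using t0 by (intro mult_strict_right_mono) auto
      moreover have "?a * ?b * ((l - m) * (l - 1)) * (t ^ c)\<^sup>2 = ?a * ?b * m"
        using eq by (simp add: mult.assoc)
      ultimately have "?a * ?b * m < m * ((l - ?a) * (l - ?b)) * (t ^ c)\<^sup>2" by linarith
      then have "m * (?a * ?b) < m * ((l - ?a) * (l - ?b) * (t ^ c)\<^sup>2)" by (simp only: mult_ac)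
      then have "?a * ?b < (l - ?a) * (l - ?b) * (t ^ c)\<^sup>2" using rm by simp
      moreover have "0 < (l - ?a) * (l - ?b)" using a b lm by simp
      ultimately have "?a * ?b / ((l - ?a) * (l - ?b)) < (t ^ c)\<^sup>2"
        by (subst pos_divide_less_eq) (simp_all only: mult_ac)
      then have "(y u)\<^sup>2 * (y v)\<^sup>2 < (t ^ c)\<^sup>2" unfolding y2[OF u] y2[OF vV] by simp
      then have "(y u * y v)\<^sup>2 < (t ^ c)\<^sup>2" by (simp add: power_mult_distrib)
      then show ?thesis using t0 by (intro power2_less_imp_less[of "y u * y v"]) auto
    qed
    have less: "ratio_sum (degree_adjacency_ratio k 1 t) T y u < 1" if u: "u \<in> verts T" for u
    proof -
      have "(1 + (y v / y u) / t ^ c) / l < (1 + (l - d u) / d u) / l" if v: "v \<in> nbrs T u" for v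
      proof -
        have "y v / y u = y u * y v / (y u)\<^sup>2" using ypos[OF u] by (simp add: power2_eq_square)
        also have "\<dots> < t ^ c / (y u)\<^sup>2" using yy[OF u v] ypos[OF u] by (intro divide_strict_right_mono) auto
        also have "\<dots> = t ^ c * ((l - d u) / d u)" using y2[OF u] by simp
        finally have "(y v / y u) / t ^ c < (l - d u) / d u"
          using t0 by (subst pos_divide_less_eq) (simp_all only: mult_ac zero_less_power)
        then show ?thesis using l0 by (intro divide_strict_right_mono) auto
      qed
      then have "ratio_sum (degree_adjacency_ratio k 1 t) T y u < (\<Sum>v\<in>nbrs T u. (1 + (l - d u) / d u) / l)"
        unfolding ratio_sum_def h using finite_nbrs[OF U] nbrs_nonempty[OF U tree_connected[OF T] E u]
        by (intro sum_strict_mono) auto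
      also have "\<dots> = 1" using d1[OF u] l0 by (simp add: d_def[symmetric] field_simps)
      finally show ?thesis .
    qed
    then have "strict_subsolution T (degree_adjacency_ratio k 1 t) y"
      using ypos u1 unfolding strict_subsolution_def by (auto intro: less_imp_le)
    then show ?thesis by blast
  qed
  ultimately show ?thesis using t(1) by blast
qed

text \<open>The test vector is the \<open>q\<close>-th root of the degree, where \<open>q = k - 1\<close>. With \<open>a\<close> its value at \<open>u\<close> and
  \<open>M\<close> the \<open>q\<close>-th root of \<open>m\<close>, convexity gives \<open>(\<Sum>v. (a + y\<^sub>v)\<^sup>q) \<le> (a\<^sup>2 + M)\<^sup>q\<close>, and
  \<open>a\<^sup>2 + M \<le> (1 + M) a\<close> because \<open>1 \<le> a \<le> M\<close>.\<close>

lemma star_bound_incidence: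
  assumes k: "k \<ge> 3" and m: "card (edges T) = m" "1 \<le> m"
  shows "\<exists>t\<ge>2. (\<exists>x. ratio_solution (incidence_ratio k t) (star_graph m) x) \<and>
    ((\<forall>u\<in>verts T. card (nbrs T u) < m) \<longrightarrow> (\<exists>y. strict_subsolution T (incidence_ratio k t) y))"
proof -
  note U = tree_uniform[OF T]
  define q where "q = k - 1"
  have q: "1 \<le> q" using k by (simp add: q_def)
  define M where "M = root q m"
  have M1: "1 \<le> M" unfolding M_def using m q by simp
  have Mq: "M ^ q = m" unfolding M_def using q by simp
  have h: "incidence_ratio k (1 + M) r = ((1 + r) / (1 + M)) ^ q" for r
    by (simp add: incidence_ratio_def q_def)
  have "ratio_solution (incidence_ratio k (1 + M)) (star_graph m) (\<lambda>i. if i = 0 then 1 else 1 / M)"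
  proof (rule star_graph_solution)
    have "(1 + 1 / M) / (1 + M) = ((1 + M) / M) / (1 + M)" using M1 by (simp add: add_divide_distrib)
    also have "\<dots> = 1 / M" using M1 by simp
    finally have "(1 + 1 / M) / (1 + M) = 1 / M" .
    then have "incidence_ratio k (1 + M) (1 / M) = 1 / m" using Mq by (simp add: h power_divide)
    then show "m * incidence_ratio k (1 + M) (1 / M) = 1" using m by simp
  qed (use M1 in \<open>auto simp: h\<close>)
  moreover have "\<exists>y. strict_subsolution T (incidence_ratio k (1 + M)) y" if nonstar: "\<forall>u\<in>verts T. card (nbrs T u) < m"
  proof -
    have E: "edges T \<noteq> {}" using m by auto
    define D where "D u = (\<Sum>v\<in>nbrs T u. card (nbrs T v))" for u
    define y where "y u = root q (card (nbrs T u))" for u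
    have yq: "y u ^ q = card (nbrs T u)" for u unfolding y_def using q by simp
    have y1: "1 \<le> y u" if "u \<in> verts T" for u
      unfolding y_def using card_nbrs_pos[OF E that] q by simp
    have yM: "y u \<le> M" for u
      unfolding y_def M_def using card_nbrs_le[of u] m q by simp
    have D: "D u \<le> m" for u using sum_card_nbrs_le m by (simp add: D_def)
    have bound: "ratio_sum (incidence_ratio k (1 + M)) T y u \<le> 1 \<and>
        (D u < m \<longrightarrow> ratio_sum (incidence_ratio k (1 + M)) T y u < 1)" if u: "u \<in> verts T" for u
    proof -
      define a where "a = y u"
      have a: "1 \<le> a" "a \<le> M" using y1[OF u] yM by (auto simp: a_def)
      \<comment> \<open>the weight for which both terms of the convex combination scale to \<open>a\<^sup>2 + M\<close>\<close>
      define s where "s = a\<^sup>2 / (a\<^sup>2 + M)"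
      have aM: "0 < a\<^sup>2 + M" using a by (intro add_nonneg_pos) auto
      have s: "0 < s" "s < 1" "1 - s = M / (a\<^sup>2 + M)" using a aM by (auto simp: s_def field_simps)
      have "(\<Sum>v\<in>nbrs T u. (a + y v) ^ q) \<le> (\<Sum>v\<in>nbrs T u. s * (a / s) ^ q + (1 - s) * (y v / (1 - s)) ^ q)"
        using a s y1 nbrs_subset[OF U, of u] by (intro sum_mono convex_power_combination) force+
      also have "\<dots> = s * (card (nbrs T u) * (a / s) ^ q) + (1 - s) * (D u / (1 - s) ^ q)"
        by (simp add: sum.distrib sum_distrib_left[symmetric] sum_divide_distrib[symmetric] power_divide yq D_def)
      also have "card (nbrs T u) * (a / s) ^ q = (a\<^sup>2 / s) ^ q"
        unfolding yq[symmetric] by (simp add: a_def[symmetric] power_mult_distrib[symmetric] power2_eq_square)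
      also have "a\<^sup>2 / s = a\<^sup>2 + M" using a by (simp add: s_def)
      finally have sum: "(\<Sum>v\<in>nbrs T u. (a + y v) ^ q) \<le> s * (a\<^sup>2 + M) ^ q + (1 - s) * (D u / (1 - s) ^ q)" .
      have "m / (1 - s) ^ q = (M / (1 - s)) ^ q" by (simp add: power_divide Mq)
      also have "M / (1 - s) = a\<^sup>2 + M" using a unfolding s(3) by simp
      finally have full: "s * (a\<^sup>2 + M) ^ q + (1 - s) * (m / (1 - s) ^ q) = (a\<^sup>2 + M) ^ q" by (simp add: algebra_simps)
      have "(a - 1) * (a - M) \<le> 0" using a by (intro mult_nonneg_nonpos) auto
      then have "a\<^sup>2 + M \<le> (1 + M) * a" by (simp add: power2_eq_square algebra_simps)
      then have top: "(a\<^sup>2 + M) ^ q \<le> ((1 + M) * a) ^ q" using aM by (intro power_mono) auto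
      have scale: "ratio_sum (incidence_ratio k (1 + M)) T y u = (\<Sum>v\<in>nbrs T u. (a + y v) ^ q) / ((1 + M) * a) ^ q"
      proof -
        have "(1 + y v / a) / (1 + M) = (a + y v) / ((1 + M) * a)" for v
          using a M1 by (simp add: field_simps)
        then show ?thesis by (simp add: ratio_sum_def h a_def[symmetric] power_divide sum_divide_distrib)
      qed
      have den: "0 < ((1 + M) * a) ^ q" using a M1 by simp
      have c: "0 < (1 - s) ^ q" using s by simp
      have "(1 - s) * (D u / (1 - s) ^ q) \<le> (1 - s) * (m / (1 - s) ^ q)"
        using D[of u] s c by (intro mult_left_mono divide_right_mono) auto
      then have "(\<Sum>v\<in>nbrs T u. (a + y v) ^ q) \<le> ((1 + M) * a) ^ q" using sum full top by linarith
      moreover have "(\<Sum>v\<in>nbrs T u. (a + y v) ^ q) < ((1 + M) * a) ^ q" if "D u < m"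
      proof -
        have "(1 - s) * (D u / (1 - s) ^ q) < (1 - s) * (m / (1 - s) ^ q)"
          using that s c by (intro mult_strict_left_mono divide_strict_right_mono) auto
        then show ?thesis using sum full top by linarith
      qed
      ultimately show ?thesis using den unfolding scale by simp
    qed
    obtain u v where uv: "u \<in> verts T" "nbrs T u = {v}" using leaf_exists[OF E] by blast
    have "v \<in> verts T" using uv nbrs_subset[OF U, of u] by blast
    then have "D u < m" using nonstar by (simp add: D_def uv)
    then have "ratio_sum (incidence_ratio k (1 + M)) T y u < 1" using bound[OF uv(1)] by blast
    moreover have "0 < y w" if "w \<in> verts T" for w using y1[OF that] by simp
    ultimately have "strict_subsolution T (incidence_ratio k (1 + M)) y"
      using bound uv(1) unfolding strict_subsolution_def by blast
    then show ?thesis by blast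
  qed
  ultimately show ?thesis using M1 by (intro exI[of _ "1 + M"]) auto
qed

end

context ratio_function
begin

text \<open>A tree on which every degree is smaller than \<open>m\<close> has a smaller parameter than the star, and a tree
  with a vertex of degree at least three has a larger one than the path.\<close>

theorem extremal_parameters:
  fixes T :: "'a hypergraph"
  assumes T: "tree T" and m: "card (edges T) = m" "1 \<le> m"
    and star: "\<exists>t\<ge>t1. (\<exists>x. ratio_solution (h t) (star_graph m) x) \<and>
      ((\<forall>u\<in>verts T. card (nbrs T u) < m) \<longrightarrow> (\<exists>y. strict_subsolution T (h t) y))"
  obtains tP xP tT xT tS xS where
    "t1 \<le> tP" "t1 \<le> tT" "t1 \<le> tS"
    "ratio_solution (h tP) (path_graph m) xP" "ratio_solution (h tT) T xT"
    "ratio_solution (h tS) (star_graph m) xS"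
    "(\<exists>u\<in>verts T. 3 \<le> card (nbrs T u)) \<longrightarrow> tP < tT"
    "(\<forall>u\<in>verts T. card (nbrs T u) < m) \<longrightarrow> tT < tS"
proof -
  note U = tree_uniform[OF T] and C = tree_connected[OF T]
  have "edges T \<noteq> {}" using m by auto
  then obtain tT xT where tT: "t1 \<le> tT" "ratio_solution (h tT) T xT"
    using ratio_solution_exists[OF U C] by blast
  have "edges (path_graph m) \<noteq> {}" using m by (auto simp: path_graph_def lessThan_empty_iff)
  then obtain tP xP where tP: "t1 \<le> tP" "ratio_solution (h tP) (path_graph m) xP"
    using ratio_solution_exists[OF path_graph_uniform path_graph_connected] by blast
  obtain tS xS where tS: "t1 \<le> tS" "ratio_solution (h tS) (star_graph m) xS"
    "(\<forall>u\<in>verts T. card (nbrs T u) < m) \<longrightarrow> (\<exists>y. strict_subsolution T (h tS) y)"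
    using star by blast
  have "tT < tS" if nonstar: "\<forall>u\<in>verts T. card (nbrs T u) < m"
  proof -
    obtain y where y: "strict_subsolution T (h tS) y" using tS(3) nonstar by blast
    show ?thesis
      by (rule parameter_less[OF U C tT(1) tS(1), of xT y])
        (use y tT(2) in \<open>auto simp: strict_subsolution_def ratio_solution_def\<close>)
  qed
  moreover have "tP < tT" if "\<exists>u\<in>verts T. 3 \<le> card (nbrs T u)"
    using path_parameter_less[OF T m tP tT] that by blast
  ultimately show ?thesis using that tT tP tS(1,2) by blast
qed

end

section \<open>Hyperstars and loose paths up to isomorphism\<close>

text \<open>A hypergraph with enumerated edges is determined up to isomorphism by the number of vertices
  of each incidence pattern.\<close>

lemma isomorphic_if_same_incidence_patterns:
  fixes G :: "'a hypergraph" and H :: "'b hypergraph"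
  assumes fin: "finite (verts G)" "finite (verts H)"
    and G: "edges G = e ` I" "\<And>i. i \<in> I \<Longrightarrow> e i \<subseteq> verts G"
    and H: "edges H = f ` I" "\<And>i. i \<in> I \<Longrightarrow> f i \<subseteq> verts H"
    and card: "\<And>J. card {v \<in> verts G. {i \<in> I. v \<in> e i} = J} = card {v \<in> verts H. {i \<in> I. v \<in> f i} = J}"
  shows "isomorphic G H"
proof -
  define X where "X J = {v \<in> verts G. {i \<in> I. v \<in> e i} = J}" for J
  define Y where "Y J = {v \<in> verts H. {i \<in> I. v \<in> f i} = J}" for J
  have "\<exists>b. bij_betw b (X J) (Y J)" for J
    using fin card[of J] by (intro finite_same_card_bij) (auto simp: X_def Y_def)
  then obtain b where b: "\<And>J. bij_betw (b J) (X J) (Y J)" by metis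
  define F where "F v = b {i \<in> I. v \<in> e i} v" for v
  have F: "F v \<in> verts H" "{i \<in> I. F v \<in> f i} = {i \<in> I. v \<in> e i}" if "v \<in> verts G" for v
  proof -
    have "v \<in> X {i \<in> I. v \<in> e i}" using that by (simp add: X_def)
    then have "F v \<in> Y {i \<in> I. v \<in> e i}" using b unfolding F_def bij_betw_def by blast
    then show "F v \<in> verts H" "{i \<in> I. F v \<in> f i} = {i \<in> I. v \<in> e i}" by (simp_all add: Y_def)
  qed
  have inj: "inj_on F (verts G)"
  proof (rule inj_onI)
    fix v w assume vw: "v \<in> verts G" "w \<in> verts G" "F v = F w"
    then have J: "{i \<in> I. v \<in> e i} = {i \<in> I. w \<in> e i}" using F(2)[of v] F(2)[of w] by simp
    then have "v \<in> X {i \<in> I. v \<in> e i}" "w \<in> X {i \<in> I. v \<in> e i}" using vw by (simp_all add: X_def)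
    moreover have "b {i \<in> I. v \<in> e i} v = b {i \<in> I. v \<in> e i} w" using vw(3) J by (simp add: F_def)
    ultimately show "v = w" using b[of "{i \<in> I. v \<in> e i}"] unfolding bij_betw_def inj_on_def by blast
  qed
  have surj: "\<exists>v\<in>verts G. F v = w" if w: "w \<in> verts H" for w
  proof -
    have "w \<in> Y {i \<in> I. w \<in> f i}" using w by (simp add: Y_def)
    then have "w \<in> b {i \<in> I. w \<in> f i} ` X {i \<in> I. w \<in> f i}"
      using bij_betw_imp_surj_on[OF b] by simp
    then obtain v where v: "v \<in> X {i \<in> I. w \<in> f i}" "b {i \<in> I. w \<in> f i} v = w"
      by (rule imageE) simp
    then have "v \<in> verts G" "{i \<in> I. v \<in> e i} = {i \<in> I. w \<in> f i}" by (simp_all add: X_def)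
    then show ?thesis using v(2) unfolding F_def by metis
  qed
  have "F ` e i = f i" if i: "i \<in> I" for i
  proof (intro equalityI subsetI)
    fix w assume "w \<in> F ` e i"
    then show "w \<in> f i" using F(2) G(2)[OF i] i by blast
  next
    fix w assume w: "w \<in> f i"
    then obtain v where "v \<in> verts G" "F v = w" using surj H(2)[OF i] by blast
    then show "w \<in> F ` e i" using F(2)[of v] w i by blast
  qed
  then have "(\<lambda>e. F ` e) ` edges G = edges H" unfolding G(1) H(1) image_image by simp
  moreover have "bij_betw F (verts G) (verts H)"
    using inj F(1) surj by (intro bij_betw_imageI) (auto simp: image_iff)
  ultimately show ?thesis unfolding isomorphic_def by blast
qed

text \<open>A vertex of the centre lies in all edges, any other vertex in exactly one; the two cases coincide
  if there is just one edge, hence the sum.\<close>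

lemma hyperstar_patterns:
  assumes S: "is_hyperstar (m * (k - 1) + 1) k S" and k: "k \<ge> 2"
  obtains e where "edges S = e ` {1..m}" "\<And>i. i \<in> {1..m} \<Longrightarrow> e i \<subseteq> verts S"
    "\<And>J. card {v \<in> verts S. {i \<in> {1..m}. v \<in> e i} = J} =
      (if J = {1..m} then 1 else 0) + (if \<exists>i\<in>{1..m}. J = {i} then k - 1 else 0)"
proof -
  obtain m' W where "m * (k - 1) + 1 = m' * (k - 1) + 1" "disjoint_family_on W {0..m'}" "verts S = (\<Union>i\<in>{0..m'}. W i)"
      "card (W 0) = 1" "\<forall>i\<in>{1..m'}. card (W i) = k - 1" "edges S = (\<lambda>i. W 0 \<union> W i) ` {1..m'}"
    using S unfolding is_hyperstar_def by blast
  moreover from this have "m' = m" using k by auto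
  ultimately have W: "disjoint_family_on W {0..m}" "verts S = (\<Union>i\<in>{0..m}. W i)" "card (W 0) = 1"
    "\<And>i. i \<in> {1..m} \<Longrightarrow> card (W i) = k - 1" "edges S = (\<lambda>i. W 0 \<union> W i) ` {1..m}"
    by auto
  have fin: "finite (verts S)" using S by (simp add: is_hyperstar_def uniform_hypergraph_def)
  have disj: "W i \<inter> W j = {}" if "i \<le> m" "j \<le> m" "i \<noteq> j" for i j
    using W(1) that by (simp add: disjoint_family_on_def)
  have pat0: "{i \<in> {1..m}. v \<in> W 0 \<union> W i} = {1..m}" if "v \<in> W 0" for v using that by auto
  have pat: "{i \<in> {1..m}. v \<in> W 0 \<union> W i} = {j}" if "v \<in> W j" "j \<in> {1..m}" for v j
    using that disj[of j] disj[of 0 j] by fastforce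
  have "card {v \<in> verts S. {i \<in> {1..m}. v \<in> W 0 \<union> W i} = J} =
      (if J = {1..m} then 1 else 0) + (if \<exists>i\<in>{1..m}. J = {i} then k - 1 else 0)" for J
  proof -
    define A where "A = (if J = {1..m} then W 0 else {})"
    define B where "B = (\<Union>i\<in>{i \<in> {1..m}. J = {i}}. W i)"
    have "{v \<in> verts S. {i \<in> {1..m}. v \<in> W 0 \<union> W i} = J} = A \<union> B"
    proof (intro equalityI subsetI)
      fix v assume v: "v \<in> {v \<in> verts S. {i \<in> {1..m}. v \<in> W 0 \<union> W i} = J}"
      then obtain j where j: "j \<le> m" "v \<in> W j" using W(2) by auto
      show "v \<in> A \<union> B"
      proof (cases "j = 0")
        case True
        then show ?thesis using v j pat0[of v] by (auto simp: A_def)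
      next
        case False
        then have "j \<in> {1..m}" using j by simp
        then show ?thesis using v pat[OF j(2)] j(2) by (auto simp: B_def)
      qed
    next
      fix v assume "v \<in> A \<union> B"
      then consider "v \<in> W 0" "J = {1..m}" | i where "i \<in> {1..m}" "J = {i}" "v \<in> W i"
        by (auto simp: A_def B_def split: if_splits)
      then show "v \<in> {v \<in> verts S. {i \<in> {1..m}. v \<in> W 0 \<union> W i} = J}"
      proof cases
        case 1
        then show ?thesis using pat0[OF 1(1)] W(2) by auto
      next
        case 2
        then show ?thesis using pat[OF 2(3,1)] W(2) by auto
      qed
    qed
    moreover have "A \<inter> B = {}"
    proof -
      have "W 0 \<inter> W i = {}" if "i \<in> {1..m}" for i using disj[of 0 i] that by simp
      then show ?thesis unfolding A_def B_def by auto
    qed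
    moreover have "finite A" "finite B" using fin W(2) by (auto simp: A_def B_def intro: finite_subset[OF _ fin])
    ultimately have "card {v \<in> verts S. {i \<in> {1..m}. v \<in> W 0 \<union> W i} = J} = card A + card B"
      by (simp add: card_Un_disjoint)
    moreover have "card A = (if J = {1..m} then 1 else 0)" using W(3) by (simp add: A_def)
    moreover have "card B = (if \<exists>i\<in>{1..m}. J = {i} then k - 1 else 0)"
    proof (cases "\<exists>i\<in>{1..m}. J = {i}")
      case True
      then obtain i where i: "i \<in> {1..m}" "J = {i}" by blast
      then have "{i \<in> {1..m}. J = {i}} = {i}" by auto
      then show ?thesis using True W(4)[OF i(1)] by (simp add: B_def)
    next
      case False
      then have "B = {}" by (auto simp: B_def)
      then show ?thesis using False by simp
    qed
    ultimately show ?thesis by simp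
  qed
  moreover have "W 0 \<union> W i \<subseteq> verts S" if "i \<in> {1..m}" for i using that W(2) by auto
  ultimately show ?thesis using that[of "\<lambda>i. W 0 \<union> W i"] W(5) by blast
qed

theorem hyperstars_isomorphic:
  fixes S :: "'a hypergraph" and S' :: "'b hypergraph"
  assumes S: "is_hyperstar (m * (k - 1) + 1) k S" and S': "is_hyperstar (m * (k - 1) + 1) k S'" and k: "k \<ge> 2"
  shows "isomorphic S S'"
proof -
  obtain e where e: "edges S = e ` {1..m}" "\<And>i. i \<in> {1..m} \<Longrightarrow> e i \<subseteq> verts S"
    "\<And>J. card {v \<in> verts S. {i \<in> {1..m}. v \<in> e i} = J} =
      (if J = {1..m} then 1 else 0) + (if \<exists>i\<in>{1..m}. J = {i} then k - 1 else 0)"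
    using hyperstar_patterns[OF S k] by blast
  obtain f where f: "edges S' = f ` {1..m}" "\<And>i. i \<in> {1..m} \<Longrightarrow> f i \<subseteq> verts S'"
    "\<And>J. card {v \<in> verts S'. {i \<in> {1..m}. v \<in> f i} = J} =
      (if J = {1..m} then 1 else 0) + (if \<exists>i\<in>{1..m}. J = {i} then k - 1 else 0)"
    using hyperstar_patterns[OF S' k] by blast
  have "finite (verts S)" "finite (verts S')"
    using S S' by (simp_all add: is_hyperstar_def uniform_hypergraph_def)
  then show ?thesis
    using e f by (intro isomorphic_if_same_incidence_patterns[of S S' e "{1..m}" f]) simp_all
qed

text \<open>The indices of the edges of a path with \<open>m\<close> edges that contain its \<open>j\<close>-th vertex.\<close>

definition path_pattern :: "nat \<Rightarrow> nat \<Rightarrow> nat set" where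
  "path_pattern m j = {i. i < m \<and> (i = j \<or> Suc i = j)}"

text \<open>The vertices of the path have the patterns \<^const>\<open>path_pattern\<close>; the other \<open>k - 2\<close> vertices of each
  edge have degree one.\<close>

lemma loose_path_patterns:
  assumes P: "is_loose_path (m * (k - 1) + 1) k P" and k: "k \<ge> 2"
  obtains e where "edges P = e ` {..<m}" "\<And>i. i \<in> {..<m} \<Longrightarrow> e i \<subseteq> verts P"
    "\<And>J. card {v \<in> verts P. {i \<in> {..<m}. v \<in> e i} = J} =
      card {j \<in> {..m}. path_pattern m j = J} + (if \<exists>i\<in>{..<m}. J = {i} then k - 2 else 0)"
proof -
  obtain m' vs es where n: "m * (k - 1) + 1 = m' * (k - 1) + 1"
    and vs': "length vs = Suc m'" "distinct vs" "set vs \<subseteq> verts P"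
    and es': "length es = m'" "distinct es" "set es = edges P"
    and inc': "\<forall>j<m'. vs ! j \<in> es ! j \<and> vs ! Suc j \<in> es ! j"
    and deg2': "\<forall>j\<in>{1..<m'}. degree P (vs ! j) = 2"
    and deg1': "m' \<ge> 1 \<longrightarrow> (\<forall>v \<in> verts P - (!) vs ` {1..<m'}. degree P v = 1)"
    using P unfolding is_loose_path_def by blast
  have mm: "m' = m" using n k by simp
  note vs = vs'[unfolded mm] and es = es'[unfolded mm]
  have inc: "vs ! j \<in> es ! j" "vs ! Suc j \<in> es ! j" if "j < m" for j
    using inc' that unfolding mm by blast+
  have deg2: "degree P (vs ! j) = 2" if "1 \<le> j" "j < m" for j
    using deg2' that unfolding mm by simp
  have deg1: "degree P v = 1" if "1 \<le> m" "v \<in> verts P" "v \<notin> (!) vs ` {1..<m}" for v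
    using deg1' that unfolding mm by blast
  have U: "finite (verts P)" "\<And>e. e \<in> edges P \<Longrightarrow> e \<subseteq> verts P \<and> card e = k"
    and cV: "card (verts P) = m * (k - 1) + 1"
    using P by (auto simp: is_loose_path_def uniform_hypergraph_def)
  define pat where "pat v = {i \<in> {..<m}. v \<in> es ! i}" for v
  have esm: "es ! i \<in> edges P" if "i < m" for i
    using nth_mem[of i es] that unfolding es(1,3) .
  have deg: "degree P v = card (pat v)" for v
  proof -
    have "{e \<in> edges P. v \<in> e} = (!) es ` pat v"
      unfolding es(3)[symmetric] pat_def using es(1) by (auto simp: in_set_conv_nth)
    moreover have "inj_on ((!) es) (pat v)" using es by (auto simp: inj_on_def pat_def nth_eq_iff_index_eq)
    ultimately show ?thesis by (simp add: degree_def card_image)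
  qed
  have inner: "(!) vs ` {1..<m} \<subseteq> set vs" using vs(1) by (auto intro: nth_mem)
  have finpat: "finite (pat v)" for v by (simp add: pat_def)
  have vsj: "pat (vs ! j) = path_pattern m j" if j: "j \<le> m" for j
  proof -
    have sub: "path_pattern m j \<subseteq> pat (vs ! j)" using inc by (auto simp: path_pattern_def pat_def)
    have "card (pat (vs ! j)) = card (path_pattern m j)" if m: "1 \<le> m"
    proof (cases "1 \<le> j \<and> j < m")
      case True
      then have "path_pattern m j = {j - 1, j}" "j - 1 \<noteq> j" by (auto simp: path_pattern_def)
      then have "card (path_pattern m j) = 2" by simp
      then show ?thesis using deg deg2 True by simp
    next
      case False
      then have "j = 0 \<or> j = m" using j by auto
      then have "path_pattern m j = {if j = 0 then 0 else m - 1}" using m by (auto simp: path_pattern_def)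
      moreover have "vs ! j \<notin> (!) vs ` {1..<m}"
      proof
        assume "vs ! j \<in> (!) vs ` {1..<m}"
        then obtain i where "i \<in> {1..<m}" "vs ! j = vs ! i" by auto
        then show False using False vs j nth_eq_iff_index_eq[of vs j i] by auto
      qed
      moreover have "vs ! j \<in> verts P" using vs j by auto
      ultimately show ?thesis using deg deg1[OF m] by simp
    qed
    then show ?thesis
      using card_subset_eq[OF finpat sub] by (cases "1 \<le> m") (auto simp: pat_def path_pattern_def)
  qed
  define R where "R i = es ! i - {vs ! i, vs ! Suc i}" for i
  have cR: "card (R i) = k - 2" if i: "i < m" for i
  proof -
    have "vs ! i \<noteq> vs ! Suc i" using vs i by (simp add: nth_eq_iff_index_eq)
    moreover have "{vs ! i, vs ! Suc i} \<subseteq> es ! i" using inc i by simp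
    ultimately show ?thesis using U(2)[OF esm[OF i]] by (simp add: R_def card_Diff_subset)
  qed
  have Rvs: "v \<notin> set vs" if i: "i < m" and v: "v \<in> R i" for i v
  proof
    assume "v \<in> set vs"
    then obtain j where j: "j \<le> m" "v = vs ! j" using vs(1) by (auto simp: in_set_conv_nth less_Suc_eq_le)
    have "i \<in> path_pattern m j" using vsj[OF j(1)] i v j by (auto simp: R_def pat_def)
    then show False using v j by (auto simp: R_def path_pattern_def)
  qed
  have inR: "pat v = {i}" if i: "i < m" and v: "v \<in> R i" for i v
  proof -
    have "v \<notin> set vs" using Rvs[OF i v] .
    then have "v \<notin> (!) vs ` {1..<m}" using inner by blast
    moreover have "v \<in> verts P" using v U(2)[OF esm[OF i]] by (auto simp: R_def)
    ultimately have "card (pat v) = 1" using deg1[of v] i deg by simp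
    moreover have "i \<in> pat v" using i v by (simp add: R_def pat_def)
    ultimately show ?thesis by (metis card_1_singletonE singletonD)
  qed
  have other: "\<exists>i<m. v \<in> R i" if v: "v \<in> verts P" "v \<notin> set vs" for v
  proof (cases "m = 0")
    case True
    then have "set vs = verts P"
      using vs U(1) cV by (intro card_subset_eq) (auto simp: distinct_card)
    then show ?thesis using v by simp
  next
    case False
    have "v \<notin> (!) vs ` {1..<m}" using v inner by blast
    then have "card (pat v) = 1" using deg1[of v] False v deg by simp
    then obtain i where "pat v = {i}" by (metis card_1_singletonE)
    then have "i < m" "v \<in> es ! i" by (auto simp: pat_def)
    moreover from this have "v \<in> R i" using v vs(1) by (auto simp: R_def)
    ultimately show ?thesis by blast
  qed
  have "card {v \<in> verts P. pat v = J} =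
      card {j \<in> {..m}. path_pattern m j = J} + (if \<exists>i\<in>{..<m}. J = {i} then k - 2 else 0)" for J
  proof -
    define A where "A = (!) vs ` {j \<in> {..m}. path_pattern m j = J}"
    define B where "B = (\<Union>i\<in>{i \<in> {..<m}. J = {i}}. R i)"
    have "{v \<in> verts P. pat v = J} = A \<union> B"
    proof (intro equalityI subsetI)
      fix v assume v: "v \<in> {v \<in> verts P. pat v = J}"
      show "v \<in> A \<union> B"
      proof (cases "v \<in> set vs")
        case True
        then obtain j where j: "j \<le> m" "v = vs ! j" using vs(1) by (auto simp: in_set_conv_nth less_Suc_eq_le)
        then show ?thesis using v vsj[OF j(1)] by (auto simp: A_def)
      next
        case False
        then obtain i where "i < m" "v \<in> R i" using other v by blast
        then show ?thesis using v inR[of i v] by (auto simp: B_def)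
      qed
    next
      fix v assume "v \<in> A \<union> B"
      then consider j where "j \<le> m" "v = vs ! j" "path_pattern m j = J" | i where "i < m" "J = {i}" "v \<in> R i"
        by (auto simp: A_def B_def)
      then show "v \<in> {v \<in> verts P. pat v = J}"
      proof cases
        case 1
        then show ?thesis using vsj[OF 1(1)] vs by auto
      next
        case 2
        then show ?thesis using inR[OF 2(1,3)] U(2)[OF esm[OF 2(1)]] by (auto simp: R_def)
      qed
    qed
    moreover have "A \<inter> B = {}" using Rvs vs(1) by (fastforce simp: A_def B_def)
    moreover have "finite A" "finite B"
      using U esm by (auto simp: A_def B_def R_def intro!: finite_subset[OF _ U(1)])
    ultimately have "card {v \<in> verts P. pat v = J} = card A + card B" by (simp add: card_Un_disjoint)
    moreover have "card A = card {j \<in> {..m}. path_pattern m j = J}"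
      unfolding A_def using vs by (intro card_image) (auto simp: inj_on_def nth_eq_iff_index_eq)
    moreover have "card B = (if \<exists>i\<in>{..<m}. J = {i} then k - 2 else 0)"
    proof (cases "\<exists>i\<in>{..<m}. J = {i}")
      case True
      then obtain i where i: "i < m" "J = {i}" by auto
      then have "{i \<in> {..<m}. J = {i}} = {i}" by auto
      then show ?thesis using True cR[OF i(1)] by (simp add: B_def)
    next
      case False
      then have "B = {}" by (auto simp: B_def)
      then show ?thesis using False by simp
    qed
    ultimately show ?thesis by simp
  qed
  moreover have "edges P = (!) es ` {..<m}"
    unfolding es(3)[symmetric] set_conv_nth es(1) by auto
  moreover have "es ! i \<subseteq> verts P" if "i \<in> {..<m}" for i using U(2)[OF esm] that by simp
  ultimately show ?thesis using that[of "(!) es"] unfolding pat_def by blast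
qed

theorem loose_paths_isomorphic:
  fixes P :: "'a hypergraph" and P' :: "'b hypergraph"
  assumes P: "is_loose_path (m * (k - 1) + 1) k P" and P': "is_loose_path (m * (k - 1) + 1) k P'" and k: "k \<ge> 2"
  shows "isomorphic P P'"
proof -
  obtain e where e: "edges P = e ` {..<m}" "\<And>i. i \<in> {..<m} \<Longrightarrow> e i \<subseteq> verts P"
    "\<And>J. card {v \<in> verts P. {i \<in> {..<m}. v \<in> e i} = J} =
      card {j \<in> {..m}. path_pattern m j = J} + (if \<exists>i\<in>{..<m}. J = {i} then k - 2 else 0)"
    using loose_path_patterns[OF P k] by blast
  obtain f where f: "edges P' = f ` {..<m}" "\<And>i. i \<in> {..<m} \<Longrightarrow> f i \<subseteq> verts P'"
    "\<And>J. card {v \<in> verts P'. {i \<in> {..<m}. v \<in> f i} = J} =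
      card {j \<in> {..m}. path_pattern m j = J} + (if \<exists>i\<in>{..<m}. J = {i} then k - 2 else 0)"
    using loose_path_patterns[OF P' k] by blast
  have "finite (verts P)" "finite (verts P')"
    using P P' by (simp_all add: is_loose_path_def uniform_hypergraph_def)
  then show ?thesis
    using e f by (intro isomorphic_if_same_incidence_patterns[of P P' e "{..<m}" f]) simp_all
qed

section \<open>Powers of stars and paths\<close>

lemma power_order_eq:
  fixes k m :: nat
  assumes "k \<ge> 3" shows "Suc m + m * (k - 2) = m * (k - 1) + 1"
  using assms by (cases k) (auto simp: algebra_simps Suc_diff_le numeral_2_eq_2)

text \<open>If a vertex of a graph with \<open>m + 1\<close> vertices is incident with all \<open>m\<close> edges, then the power is a hyperstar.\<close>

lemma power_is_hyperstar:
  assumes G: "uniform_hypergraph 2 G" and k: "k \<ge> 3"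
    and V: "card (verts G) = Suc m" and E: "card (edges G) = m"
    and c: "c \<in> verts G" "card (nbrs G c) = m"
  shows "is_hyperstar (m * (k - 1) + 1) k (power_hypergraph k G)"
proof -
  let ?H = "power_hypergraph k G"
  note fn = finite_nbrs[OF G, of c]
  have cn: "c \<notin> nbrs G c" by (rule nbrs_irrefl[OF G])
  have "insert c (nbrs G c) = verts G"
    using c V fn cn nbrs_subset[OF G, of c] finite_verts[OF G] by (intro card_subset_eq) auto
  moreover have "(\<lambda>v. {c, v}) ` nbrs G c = edges G"
    using finite_edges[OF G] c E by (intro card_subset_eq) (auto simp: card_image inj_on_edge[OF G] nbrs_def)
  ultimately have VG: "verts G = insert c (nbrs G c)" and EG: "edges G = (\<lambda>v. {c, v}) ` nbrs G c" by simp_all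
  have "\<exists>b. bij_betw b {1..m} (nbrs G c)" using fn c by (intro finite_same_card_bij) auto
  then obtain b where b: "bij_betw b {1..m} (nbrs G c)" by blast
  have bn: "b i \<in> nbrs G c" if "i \<in> {1..m}" for i using b that by (auto simp: bij_betw_def)
  have binj: "b i = b j \<longleftrightarrow> i = j" if "i \<in> {1..m}" "j \<in> {1..m}" for i j
    using inj_on_eq_iff[OF bij_betw_imp_inj_on[OF b] that] .
  have bim: "nbrs G c = b ` {1..m}" using b by (simp add: bij_betw_def)
  define W where "W i = (if i = 0 then {Inl c} else power_edge k {c, b i} - {Inl c})" for i
  have H: "uniform_hypergraph k ?H" by (rule uniform_power_hypergraph[OF G k])
  have cV: "card (verts ?H) = m * (k - 1) + 1"
    using card_verts_power_hypergraph[OF G k] V E power_order_eq[OF k, of m] by simp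
  have Wi: "Inl c \<in> power_edge k {c, b i}" "W i = power_edge k {c, b i} - {Inl c}" if "i \<in> {1..m}" for i
    using that by (auto simp: W_def)
  have un: "W 0 \<union> W i = power_edge k {c, b i}" if "i \<in> {1..m}" for i
    unfolding Wi(2)[OF that] W_def[of 0] using Wi(1)[OF that] by (simp add: insert_absorb)
  have EH: "edges ?H = (\<lambda>i. W 0 \<union> W i) ` {1..m}"
    unfolding edges_power_hypergraph EG bim image_image using un by simp
  have ck: "card (power_edge k {c, b i}) = k" if "i \<in> {1..m}" for i
    using H un[OF that] that EH unfolding uniform_hypergraph_def by blast
  have "card (W i) = k - 1" if "i \<in> {1..m}" for i
    using ck[OF that] Wi[OF that] by simp
  moreover have "disjoint_family_on W {0..m}"
    unfolding disjoint_family_on_def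
  proof (intro ballI impI)
    fix i j assume ij: "i \<in> {0..m}" "j \<in> {0..m}" "i \<noteq> j"
    show "W i \<inter> W j = {}"
    proof (cases "i = 0 \<or> j = 0")
      case True
      then show ?thesis using ij(3) by (auto simp: W_def)
    next
      case False
      then have "i \<in> {1..m}" "j \<in> {1..m}" using ij by auto
      then have "b i \<noteq> b j" "b i \<noteq> c" "b j \<noteq> c" using binj ij(3) bn cn by metis+
      then show ?thesis using False by (auto simp: W_def power_edge_def doubleton_eq_iff)
    qed
  qed
  moreover have "verts ?H = (\<Union>i\<in>{0..m}. W i)"
  proof (intro equalityI subsetI)
    fix x assume x: "x \<in> verts ?H"
    show "x \<in> (\<Union>i\<in>{0..m}. W i)"
    proof (cases x)
      case (Inl u)
      then have "u = c \<or> u \<in> nbrs G c" using x VG by auto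
      then show ?thesis
      proof
        assume "u = c"
        then show ?thesis using Inl by (auto simp: W_def)
      next
        assume "u \<in> nbrs G c"
        then obtain i where i: "i \<in> {1..m}" "u = b i" using bim by auto
        then have "x \<in> W i" using bn[OF i(1)] cn Inl by (auto simp: W_def)
        then show ?thesis using i by auto
      qed
    next
      case (Inr p)
      then obtain e j where p: "x = Inr (e, j)" "e \<in> edges G" "j \<in> {1..k - 2}" using x by (cases p) auto
      then obtain i where i: "i \<in> {1..m}" "e = {c, b i}" unfolding EG bim by auto
      then have "x \<in> W i" using p by (auto simp: W_def)
      then show ?thesis using i by auto
    qed
  next
    fix x assume "x \<in> (\<Union>i\<in>{0..m}. W i)"
    then obtain i where i: "i \<le> m" "x \<in> W i" by auto
    show "x \<in> verts ?H"
    proof (cases "i = 0")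
      case True
      then show ?thesis using i c by (auto simp: W_def)
    next
      case False
      then have "power_edge k {c, b i} \<in> edges ?H" "x \<in> power_edge k {c, b i}"
        using EH un[of i] i by (auto simp: W_def)
      then show ?thesis using H unfolding uniform_hypergraph_def by blast
    qed
  qed
  moreover have "card (edges ?H) = m" using E by (simp add: card_edges_power_hypergraph)
  moreover have "card (W 0) = 1" by (simp add: W_def)
  ultimately show ?thesis using H cV EH unfolding is_hyperstar_def by blast
qed

lemma power_is_loose_path:
  assumes G: "uniform_hypergraph 2 G" and k: "k \<ge> 3"
    and vs: "distinct vs" "length vs = Suc m" "set vs = verts G"
    and E: "edges G = (\<lambda>i. {vs ! i, vs ! Suc i}) ` {..<m}"
  shows "is_loose_path (m * (k - 1) + 1) k (power_hypergraph k G)"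
proof -
  let ?H = "power_hypergraph k G"
  have vs_eq: "vs ! i = vs ! j \<longleftrightarrow> i = j" if "i \<le> m" "j \<le> m" for i j
    using vs that by (simp add: nth_eq_iff_index_eq)
  have inj: "inj_on (\<lambda>i. {vs ! i, vs ! Suc i}) {..<m}"
    by (rule inj_onI) (auto simp: doubleton_eq_iff vs_eq)
  have cE: "card (edges G) = m" unfolding E by (simp add: card_image inj)
  have cV: "card (verts G) = Suc m" using vs distinct_card by metis
  have H: "uniform_hypergraph k ?H" by (rule uniform_power_hypergraph[OF G k])
  have cVH: "card (verts ?H) = m * (k - 1) + 1"
    using card_verts_power_hypergraph[OF G k] cV cE power_order_eq[OF k, of m] by simp
  have nb: "nbrs G (vs ! j) = (!) vs ` {i. i \<le> m \<and> (i = Suc j \<or> Suc i = j)}" if j: "j \<le> m" for j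
  proof (intro equalityI subsetI)
    fix v assume "v \<in> nbrs G (vs ! j)"
    then obtain i where i: "i < m" "{vs ! j, v} = {vs ! i, vs ! Suc i}" unfolding nbrs_def E by auto
    then show "v \<in> (!) vs ` {i. i \<le> m \<and> (i = Suc j \<or> Suc i = j)}"
      using j by (auto simp: doubleton_eq_iff vs_eq)
  next
    fix v assume "v \<in> (!) vs ` {i. i \<le> m \<and> (i = Suc j \<or> Suc i = j)}"
    then show "v \<in> nbrs G (vs ! j)"
      using j unfolding nbrs_def E by (auto simp: image_iff insert_commute)
  qed
  have deg: "degree ?H (Inl (vs ! j)) = card {i. i \<le> m \<and> (i = Suc j \<or> Suc i = j)}" if j: "j \<le> m" for j
    unfolding degree_power_Inl[OF G k] nb[OF j] by (rule card_image) (auto simp: inj_on_def vs_eq)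
  let ?vs = "map Inl vs :: ('a + 'a set \<times> nat) list"
  let ?es = "map (\<lambda>i. power_edge k {vs ! i, vs ! Suc i}) [0..<m]"
  have "distinct ?vs" using vs by (simp add: distinct_map)
  moreover have "set ?vs \<subseteq> verts ?H" using vs by auto
  moreover have "set ?es = edges ?H" unfolding edges_power_hypergraph E by auto
  moreover have "distinct ?es"
    using comp_inj_on[OF inj inj_on_subset[OF inj_power_edge subset_UNIV], of k]
    by (simp add: distinct_map o_def lessThan_atLeast0)
  moreover have "\<forall>j<m. ?vs ! j \<in> ?es ! j \<and> ?vs ! Suc j \<in> ?es ! j" using vs(2) by simp
  moreover have "\<forall>j\<in>{1..<m}. degree ?H (?vs ! j) = 2"
  proof
    fix j assume j: "j \<in> {1..<m}"
    then have "{i. i \<le> m \<and> (i = Suc j \<or> Suc i = j)} = {j - 1, Suc j}" "j - 1 \<noteq> Suc j" by auto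
    then show "degree ?H (?vs ! j) = 2" using deg[of j] j vs(2) by simp
  qed
  moreover have "degree ?H v = 1" if m: "m \<ge> 1" and v: "v \<in> verts ?H" "v \<notin> (!) ?vs ` {1..<m}" for v
  proof (cases v)
    case (Inl u)
    then have "u \<in> set vs" using v vs by simp
    then obtain j where j: "j \<le> m" "u = vs ! j" using vs(2) by (auto simp: in_set_conv_nth less_Suc_eq_le)
    have "j \<notin> {1..<m}" using v(2) j vs(2) Inl by (auto simp: image_iff)
    then have "j = 0 \<or> j = m" using j by auto
    then have "{i. i \<le> m \<and> (i = Suc j \<or> Suc i = j)} = {if j = 0 then 1 else m - 1}" using m by auto
    then show ?thesis using deg[OF j(1)] Inl j(2) by simp
  next
    case (Inr p)
    then obtain e j where p: "v = Inr (e, j)" "e \<in> edges G" "j \<in> {1..k - 2}" using v by (cases p) auto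
    then show ?thesis using degree_power_Inr[OF G k] by blast
  qed
  moreover have "length ?vs = Suc m" "length ?es = m" using vs(2) by auto
  moreover have "card (edges ?H) = m" using cE by (simp add: card_edges_power_hypergraph)
  ultimately show ?thesis using H cVH unfolding is_loose_path_def by blast
qed

text \<open>In a tree with maximum degree at most two, a longest path passes through every vertex.\<close>

lemma tree_power_is_loose_path:
  assumes T: "tree T" and k: "k \<ge> 3" and m: "card (edges T) = m"
    and deg: "\<And>u. u \<in> verts T \<Longrightarrow> card (nbrs T u) \<le> 2"
  shows "is_loose_path (m * (k - 1) + 1) k (power_hypergraph k T)"
proof -
  note U = tree_uniform[OF T]
  define pth where "pth vs \<longleftrightarrow> vs \<noteq> [] \<and> distinct vs \<and> set vs \<subseteq> verts T \<and>
    (\<forall>i. Suc i < length vs \<longrightarrow> vs ! Suc i \<in> nbrs T (vs ! i))" for vs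
  obtain r where r: "r \<in> verts T" using U by (auto simp: uniform_hypergraph_def)
  have "pth [r]" using r by (simp add: pth_def)
  moreover have "\<forall>vs. pth vs \<longrightarrow> length vs < Suc (card (verts T))"
  proof (intro allI impI)
    fix vs assume "pth vs"
    then have vs: "distinct vs" "set vs \<subseteq> verts T" by (simp_all add: pth_def)
    have "length vs = card (set vs)" using distinct_card[OF vs(1)] by simp
    also have "\<dots> \<le> card (verts T)" by (rule card_mono[OF finite_verts[OF U] vs(2)])
    finally show "length vs < Suc (card (verts T))" by simp
  qed
  ultimately obtain vs where vs: "pth vs" and max: "\<And>ws. pth ws \<Longrightarrow> length ws \<le> length vs"
    using ex_has_greatest_nat[of pth "[r]" length] by blast
  have ne: "vs \<noteq> []" and dist: "distinct vs" and sub: "set vs \<subseteq> verts T"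
    and adj: "\<And>i. Suc i < length vs \<Longrightarrow> vs ! Suc i \<in> nbrs T (vs ! i)" using vs by (auto simp: pth_def)
  have "set vs = verts T"
  proof (rule connected_closed_eq_verts[OF U tree_connected[OF T] _ sub])
    show "hd vs \<in> set vs" using ne by simp
    fix u w assume u: "u \<in> set vs" and w: "w \<in> nbrs T u"
    have wV: "w \<in> verts T" using w nbrs_subset[OF U] by blast
    obtain i where i: "i < length vs" "u = vs ! i" using u by (auto simp: in_set_conv_nth)
    show "w \<in> set vs"
    proof (rule ccontr)
      assume wn: "w \<notin> set vs"
      consider "i = 0" | "Suc i = length vs" | "0 < i" "Suc i < length vs" using i by linarith
      then show False
      proof cases
        case 1
        have "pth (w # vs)"
          unfolding pth_def
        proof (intro conjI allI impI)
          fix j assume j: "Suc j < length (w # vs)"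
          show "(w # vs) ! Suc j \<in> nbrs T ((w # vs) ! j)"
            using j adj w i 1 nbrs_sym[of w T u] by (cases j) auto
        qed (use wn wV dist sub in auto)
        then show False using max[of "w # vs"] by simp
      next
        case 2
        have "pth (vs @ [w])"
          unfolding pth_def
        proof (intro conjI allI impI)
          fix j assume j: "Suc j < length (vs @ [w])"
          show "(vs @ [w]) ! Suc j \<in> nbrs T ((vs @ [w]) ! j)"
          proof (cases "Suc j < length vs")
            case True
            then show ?thesis using adj[of j] by (simp add: nth_append)
          next
            case False
            then have "j = i" using j 2 by simp
            then show ?thesis using 2 w i by (simp add: nth_append)
          qed
        qed (use wn wV dist sub in auto)
        then show False using max[of "vs @ [w]"] by simp
      next
        case 3
        have "vs ! Suc i \<in> nbrs T u" using adj[of i] 3 i by simp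
        moreover have "vs ! (i - 1) \<in> nbrs T u" using adj[of "i - 1"] 3 i nbrs_sym by fastforce
        ultimately have "{vs ! (i - 1), vs ! Suc i, w} \<subseteq> nbrs T u" using w by blast
        then have "card {vs ! (i - 1), vs ! Suc i, w} \<le> card (nbrs T u)"
          by (rule card_mono[OF finite_nbrs[OF U]])
        moreover have "vs ! (i - 1) \<noteq> vs ! Suc i" using dist 3 by (simp add: nth_eq_iff_index_eq)
        moreover have "vs ! (i - 1) \<noteq> w" "vs ! Suc i \<noteq> w" using wn 3 by auto
        ultimately show False using deg[of u] sub u by auto
      qed
    qed
  qed
  have len: "length vs = Suc m"
    using \<open>set vs = verts T\<close> dist tree_card_verts[OF T] m distinct_card by metis
  have "(\<lambda>i. {vs ! i, vs ! Suc i}) ` {..<m} = edges T"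
  proof (rule card_subset_eq[OF finite_edges[OF U]])
    show "(\<lambda>i. {vs ! i, vs ! Suc i}) ` {..<m} \<subseteq> edges T" using adj len by (auto simp: nbrs_def)
    have "inj_on (\<lambda>i. {vs ! i, vs ! Suc i}) {..<m}"
      using dist len by (intro inj_onI) (auto simp: doubleton_eq_iff nth_eq_iff_index_eq)
    then show "card ((\<lambda>i. {vs ! i, vs ! Suc i}) ` {..<m}) = card (edges T)" using m by (simp add: card_image)
  qed
  then show ?thesis
    using power_is_loose_path[OF U k dist len \<open>set vs = verts T\<close>] by simp
qed

lemma path_graph_power_is_loose_path:
  assumes k: "k \<ge> 3"
  shows "is_loose_path (m * (k - 1) + 1) k (power_hypergraph k (path_graph m))"
proof (rule power_is_loose_path[OF path_graph_uniform k, of "[0..<Suc m]"])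
  show "edges (path_graph m) = (\<lambda>i. {[0..<Suc m] ! i, [0..<Suc m] ! Suc i}) ` {..<m}"
    by (auto simp: path_graph_def simp del: upt_Suc intro!: image_cong)
qed (auto simp: path_graph_def)

lemma star_graph_power_is_hyperstar:
  assumes k: "k \<ge> 3"
  shows "is_hyperstar (m * (k - 1) + 1) k (power_hypergraph k (star_graph m))"
proof (rule power_is_hyperstar[OF star_graph_uniform k, of _ _ 0])
  show "card (edges (star_graph m)) = m"
    by (simp add: star_graph_def card_image inj_on_def doubleton_eq_iff)
  show "card (nbrs (star_graph m) 0) = m" by (simp add: nbrs_star_graph)
qed (auto simp: star_graph_def)

section \<open>The extremal power hypergraphs\<close>

lemma card_nbrs_less_if_power_not_hyperstar:
  assumes T: "tree T" and k: "k \<ge> 3" and m: "card (edges T) = m"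
    and not: "\<not> is_hyperstar (m * (k - 1) + 1) k (power_hypergraph k T)" and u: "u \<in> verts T"
  shows "card (nbrs T u) < m"
proof -
  have "card (verts T) = Suc m" using tree_card_verts[OF T] m by simp
  then have "card (nbrs T u) \<noteq> m" using power_is_hyperstar[OF tree_uniform[OF T] k _ m u] not by blast
  then show ?thesis using card_nbrs_le[OF T, of u] m by linarith
qed

theorem theorem2:
  fixes k n :: nat
    and T :: "'a hypergraph" and P :: "'b hypergraph" and S :: "'c hypergraph"
  assumes "k \<ge> 3"
    and "tree T"
    and "card (verts (power_hypergraph k T)) = n"
    and "is_loose_path n k P"
    and "is_hyperstar n k S"
  shows
    "(rho_A k P \<le> rho_A k (power_hypergraph k T) \<and>
      rho_A k (power_hypergraph k T) \<le> rho_A k S) \<and>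
     (rho_Q k P \<le> rho_Q k (power_hypergraph k T) \<and>
      rho_Q k (power_hypergraph k T) \<le> rho_Q k S) \<and>
     (rho_Q_star k P \<le> rho_Q_star k (power_hypergraph k T) \<and>
      rho_Q_star k (power_hypergraph k T) \<le> rho_Q_star k S) \<and>
     (rho_A k P = rho_A k (power_hypergraph k T) \<longleftrightarrow> isomorphic (power_hypergraph k T) P) \<and>
     (rho_Q k P = rho_Q k (power_hypergraph k T) \<longleftrightarrow> isomorphic (power_hypergraph k T) P) \<and>
     (rho_Q_star k P = rho_Q_star k (power_hypergraph k T) \<longleftrightarrow> isomorphic (power_hypergraph k T) P) \<and>
     (rho_A k (power_hypergraph k T) = rho_A k S \<longleftrightarrow> isomorphic (power_hypergraph k T) S) \<and>
     (rho_Q k (power_hypergraph k T) = rho_Q k S \<longleftrightarrow> isomorphic (power_hypergraph k T) S) \<and>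
     (rho_Q_star k (power_hypergraph k T) = rho_Q_star k S \<longleftrightarrow> isomorphic (power_hypergraph k T) S)"
proof -
  note k = assms(1) and T = assms(2)
  let ?H = "power_hypergraph k T"
  define m where "m = card (edges T)"
  let ?P = "power_hypergraph k (path_graph m)" and ?S = "power_hypergraph k (star_graph m)"
  note UT = tree_uniform[OF T]
  have k1: "1 \<le> k" "2 \<le> k" using k by auto
  have n: "n = m * (k - 1) + 1"
    using card_verts_power_hypergraph[OF UT k] tree_card_verts[OF T] assms(3) power_order_eq[OF k, of m] by (simp add: m_def)
  have P: "is_loose_path (m * (k - 1) + 1) k P" and S: "is_hyperstar (m * (k - 1) + 1) k S"
    using assms(4,5) n by simp_all
  have UH: "uniform_hypergraph k ?H" by (rule uniform_power_hypergraph[OF UT k])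
  have UP: "uniform_hypergraph k ?P" and US: "uniform_hypergraph k ?S"
    using uniform_power_hypergraph[OF path_graph_uniform k] uniform_power_hypergraph[OF star_graph_uniform k] by auto
  note rhoP = isomorphic_imp_spectral_radii_eq[OF loose_paths_isomorphic[OF path_graph_power_is_loose_path[OF k] P k1(2)] UP k1(1)]
  note rhoS = isomorphic_imp_spectral_radii_eq[OF hyperstars_isomorphic[OF star_graph_power_is_hyperstar[OF k] S k1(2)] US k1(1)]
  note isoP = isomorphic_imp_spectral_radii_eq[OF _ UH k1(1), of P]
  note isoS = isomorphic_imp_spectral_radii_eq[OF _ UH k1(1), of S]
  have strictP: "1 \<le> m \<and> (\<exists>u\<in>verts T. 3 \<le> card (nbrs T u))" if "\<not> isomorphic ?H P"
  proof -
    have "\<not> is_loose_path (m * (k - 1) + 1) k ?H"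
      using that loose_paths_isomorphic[OF _ P k1(2)] by blast
    then obtain u where u: "u \<in> verts T" "\<not> card (nbrs T u) \<le> 2"
      using tree_power_is_loose_path[OF T k m_def[symmetric]] by blast
    moreover have "card (nbrs T u) \<le> m" using card_nbrs_le[OF T] by (simp add: m_def)
    ultimately show ?thesis by (intro conjI bexI[of _ u]) linarith+
  qed
  have strictS: "1 \<le> m \<and> (\<forall>u\<in>verts T. card (nbrs T u) < m)" if "\<not> isomorphic ?H S"
  proof -
    have not: "\<not> is_hyperstar (m * (k - 1) + 1) k ?H"
      using that hyperstars_isomorphic[OF _ S k1(2)] by blast
    have small: "\<forall>u\<in>verts T. card (nbrs T u) < m"
      using card_nbrs_less_if_power_not_hyperstar[OF T k m_def[symmetric] not] by blast
    moreover obtain u where "u \<in> verts T" using UT by (auto simp: uniform_hypergraph_def)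
    ultimately have "0 < m" by fastforce
    then show ?thesis using small by simp
  qed
  \<comment> \<open>a tree with a single vertex needs no comparison: its power is both a loose path and a hyperstar\<close>
  have combine: "(rP \<le> rT \<and> rT \<le> rS) \<and> (rP = rT \<longleftrightarrow> isomorphic ?H P) \<and> (rT = rS \<longleftrightarrow> isomorphic ?H S)"
    if "isomorphic ?H P \<Longrightarrow> rT = rP" "isomorphic ?H S \<Longrightarrow> rT = rS"
      "1 \<le> m \<Longrightarrow> \<exists>u\<in>verts T. 3 \<le> card (nbrs T u) \<Longrightarrow> rP < rT"
      "1 \<le> m \<Longrightarrow> \<forall>u\<in>verts T. card (nbrs T u) < m \<Longrightarrow> rT < rS" for rP rT rS :: real
  proof -
    have "isomorphic ?H P \<and> rT = rP \<or> \<not> isomorphic ?H P \<and> rP < rT" using that(1,3) strictP by blast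
    moreover have "isomorphic ?H S \<and> rT = rS \<or> \<not> isomorphic ?H S \<and> rT < rS" using that(2,4) strictS by blast
    ultimately show ?thesis by auto
  qed
  have A: "(\<exists>u\<in>verts T. 3 \<le> card (nbrs T u)) \<longrightarrow> rho_A k ?P < rho_A k ?H"
    "(\<forall>u\<in>verts T. card (nbrs T u) < m) \<longrightarrow> rho_A k ?H < rho_A k ?S" if m: "1 \<le> m"
  proof -
    interpret ratio_function "degree_adjacency_ratio k 0" 1
      by (rule ratio_function_degree_adjacency[OF k]) simp
    obtain tP xP tT xT tS xS where t: "1 \<le> tP" "1 \<le> tT" "1 \<le> tS"
      and x: "ratio_solution (degree_adjacency_ratio k 0 tP) (path_graph m) xP"
        "ratio_solution (degree_adjacency_ratio k 0 tT) T xT"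
        "ratio_solution (degree_adjacency_ratio k 0 tS) (star_graph m) xS"
      and less: "(\<exists>u\<in>verts T. 3 \<le> card (nbrs T u)) \<longrightarrow> tP < tT"
        "(\<forall>u\<in>verts T. card (nbrs T u) < m) \<longrightarrow> tT < tS"
      by (rule extremal_parameters[OF T m_def[symmetric] m star_bound_adjacency[OF T k m_def[symmetric] m]])
    have mono: "a\<^sup>2 < b\<^sup>2" if "a < b" "1 \<le> a" for a b :: real using that by (intro power_strict_mono) auto
    have rho: "rho_A k ?P = tP\<^sup>2" "rho_A k ?H = tT\<^sup>2" "rho_A k ?S = tS\<^sup>2"
      using rho_A_power_hypergraph[OF path_graph_uniform k x(1)] rho_A_power_hypergraph[OF UT k x(2)]
        rho_A_power_hypergraph[OF star_graph_uniform k x(3)] t by simp_all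
    show "(\<exists>u\<in>verts T. 3 \<le> card (nbrs T u)) \<longrightarrow> rho_A k ?P < rho_A k ?H"
      unfolding rho by (intro impI mono[OF _ t(1)]) (erule less(1)[THEN mp])
    show "(\<forall>u\<in>verts T. card (nbrs T u) < m) \<longrightarrow> rho_A k ?H < rho_A k ?S"
      unfolding rho by (intro impI mono[OF _ t(2)]) (erule less(2)[THEN mp])
  qed
  have Q: "(\<exists>u\<in>verts T. 3 \<le> card (nbrs T u)) \<longrightarrow> rho_Q k ?P < rho_Q k ?H"
    "(\<forall>u\<in>verts T. card (nbrs T u) < m) \<longrightarrow> rho_Q k ?H < rho_Q k ?S" if m: "1 \<le> m"
  proof -
    interpret ratio_function "degree_adjacency_ratio k 1" 1
      by (rule ratio_function_degree_adjacency[OF k]) simp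
    obtain tP xP tT xT tS xS where t: "1 \<le> tP" "1 \<le> tT" "1 \<le> tS"
      and x: "ratio_solution (degree_adjacency_ratio k 1 tP) (path_graph m) xP"
        "ratio_solution (degree_adjacency_ratio k 1 tT) T xT"
        "ratio_solution (degree_adjacency_ratio k 1 tS) (star_graph m) xS"
      and less: "(\<exists>u\<in>verts T. 3 \<le> card (nbrs T u)) \<longrightarrow> tP < tT"
        "(\<forall>u\<in>verts T. card (nbrs T u) < m) \<longrightarrow> tT < tS"
      by (rule extremal_parameters[OF T m_def[symmetric] m star_bound_signless_laplacian[OF T k m_def[symmetric] m]])
    have mono: "1 + a\<^sup>2 < 1 + b\<^sup>2" if "a < b" "1 \<le> a" for a b :: real
      using that power_strict_mono[of a b 2] by simp
    have rho: "rho_Q k ?P = 1 + tP\<^sup>2" "rho_Q k ?H = 1 + tT\<^sup>2" "rho_Q k ?S = 1 + tS\<^sup>2"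
      using rho_Q_power_hypergraph[OF path_graph_uniform k x(1)] rho_Q_power_hypergraph[OF UT k x(2)]
        rho_Q_power_hypergraph[OF star_graph_uniform k x(3)] t by simp_all
    show "(\<exists>u\<in>verts T. 3 \<le> card (nbrs T u)) \<longrightarrow> rho_Q k ?P < rho_Q k ?H"
      unfolding rho by (intro impI mono[OF _ t(1)]) (erule less(1)[THEN mp])
    show "(\<forall>u\<in>verts T. card (nbrs T u) < m) \<longrightarrow> rho_Q k ?H < rho_Q k ?S"
      unfolding rho by (intro impI mono[OF _ t(2)]) (erule less(2)[THEN mp])
  qed
  have Qs: "(\<exists>u\<in>verts T. 3 \<le> card (nbrs T u)) \<longrightarrow> rho_Q_star k ?P < rho_Q_star k ?H"
    "(\<forall>u\<in>verts T. card (nbrs T u) < m) \<longrightarrow> rho_Q_star k ?H < rho_Q_star k ?S" if m: "1 \<le> m"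
  proof -
    interpret ratio_function "incidence_ratio k" 2 by (rule ratio_function_incidence[OF k])
    obtain tP xP tT xT tS xS where t: "2 \<le> tP" "2 \<le> tT" "2 \<le> tS"
      and x: "ratio_solution (incidence_ratio k tP) (path_graph m) xP"
        "ratio_solution (incidence_ratio k tT) T xT"
        "ratio_solution (incidence_ratio k tS) (star_graph m) xS"
      and less: "(\<exists>u\<in>verts T. 3 \<le> card (nbrs T u)) \<longrightarrow> tP < tT"
        "(\<forall>u\<in>verts T. card (nbrs T u) < m) \<longrightarrow> tT < tS"
      by (rule extremal_parameters[OF T m_def[symmetric] m star_bound_incidence[OF T k m_def[symmetric] m]])
    have mono: "(a + real (k - 2)) ^ (k - 1) < (b + real (k - 2)) ^ (k - 1)" if "a < b" "2 \<le> a" for a b :: real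
      using that k by (intro power_strict_mono) auto
    have rho: "rho_Q_star k ?P = (tP + real (k - 2)) ^ (k - 1)" "rho_Q_star k ?H = (tT + real (k - 2)) ^ (k - 1)"
      "rho_Q_star k ?S = (tS + real (k - 2)) ^ (k - 1)"
      using rho_Q_star_power_hypergraph[OF path_graph_uniform k x(1)] rho_Q_star_power_hypergraph[OF UT k x(2)]
        rho_Q_star_power_hypergraph[OF star_graph_uniform k x(3)] t by simp_all
    show "(\<exists>u\<in>verts T. 3 \<le> card (nbrs T u)) \<longrightarrow> rho_Q_star k ?P < rho_Q_star k ?H"
      unfolding rho by (intro impI mono[OF _ t(1)]) (erule less(1)[THEN mp])
    show "(\<forall>u\<in>verts T. card (nbrs T u) < m) \<longrightarrow> rho_Q_star k ?H < rho_Q_star k ?S"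
      unfolding rho by (intro impI mono[OF _ t(2)]) (erule less(2)[THEN mp])
  qed
  have 1: "(rho_A k P \<le> rho_A k ?H \<and> rho_A k ?H \<le> rho_A k S) \<and>
      (rho_A k P = rho_A k ?H \<longleftrightarrow> isomorphic ?H P) \<and> (rho_A k ?H = rho_A k S \<longleftrightarrow> isomorphic ?H S)"
    by (rule combine[OF isoP(1) isoS(1)]) (use A in \<open>unfold rhoP rhoS, blast+\<close>)
  have 2: "(rho_Q k P \<le> rho_Q k ?H \<and> rho_Q k ?H \<le> rho_Q k S) \<and>
      (rho_Q k P = rho_Q k ?H \<longleftrightarrow> isomorphic ?H P) \<and> (rho_Q k ?H = rho_Q k S \<longleftrightarrow> isomorphic ?H S)"
    by (rule combine[OF isoP(2) isoS(2)]) (use Q in \<open>unfold rhoP rhoS, blast+\<close>)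
  have 3: "(rho_Q_star k P \<le> rho_Q_star k ?H \<and> rho_Q_star k ?H \<le> rho_Q_star k S) \<and>
      (rho_Q_star k P = rho_Q_star k ?H \<longleftrightarrow> isomorphic ?H P) \<and>
      (rho_Q_star k ?H = rho_Q_star k S \<longleftrightarrow> isomorphic ?H S)"
    by (rule combine[OF isoP(3) isoS(3)]) (use Qs in \<open>unfold rhoP rhoS, blast+\<close>)
  show ?thesis using 1 2 3 by (elim conjE) (intro conjI; assumption)
qed

end
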